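(* Let $X=(W,Q,\pi,I)\in\mathscr D_{fin}$ with $\pi=w_0$ (the longest element of $W$). If $\Gamma_X$ is of tree type (its underlying graph is a tree), then for any special vertex $i$ of $\Gamma_X$, the flip $X\overset{\{i,i'\}}{\longrightarrow}Y=(W,Q,\pi,(I\setminus\{i\})\cup\{i'\})$ induces an isomorphism of algebras from $\mathcal H(\mathcal S_X)$ to $\mathcal H(\mathcal S_Y)$; that is, the Hall algebras attached to the source and the target of the flip are isomorphic as algebras.
   Context: $k$ is a field containing $\mathbb Z$; algebras are over $k$. Quadruples. For a Coxeter group $W$ of finite rank with simple reflections $s_1,\dots,s_n$, let $V$ be the real vector space with basis the simple roots $\alpha_1,\dots,\alpha_n$, with the form $\langle\alpha_i,\alpha_j\rangle=-\cos(\pi/\operatorname{ord}(s_is_j))$ and the usual geometric action of $W$. Write $[m]=\{1,\dots,m\}$. For a word $Q=s_{i_1}\cdots s_{i_m}$ and $\pi\in W$, the subword complex $\mathcal{SC}_W(Q,\pi)$ has as faces the subsets $I\subseteq[m]$ such that the subword of $Q$ at positions $[m]\setminus I$ contains a reduced expression of $\pi$. A quadruple is $X=(W,Q,\pi,I)$ with $I$ a maximal face of $\mathcal{SC}_W(Q,\pi)$. The root function is $r_X(l)=\big(\prod_{j\in[l-1]\setminus I}s_{i_j}\big)(\alpha_{i_l})$, $l\in[m]$ (product in increasing order of $j$). $X$ is irreducible if $\{r_X(i)\}_{i\in I}$ spans $V$; it is moreover root independent if $\{r_X(i)\}_{i\in I}$ is a basis of $V$. $\mathscr D_{fin}$ consists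 of the root independent irreducible quadruples with $W$ finite. Root configuration quiver. $\Gamma_X$ has vertex set (labelled by) $I$, and there is a (single) arrow $i\to j$ if and only if $(i-j)\cdot\langle r_X(i),r_X(j)\rangle>0$. The subobjects of $X$ are indexed by subsets $J\subseteq I$; the subobject $X(J)$ has root configuration quiver $\Gamma_{X(J)}$, identified with the full subquiver of $\Gamma_X$ on $J$. Flips. The flat of a subspace $U\subseteq V$ is $\{l\in[m]:r_X(l)\in U\}$. For $i\in I$, $i'$ denotes the unique index in $[m]\setminus I$ such that $\{i,i'\}$ is a flippable flat of $X$, i.e. such that $\{i,i'\}$ is the flat of the line $\mathbb R r_X(i)$. The flip of $X$ by $\{i,i'\}$ replaces the maximal face $I$ by $(I\setminus\{i\})\cup\{i'\}$. The reflection interval of the flip is $[i,i']$ if $i<i'$ and $[i',i]$ if $i'<i$; the stable interval is its complement in $[m]$. A vertex $i$ of $\Gamma_X$ is special if the vertices adjacent to $i$ in $\Gamma_X$ are either all in the reflection interval or all in the stable interval of the flip $\{i,i'\}$. $\mathcal S_X$: objects are finite disjoint unions $\bigsqcup_{i=1}^t\Gamma_{X(J_i)}$ of labelled quivers, $J_i\subseteq I$ (repetitions allowed); morphisms $A\to B$ are label-preserving partial isomorphisms, i.e. diagrams $A\hookleftarrow P\hookrightarrow B$ given by an $I$-labelled quiver $P$ identified, preserving labels, with a (full) subquiver of $A$ and of $B$; composition is by intersection in the middle object. Proto-exact structure (for $\Gamma_X$ a tree). For $a,b\in I$ put $a\preceq b$ iff there is a path from $b$ to $a$ in $\Gamma_X$.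 For $J\subseteq H\subseteq I$, $\Gamma_{X(J)}\hookleftarrow\Gamma_{X(J)}\hookrightarrow\Gamma_{X(H)}$ is a basic admissible monomorphism iff $\{b\in H\mid b\preceq a\}\subseteq J$ for all $a\in J$; for $K\subseteq H$, $\Gamma_{X(H)}\hookleftarrow\Gamma_{X(K)}\hookrightarrow\Gamma_{X(K)}$ is a basic admissible epimorphism iff $\{b\in H\mid a\preceq b\}\subseteq K$ for all $a\in K$. Admissible monomorphisms (epimorphisms) are finite disjoint unions of basic ones. An admissible proto-exact sequence $A\to B\to C$ is an admissible monomorphism $A\to B$ and an admissible epimorphism $B\to C$ forming with $A\to0\to C$ a biCartesian square. $\operatorname{Ext}_{\mathcal S_X}(C,A)_B$ is the set of equivalence classes (isomorphism of middle terms inducing identities on $A$ and $C$) of admissible proto-exact sequences $A\to B'\to C$ with $B'\cong B$. $\mathcal H(\mathcal S_X)$ is the $k$-vector space on isomorphism classes of objects of $\mathcal S_X$ with product $[\Gamma_1]\cdot[\Gamma_2]=\sum_{K}|\operatorname{Ext}_{\mathcal S_X}(\Gamma_2,\Gamma_1)_K|\,[K]$, $K$ over isomorphism classes. $\mathcal S_Y$ and $\mathcal H(\mathcal S_Y)$ are defined in the same way from $Y$ and $\Gamma_Y$. *)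

theory Defs
  imports
    "HOL-Analysis.Analysis"
    "HOL-Algebra.Multiplicative_Group"
    "HOL-Algebra.Generated_Groups"
    "HOL-Algebra.Module"
    "HOL-Algebra.QuotRing"
    "HOL-Library.Sublist"
begin

section \<open>Coxeter groups and the geometric representation\<close>

definition word_prod :: "('w, 'z) monoid_scheme \<Rightarrow> ('n \<Rightarrow> 'w) \<Rightarrow> 'n list \<Rightarrow> 'w" where
  "word_prod G s w = foldr (\<lambda>i x. s i \<otimes>\<^bsub>G\<^esub> x) w \<one>\<^bsub>G\<^esub>"

text \<open>Deletion of one relator \<open>(i j)^(m i j)\<close>; the value \<open>m i j = 0\<close> stands for infinite order
  and gives no relation, in accordance with \<^const>\<open>group.ord\<close>.\<close>
definition relator_step :: "('n \<Rightarrow> 'n \<Rightarrow> nat) \<Rightarrow> 'n list \<Rightarrow> 'n list \<Rightarrow> bool" where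
  "relator_step m u v \<longleftrightarrow>
    (\<exists>p q i j. u = p @ concat (replicate (m i j) [i, j]) @ q \<and> v = p @ q)"

text \<open>\<open>G\<close> is presented by the generators \<open>s i\<close> and the relators \<open>(s i s j)^ord(s i s j)\<close>.
  The relators with \<open>i = j\<close> are the squares \<open>i i\<close>, so every generator is its own inverse and
  positive words suffice.\<close>
definition coxeter_system :: "('w, 'z) monoid_scheme \<Rightarrow> ('n \<Rightarrow> 'w) \<Rightarrow> bool" where
  "coxeter_system G s \<longleftrightarrow>
     group G \<and> range s \<subseteq> carrier G \<and> inj s \<and>
     (\<forall>i. s i \<noteq> \<one>\<^bsub>G\<^esub> \<and> s i \<otimes>\<^bsub>G\<^esub> s i = \<one>\<^bsub>G\<^esub>) \<and>
     generate G (range s) = carrier G \<and>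
     (\<forall>w. word_prod G s w = \<one>\<^bsub>G\<^esub> \<longrightarrow>
        equivclp (relator_step (\<lambda>i j. group.ord G (s i \<otimes>\<^bsub>G\<^esub> s j))) w [])"

definition cox_length :: "('w, 'z) monoid_scheme \<Rightarrow> ('n \<Rightarrow> 'w) \<Rightarrow> 'w \<Rightarrow> nat" where
  "cox_length G s g = (LEAST k. \<exists>w. length w = k \<and> word_prod G s w = g)"

definition reduced_expression :: "('w, 'z) monoid_scheme \<Rightarrow> ('n \<Rightarrow> 'w) \<Rightarrow> 'n list \<Rightarrow> 'w \<Rightarrow> bool" where
  "reduced_expression G s w g \<longleftrightarrow> word_prod G s w = g \<and> length w = cox_length G s g"

definition longest_element :: "('w, 'z) monoid_scheme \<Rightarrow> ('n \<Rightarrow> 'w) \<Rightarrow> 'w \<Rightarrow> bool" where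
  "longest_element G s g \<longleftrightarrow>
     g \<in> carrier G \<and> (\<forall>h\<in>carrier G. cox_length G s h \<le> cox_length G s g)"

definition simple_root :: "'n \<Rightarrow> real ^ 'n" where
  "simple_root i = axis i 1"

text \<open>The bilinear form with \<open>\<langle>\<alpha>\<^sub>i, \<alpha>\<^sub>j\<rangle> = - cos (\<pi> / ord(s i s j))\<close>. For infinite order
  \<^const>\<open>group.ord\<close> is \<open>0\<close> and the entry is \<open>- cos 0 = -1\<close>, as usual.\<close>
definition cox_form ::
  "('w, 'z) monoid_scheme \<Rightarrow> ('n \<Rightarrow> 'w) \<Rightarrow> real ^ 'n \<Rightarrow> real ^ 'n::finite \<Rightarrow> real" where
  "cox_form G s x y =
     (\<Sum>i\<in>UNIV. \<Sum>j\<in>UNIV. x $ i * y $ j * (- cos (pi / real (group.ord G (s i \<otimes>\<^bsub>G\<^esub> s j)))))"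

definition simple_reflection ::
  "('w, 'z) monoid_scheme \<Rightarrow> ('n \<Rightarrow> 'w) \<Rightarrow> 'n \<Rightarrow> real ^ 'n \<Rightarrow> real ^ 'n::finite" where
  "simple_reflection G s i v = v - (2 * cox_form G s (simple_root i) v) *\<^sub>R simple_root i"

text \<open>The geometric action of the element \<open>word_prod G s w\<close>: the leftmost letter acts last.\<close>
definition word_act ::
  "('w, 'z) monoid_scheme \<Rightarrow> ('n \<Rightarrow> 'w) \<Rightarrow> 'n list \<Rightarrow> real ^ 'n \<Rightarrow> real ^ 'n::finite" where
  "word_act G s w v = foldr (simple_reflection G s) w v"


section \<open>Subword complexes and quadruples\<close>

text \<open>Positions in a word are numbered from 1.\<close>

definition positions :: "'n list \<Rightarrow> nat set" where
  "positions Q = {1..length Q}"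

definition letter :: "'n list \<Rightarrow> nat \<Rightarrow> 'n" where
  "letter Q l = Q ! (l - 1)"

definition subword :: "'n list \<Rightarrow> nat set \<Rightarrow> 'n list" where
  "subword Q A = map (letter Q) (filter (\<lambda>j. j \<in> A) [1..<Suc (length Q)])"

definition subword_complex ::
  "('w, 'z) monoid_scheme \<Rightarrow> ('n \<Rightarrow> 'w) \<Rightarrow> 'n list \<Rightarrow> 'w \<Rightarrow> nat set set" where
  "subword_complex G s Q g =
     {I. I \<subseteq> positions Q \<and>
         (\<exists>w. subseq w (subword Q (positions Q - I)) \<and> reduced_expression G s w g)}"

record ('w, 'n) quadruple =
  grp :: "'w monoid"
  gens :: "'n \<Rightarrow> 'w"
  qword :: "'n list"
  elt :: "'w"
  face :: "nat set"

definition is_quadruple :: "('w, 'n) quadruple \<Rightarrow> bool" where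
  "is_quadruple X \<longleftrightarrow>
     coxeter_system (grp X) (gens X) \<and>
     elt X \<in> carrier (grp X) \<and>
     face X \<in> subword_complex (grp X) (gens X) (qword X) (elt X) \<and>
     (\<forall>F\<in>subword_complex (grp X) (gens X) (qword X) (elt X). face X \<subseteq> F \<longrightarrow> F = face X)"

definition root_fun :: "('w, 'n::finite) quadruple \<Rightarrow> nat \<Rightarrow> real ^ 'n" where
  "root_fun X l =
     word_act (grp X) (gens X) (subword (qword X) ({1..<l} - face X))
       (simple_root (letter (qword X) l))"

definition root_form :: "('w, 'n::finite) quadruple \<Rightarrow> nat \<Rightarrow> nat \<Rightarrow> real" where
  "root_form X i j = cox_form (grp X) (gens X) (root_fun X i) (root_fun X j)"

definition irreducible_quadruple :: "('w, 'n::finite) quadruple \<Rightarrow> bool" where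
  "irreducible_quadruple X \<longleftrightarrow> span (root_fun X ` face X) = UNIV"

text \<open>The basis condition is about the family indexed by \<open>face X\<close>, whence injectivity.\<close>
definition root_independent :: "('w, 'n::finite) quadruple \<Rightarrow> bool" where
  "root_independent X \<longleftrightarrow>
     inj_on (root_fun X) (face X) \<and>
     independent (root_fun X ` face X) \<and>
     span (root_fun X ` face X) = UNIV"

definition D_fin :: "('w, 'n::finite) quadruple set" where
  "D_fin = {X. is_quadruple X \<and> irreducible_quadruple X \<and> root_independent X \<and>
               finite (carrier (grp X))}"


section \<open>Quivers, flips and special vertices\<close>

record quiver =
  verts :: "nat set"
  arrows :: "(nat \<times> nat) set"

definition adjacent :: "quiver \<Rightarrow> nat \<Rightarrow> nat \<Rightarrow> bool" where
  "adjacent \<Gamma> a b \<longleftrightarrow> (a, b) \<in> arrows \<Gamma> \<or> (b, a) \<in> arrows \<Gamma>"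

definition root_quiver :: "('w, 'n::finite) quadruple \<Rightarrow> quiver" where
  "root_quiver X =
     \<lparr> verts = face X,
       arrows = {(i, j). i \<in> face X \<and> j \<in> face X \<and> (real i - real j) * root_form X i j > 0} \<rparr>"

text \<open>The underlying undirected graph is a tree: nonempty, connected and without cycles
  (a cycle being a closed walk through at least three distinct vertices).\<close>
definition tree_type :: "quiver \<Rightarrow> bool" where
  "tree_type \<Gamma> \<longleftrightarrow>
     verts \<Gamma> \<noteq> {} \<and>
     (\<forall>a\<in>verts \<Gamma>. \<forall>b\<in>verts \<Gamma>. (adjacent \<Gamma>)\<^sup>*\<^sup>* a b) \<and>
     \<not> (\<exists>vs. length vs \<ge> 3 \<and> distinct vs \<and> set vs \<subseteq> verts \<Gamma> \<and>
           (\<forall>k. Suc k < length vs \<longrightarrow> adjacent \<Gamma> (vs ! k) (vs ! Suc k)) \<and>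
           adjacent \<Gamma> (last vs) (hd vs))"

definition flat :: "('w, 'n::finite) quadruple \<Rightarrow> (real ^ 'n) set \<Rightarrow> nat set" where
  "flat X U = {l \<in> positions (qword X). root_fun X l \<in> U}"

definition flip_partner :: "('w, 'n::finite) quadruple \<Rightarrow> nat \<Rightarrow> nat" where
  "flip_partner X i =
     (THE i'. i' \<in> positions (qword X) - face X \<and> flat X (span {root_fun X i}) = {i, i'})"

definition flip :: "('w, 'n::finite) quadruple \<Rightarrow> nat \<Rightarrow> ('w, 'n) quadruple" where
  "flip X i = X \<lparr> face := (face X - {i}) \<union> {flip_partner X i} \<rparr>"

definition reflection_interval :: "('w, 'n::finite) quadruple \<Rightarrow> nat \<Rightarrow> nat set" where
  "reflection_interval X i = {min i (flip_partner X i)..max i (flip_partner X i)}"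

definition stable_interval :: "('w, 'n::finite) quadruple \<Rightarrow> nat \<Rightarrow> nat set" where
  "stable_interval X i = positions (qword X) - reflection_interval X i"

definition special_vertex :: "('w, 'n::finite) quadruple \<Rightarrow> nat \<Rightarrow> bool" where
  "special_vertex X i \<longleftrightarrow>
     i \<in> verts (root_quiver X) \<and>
     ({j. adjacent (root_quiver X) i j} \<subseteq> reflection_interval X i \<or>
      {j. adjacent (root_quiver X) i j} \<subseteq> stable_interval X i)"


section \<open>The category of disjoint unions of full subquivers\<close>

text \<open>The list \<open>[J\<^sub>0, \<dots>, J\<^sub>r]\<close> of vertex sets represents the disjoint union of the full subquivers
  of \<open>\<Gamma>\<close> on the \<open>J\<^sub>t\<close>. Its vertices are the pairs \<open>(t, j)\<close> with \<open>j \<in> J\<^sub>t\<close>, and \<open>(t, j)\<close> is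
  labelled by \<open>j\<close>.\<close>

type_synonym sobj = "nat set list"
type_synonym smor = "((nat \<times> nat) \<times> (nat \<times> nat)) set"

definition sobjs :: "quiver \<Rightarrow> sobj set" where
  "sobjs \<Gamma> = {A. \<forall>J\<in>set A. J \<subseteq> verts \<Gamma>}"

definition sverts :: "sobj \<Rightarrow> (nat \<times> nat) set" where
  "sverts A = {(t, j). t < length A \<and> j \<in> A ! t}"

definition sarrows :: "quiver \<Rightarrow> sobj \<Rightarrow> ((nat \<times> nat) \<times> (nat \<times> nat)) set" where
  "sarrows \<Gamma> A =
     {(x, y). x \<in> sverts A \<and> y \<in> sverts A \<and> fst x = fst y \<and> (snd x, snd y) \<in> arrows \<Gamma>}"

text \<open>A partial isomorphism \<open>A \<hookleftarrow> P \<hookrightarrow> B\<close> is encoded by the set of pairs formed by the two images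
  of each vertex of \<open>P\<close>: a label-preserving bijection between vertex sets of full subquivers of
  \<open>A\<close> and \<open>B\<close> which preserves and reflects arrows. Composition by intersection in the middle
  object is then \<^term>\<open>f O g\<close> (first \<open>f\<close>, then \<open>g\<close>).\<close>
definition shom :: "quiver \<Rightarrow> sobj \<Rightarrow> sobj \<Rightarrow> smor set" where
  "shom \<Gamma> A B =
     {f. f \<subseteq> sverts A \<times> sverts B \<and> single_valued f \<and> single_valued (f\<inverse>) \<and>
         (\<forall>(x, y)\<in>f. snd x = snd y) \<and>
         (\<forall>(x, y)\<in>f. \<forall>(x', y')\<in>f. (x, x') \<in> sarrows \<Gamma> A \<longleftrightarrow> (y, y') \<in> sarrows \<Gamma> B)}"

definition sid :: "sobj \<Rightarrow> smor" where
  "sid A = Id_on (sverts A)"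

definition siso :: "quiver \<Rightarrow> sobj \<Rightarrow> sobj \<Rightarrow> smor set" where
  "siso \<Gamma> A B = {f \<in> shom \<Gamma> A B. \<exists>g\<in>shom \<Gamma> B A. f O g = sid A \<and> g O f = sid B}"

definition isomorphic_in :: "quiver \<Rightarrow> sobj \<Rightarrow> sobj \<Rightarrow> bool" where
  "isomorphic_in \<Gamma> A B \<longleftrightarrow> siso \<Gamma> A B \<noteq> {}"

text \<open>Squares have top \<open>f : A \<rightarrow> B\<close>, left \<open>g : A \<rightarrow> C\<close>, right \<open>h : B \<rightarrow> D\<close> and bottom
  \<open>k : C \<rightarrow> D\<close>.\<close>

definition commutative_square ::
  "quiver \<Rightarrow> sobj \<Rightarrow> sobj \<Rightarrow> sobj \<Rightarrow> sobj \<Rightarrow> smor \<Rightarrow> smor \<Rightarrow> smor \<Rightarrow> smor \<Rightarrow> bool" where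
  "commutative_square \<Gamma> A B C D f g h k \<longleftrightarrow>
     {A, B, C, D} \<subseteq> sobjs \<Gamma> \<and>
     f \<in> shom \<Gamma> A B \<and> g \<in> shom \<Gamma> A C \<and> h \<in> shom \<Gamma> B D \<and> k \<in> shom \<Gamma> C D \<and>
     f O h = g O k"

definition pullback_square ::
  "quiver \<Rightarrow> sobj \<Rightarrow> sobj \<Rightarrow> sobj \<Rightarrow> sobj \<Rightarrow> smor \<Rightarrow> smor \<Rightarrow> smor \<Rightarrow> smor \<Rightarrow> bool" where
  "pullback_square \<Gamma> A B C D f g h k \<longleftrightarrow>
     commutative_square \<Gamma> A B C D f g h k \<and>
     (\<forall>Z\<in>sobjs \<Gamma>. \<forall>p\<in>shom \<Gamma> Z B. \<forall>q\<in>shom \<Gamma> Z C. p O h = q O k \<longrightarrow>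
        (\<exists>!u. u \<in> shom \<Gamma> Z A \<and> u O f = p \<and> u O g = q))"

definition pushout_square ::
  "quiver \<Rightarrow> sobj \<Rightarrow> sobj \<Rightarrow> sobj \<Rightarrow> sobj \<Rightarrow> smor \<Rightarrow> smor \<Rightarrow> smor \<Rightarrow> smor \<Rightarrow> bool" where
  "pushout_square \<Gamma> A B C D f g h k \<longleftrightarrow>
     commutative_square \<Gamma> A B C D f g h k \<and>
     (\<forall>Z\<in>sobjs \<Gamma>. \<forall>p\<in>shom \<Gamma> B Z. \<forall>q\<in>shom \<Gamma> C Z. f O p = g O q \<longrightarrow>
        (\<exists>!u. u \<in> shom \<Gamma> D Z \<and> h O u = p \<and> k O u = q))"

definition bicartesian_square ::
  "quiver \<Rightarrow> sobj \<Rightarrow> sobj \<Rightarrow> sobj \<Rightarrow> sobj \<Rightarrow> smor \<Rightarrow> smor \<Rightarrow> smor \<Rightarrow> smor \<Rightarrow> bool" where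
  "bicartesian_square \<Gamma> A B C D f g h k \<longleftrightarrow>
     pullback_square \<Gamma> A B C D f g h k \<and> pushout_square \<Gamma> A B C D f g h k"


section \<open>Proto-exact structure and Hall algebra\<close>

definition path_le :: "quiver \<Rightarrow> nat \<Rightarrow> nat \<Rightarrow> bool" where
  "path_le \<Gamma> a b \<longleftrightarrow> (b, a) \<in> (arrows \<Gamma>)\<^sup>*"

definition basic_mono :: "quiver \<Rightarrow> nat set \<Rightarrow> nat set \<Rightarrow> bool" where
  "basic_mono \<Gamma> J H \<longleftrightarrow>
     J \<subseteq> H \<and> H \<subseteq> verts \<Gamma> \<and> (\<forall>a\<in>J. {b \<in> H. path_le \<Gamma> b a} \<subseteq> J)"

definition basic_epi :: "quiver \<Rightarrow> nat set \<Rightarrow> nat set \<Rightarrow> bool" where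
  "basic_epi \<Gamma> H K \<longleftrightarrow>
     K \<subseteq> H \<and> H \<subseteq> verts \<Gamma> \<and> (\<forall>a\<in>K. {b \<in> H. path_le \<Gamma> a b} \<subseteq> K)"

text \<open>Admissible morphisms are the finite disjoint unions of basic ones. Since a labelled quiver
  can be written as such a union in several ways (a disconnected full subquiver is also the
  disjoint union of its components), this is understood up to isomorphism of source and target.\<close>

definition admissible_mono :: "quiver \<Rightarrow> sobj \<Rightarrow> sobj \<Rightarrow> smor \<Rightarrow> bool" where
  "admissible_mono \<Gamma> A B f \<longleftrightarrow>
     (\<exists>ps. (\<forall>(J, H)\<in>set ps. basic_mono \<Gamma> J H) \<and>
        (\<exists>\<alpha>\<in>siso \<Gamma> A (map fst ps). \<exists>\<beta>\<in>siso \<Gamma> (map snd ps) B.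
           f = \<alpha> O sid (map fst ps) O \<beta>))"

definition admissible_epi :: "quiver \<Rightarrow> sobj \<Rightarrow> sobj \<Rightarrow> smor \<Rightarrow> bool" where
  "admissible_epi \<Gamma> B C g \<longleftrightarrow>
     (\<exists>ps. (\<forall>(H, K)\<in>set ps. basic_epi \<Gamma> H K) \<and>
        (\<exists>\<alpha>\<in>siso \<Gamma> B (map fst ps). \<exists>\<beta>\<in>siso \<Gamma> (map snd ps) C.
           g = \<alpha> O sid (map snd ps) O \<beta>))"

text \<open>The zero object is \<open>[]\<close>, and the empty relation is the only morphism from or to it.\<close>
definition admissible_sequence :: "quiver \<Rightarrow> sobj \<Rightarrow> sobj \<Rightarrow> sobj \<Rightarrow> smor \<Rightarrow> smor \<Rightarrow> bool" where
  "admissible_sequence \<Gamma> A B C f g \<longleftrightarrow>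
     admissible_mono \<Gamma> A B f \<and> admissible_epi \<Gamma> B C g \<and>
     bicartesian_square \<Gamma> A B [] C f {} g {}"

definition ext_sequences :: "quiver \<Rightarrow> sobj \<Rightarrow> sobj \<Rightarrow> sobj \<Rightarrow> (sobj \<times> smor \<times> smor) set" where
  "ext_sequences \<Gamma> C A B =
     {(B', f, g). B' \<in> sobjs \<Gamma> \<and> isomorphic_in \<Gamma> B' B \<and> admissible_sequence \<Gamma> A B' C f g}"

definition ext_equiv ::
  "quiver \<Rightarrow> sobj \<Rightarrow> sobj \<Rightarrow> sobj \<Rightarrow> ((sobj \<times> smor \<times> smor) \<times> (sobj \<times> smor \<times> smor)) set" where
  "ext_equiv \<Gamma> C A B =
     {((B1, f1, g1), (B2, f2, g2)).
        (B1, f1, g1) \<in> ext_sequences \<Gamma> C A B \<and> (B2, f2, g2) \<in> ext_sequences \<Gamma> C A B \<and>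
        (\<exists>\<phi>\<in>siso \<Gamma> B1 B2. f1 O \<phi> = f2 \<and> \<phi> O g2 = g1)}"

definition Ext :: "quiver \<Rightarrow> sobj \<Rightarrow> sobj \<Rightarrow> sobj \<Rightarrow> (sobj \<times> smor \<times> smor) set set" where
  "Ext \<Gamma> C A B = ext_sequences \<Gamma> C A B // ext_equiv \<Gamma> C A B"

definition iso_class :: "quiver \<Rightarrow> sobj \<Rightarrow> sobj set" where
  "iso_class \<Gamma> A = {B \<in> sobjs \<Gamma>. isomorphic_in \<Gamma> A B}"

definition iso_classes :: "quiver \<Rightarrow> sobj set set" where
  "iso_classes \<Gamma> = iso_class \<Gamma> ` sobjs \<Gamma>"

definition rep :: "sobj set \<Rightarrow> sobj" where
  "rep K = (SOME A. A \<in> K)"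

text \<open>Elements are the finitely supported functions on isomorphism classes; the product is the
  bilinear extension of \<open>[A] [C] = (\<Sum>K. |Ext(C, A)\<^sub>K| [K])\<close>.\<close>
definition hall_algebra :: "quiver \<Rightarrow> ('k::field_char_0, sobj set \<Rightarrow> 'k) module" where
  "hall_algebra \<Gamma> =
     \<lparr> carrier = {x. finite {K. x K \<noteq> 0} \<and> {K. x K \<noteq> 0} \<subseteq> iso_classes \<Gamma>},
       mult = (\<lambda>x y K. if K \<in> iso_classes \<Gamma> then
                 (\<Sum>A | x A \<noteq> 0. \<Sum>C | y C \<noteq> 0.
                    x A * y C * of_nat (card (Ext \<Gamma> (rep C) (rep A) (rep K)))) else 0),
       one = (\<lambda>K. if K = iso_class \<Gamma> [] then 1 else 0),
       zero = (\<lambda>K. 0),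
       add = (\<lambda>x y K. x K + y K),
       smult = (\<lambda>c x K. c * x K) \<rparr>"

definition algebra_iso ::
  "('k, 'a, 'y) module_scheme \<Rightarrow> ('k, 'b, 'z) module_scheme \<Rightarrow> ('a \<Rightarrow> 'b) set" where
  "algebra_iso A B =
     {\<phi> \<in> ring_iso A B. \<forall>c. \<forall>x\<in>carrier A. \<phi> (c \<odot>\<^bsub>A\<^esub> x) = c \<odot>\<^bsub>B\<^esub> \<phi> x}"

end

theory Submission
  imports Defs
begin

text \<open>The theorem combines two independent facts.

  A flip at a special vertex \<open>i\<close> reverses the arrows at \<open>i\<close> and does nothing else, apart from
  renaming \<open>i\<close> to \<open>i'\<close> (\<open>flip_special_quiver\<close>). The positions outside the face carry a reduced word of
  the longest element, so their roots run through the positive roots, each exactly once; this is what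
  makes \<open>i'\<close> exist and be unique. It rests on the classical theorem that \<open>w\<close> maps the simple root of
  \<open>s\<close> to a nonnegative combination of simple roots when \<open>ws\<close> is longer than \<open>w\<close> (\<open>reduced_nonneg\<close>).
  The flip applies the reflection in \<open>\<beta> = r\<^sub>X(i)\<close> to the roots between \<open>i\<close> and \<open>i'\<close> and replaces \<open>\<beta>\<close>
  by \<open>-\<beta>\<close> (\<open>flip_root_fun\<close>). Between a reflected root and an unreflected one the form can change only
  if neither is orthogonal to \<open>\<beta>\<close>, and this is excluded when \<open>i\<close> is special.

  The Hall algebra of a quiver whose underlying graph is a forest does not depend on the
  orientation, up to isomorphism (\<open>reversal_algebra_iso\<close>). An object is the same as a finite graph
  with vertices labelled by the forest in which the edges over each edge of the forest form a partial
  matching: the components of such a graph are immersed in a forest, hence embedded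
  (\<open>realisation\<close>). An extension of \<open>C\<close> by \<open>A\<close> amounts to adding edges between \<open>A\<close> and \<open>C\<close>
  whose arrows point from \<open>C\<close> to \<open>A\<close> (\<open>card_Ext\<close>). If the arrows over a set \<open>F\<close> of edges are
  reversed, the isomorphism is
  \<open>[A] \<mapsto> (-1)^e(A) \<Sum> [A']\<close>,
  where \<open>e(A)\<close> is the number of edges of \<open>A\<close> over \<open>F\<close> and \<open>A'\<close> runs through the graphs obtained from
  \<open>A\<close> by adding edges over \<open>F\<close>. In the product of the images, the edges over \<open>F\<close> between the two
  factors have exactly the direction that the product in the source forbids; in the image of the
  product, those with the other direction occur with alternating signs and cancel
  (\<open>signed_glue_sum\<close>). The same cancellation shows that the map is inverse to the one in the
  opposite direction (\<open>transition_inverse\<close>).\<close>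

section \<open>Walks in forests\<close>

fun nonbacktracking :: "'a list \<Rightarrow> bool" where
  "nonbacktracking (a # b # c # xs) \<longleftrightarrow> a \<noteq> c \<and> nonbacktracking (b # c # xs)"
| "nonbacktracking _ \<longleftrightarrow> True"

lemma nonbacktracking_tl: "nonbacktracking (a # xs) \<Longrightarrow> nonbacktracking xs"
  by (cases "a # xs" rule: nonbacktracking.cases) auto

lemma nonbacktracking_butlast: "nonbacktracking (xs @ [b]) \<Longrightarrow> nonbacktracking xs"
  by (induction xs rule: nonbacktracking.induct) auto

lemma distinct_nonbacktracking: "distinct xs \<Longrightarrow> nonbacktracking xs"
  by (induction xs rule: nonbacktracking.induct) auto

lemma nonbacktracking_append:
  "\<lbrakk>nonbacktracking (xs @ [b]); nonbacktracking (b # ys); xs \<noteq> [] \<Longrightarrow> ys \<noteq> [] \<Longrightarrow> last xs \<noteq> hd ys\<rbrakk>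
    \<Longrightarrow> nonbacktracking (xs @ b # ys)"
proof (induction xs rule: nonbacktracking.induct)
  case ("2_2" x)
  then show ?case by (cases ys) auto
next
  case ("2_3" x y)
  then show ?case by (cases ys) auto
qed auto

lemma nonbacktracking_mapI:
  assumes "\<And>x y z. r x y \<Longrightarrow> r y z \<Longrightarrow> x \<noteq> z \<Longrightarrow> f x \<noteq> f z"
  shows "successively r xs \<Longrightarrow> distinct xs \<Longrightarrow> nonbacktracking (map f xs)"
proof (induction xs rule: nonbacktracking.induct)
  case (1 a b c xs)
  then show ?case using assms[of a b c] by auto
qed auto

lemma rtrancl_distinct_path:
  "(a, b) \<in> r\<^sup>* \<Longrightarrow>
    \<exists>p. p \<noteq> [] \<and> hd p = a \<and> last p = b \<and> distinct p \<and> successively (\<lambda>x y. (x, y) \<in> r) p"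
proof (induction rule: converse_rtrancl_induct)
  case base
  show ?case by (rule exI[of _ "[b]"]) simp
next
  case (step a c)
  then obtain p where p: "p \<noteq> []" "hd p = c" "last p = b" "distinct p"
    "successively (\<lambda>x y. (x, y) \<in> r) p" by blast
  show ?case
  proof (cases "a \<in> set p")
    case True
    then obtain xs ys where xs: "p = xs @ a # ys" by (auto simp: in_set_conv_decomp)
    then show ?thesis using p by (intro exI[of _ "a # ys"]) (auto simp: successively_append_iff)
  next
    case False
    then show ?thesis using p step(1) by (intro exI[of _ "a # p"]) (auto simp: successively_Cons)
  qed
qed

lemma successively_in_rtrancl:
  "\<lbrakk>successively (\<lambda>x y. (x, y) \<in> r) p; p \<noteq> []; set p \<subseteq> H\<rbrakk> \<Longrightarrow> (hd p, last p) \<in> (r \<inter> H \<times> H)\<^sup>*"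
proof (induction p)
  case (Cons a p)
  show ?case
  proof (cases p)
    case (Cons b p')
    then have "(a, b) \<in> r \<inter> H \<times> H" "(b, last p) \<in> (r \<inter> H \<times> H)\<^sup>*"
      using Cons.IH Cons.prems by auto
    then show ?thesis using Cons by (auto intro: converse_rtrancl_into_rtrancl)
  qed simp
qed simp

text \<open>The edges carry a reference direction, so that an undirected edge is a single pair and edges can be
  counted.\<close>

locale forest =
  fixes L :: "'a set" and R :: "'a rel"
  assumes finite_L: "finite L" and R_L: "R \<subseteq> L \<times> L"
    and R_antisym: "(a, b) \<in> R \<Longrightarrow> (b, a) \<notin> R"
    and acyclic: "\<lbrakk>length vs \<ge> 3; distinct vs; set vs \<subseteq> L;
      successively (\<lambda>a b. (a, b) \<in> R \<union> R\<inverse>) vs; (last vs, hd vs) \<in> R \<union> R\<inverse>\<rbrakk> \<Longrightarrow> False"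
begin

abbreviation "adj a b \<equiv> (a, b) \<in> R \<union> R\<inverse>"

lemma R_irrefl: "(a, a) \<notin> R"
  using R_antisym by blast

lemma walk_subset: "successively adj xs \<Longrightarrow> length xs \<noteq> 1 \<Longrightarrow> set xs \<subseteq> L"
proof (induction xs)
  case IH: (Cons a xs)
  show ?case
  proof (cases xs)
    case Nil
    then show ?thesis using IH.prems by simp
  next
    case (Cons b ys)
    have "a \<in> L" "b \<in> L" using IH.prems(1) R_L Cons by auto
    moreover have "set xs \<subseteq> L" if "ys \<noteq> []"
      using IH.IH IH.prems(1) Cons that by (simp add: successively_Cons)
    ultimately show ?thesis using Cons by (cases ys) auto
  qed
qed simp

text \<open>By induction a walk without its first or without its last vertex has no repetitions, so only
  the two ends can coincide; then the walk is a cycle.\<close>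

lemma nonbacktracking_distinct:
  "successively adj xs \<Longrightarrow> nonbacktracking xs \<Longrightarrow> distinct xs"
proof (induction "length xs" arbitrary: xs rule: less_induct)
  case less
  show ?case
  proof (cases xs)
    case (Cons a us)
    show ?thesis
    proof (cases us rule: rev_cases)
      case Nil then show ?thesis using Cons by simp
    next
      case (snoc ws b)
      have xs: "xs = a # ws @ [b]" using Cons snoc by simp
      have w: "successively adj (a # ws)" "successively adj (ws @ [b])"
        using less.prems(1) unfolding xs
        by (auto simp: successively_append_iff successively_Cons split: if_splits)
      have d: "distinct (a # ws)" "distinct (ws @ [b])"
        using less.hyps[of "a # ws"] less.hyps[of "ws @ [b]"] w less.prems(2)
          nonbacktracking_tl[of a "ws @ [b]"] nonbacktracking_butlast[of "a # ws" b] unfolding xs by auto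
      have "a \<noteq> b"
      proof
        assume ab: "a = b"
        show False
        proof (cases ws rule: rev_cases)
          case Nil
          then show False using less.prems(1) R_irrefl ab unfolding xs by auto
        next
          case (snoc ws' c)
          have ca: "adj c a" using less.prems(1) ab snoc unfolding xs
            by (auto simp: successively_append_iff successively_Cons split: if_splits)
          show False
          proof (cases ws')
            case Nil
            then show False using less.prems(2) ab snoc unfolding xs by simp
          next
            case (Cons d ws'')
            show False
              by (rule acyclic[of "a # ws"]) (use w d ca snoc Cons walk_subset[of "a # ws"] in auto)
          qed
        qed
      qed
      then show ?thesis using d unfolding xs by auto
    qed
  qed simp
qed

text \<open>Where two paths with the same ends separate, going back along one and forth along the other
  never backtracks, and visits the common end twice.\<close>

lemma unique_path:
  "\<lbrakk>successively adj p; successively adj q; distinct p; distinct q; p \<noteq> []; q \<noteq> [];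
    hd p = hd q; last p = last q\<rbrakk> \<Longrightarrow> p = q"
proof (induction p arbitrary: q)
  case (Cons a p')
  obtain q' where q: "q = a # q'" using Cons.prems by (cases q) auto
  show ?case
  proof (cases "p' = [] \<or> q' = []")
    case True
    then show ?thesis using Cons.prems q by (auto split: if_splits)
  next
    case False
    have w: "successively adj p'" "successively adj q'" "adj a (hd p')" "adj a (hd q')"
      using Cons.prems False q by (auto simp: successively_Cons)
    have l: "last p' = last q'" using Cons.prems False q by simp
    show ?thesis
    proof (cases "hd p' = hd q'")
      case True
      then show ?thesis using Cons.IH[of q'] w l Cons.prems False q by auto
    next
      case hd: False
      have sym: "successively (\<lambda>x y. adj y x) p' \<longleftrightarrow> successively adj p'"
        by (rule successively_cong) auto
      let ?w = "rev p' @ a # q'"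
      have "successively adj ?w"
        using w False sym by (auto simp: successively_append_iff successively_Cons last_rev)
      moreover have "nonbacktracking ?w"
        by (rule nonbacktracking_append)
          (use Cons.prems q hd False in \<open>auto intro!: distinct_nonbacktracking simp: last_rev\<close>)
      ultimately have "distinct ?w" by (rule nonbacktracking_distinct)
      moreover have "last q' \<in> set p'" using l False by (metis last_in_set)
      moreover have "last q' \<in> set q'" using False by simp
      ultimately show ?thesis by auto
    qed
  qed
qed simp

text \<open>The undirected path inside \<open>H\<close> is the only path between its ends, so a directed path cannot
  leave \<open>H\<close> and come back. This is why the path order of the whole quiver restricts well to
  connected full subquivers.\<close>

lemma directed_path_in_connected:
  assumes A: "A \<subseteq> R \<union> R\<inverse>" "\<And>x y. (x, y) \<in> A \<Longrightarrow> (y, x) \<notin> A"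
    and path: "(a, b) \<in> A\<^sup>*" and con: "(a, b) \<in> ((R \<union> R\<inverse>) \<inter> H \<times> H)\<^sup>*" and a: "a \<in> H"
  shows "(a, b) \<in> (A \<inter> H \<times> H)\<^sup>*"
proof -
  obtain p where p: "p \<noteq> []" "hd p = a" "last p = b" "distinct p" "successively (\<lambda>x y. (x, y) \<in> A) p"
    using rtrancl_distinct_path[OF path] by blast
  obtain q where q: "q \<noteq> []" "hd q = a" "last q = b" "distinct q"
    "successively (\<lambda>x y. (x, y) \<in> (R \<union> R\<inverse>) \<inter> H \<times> H) q"
    using rtrancl_distinct_path[OF con] by blast
  have "set q \<subseteq> H" using q(5,2,1) a
  proof (induction q arbitrary: a)
    case (Cons x q) then show ?case by (cases q) (auto simp: successively_Cons)
  qed simp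
  moreover have "p = q"
    by (rule unique_path) (use p q A(1) in \<open>auto elim!: successively_mono\<close>)
  ultimately show ?thesis using successively_in_rtrancl[OF p(5,1), of H] p by simp
qed

end

section \<open>Locally injective labelled graphs\<close>

text \<open>Over each edge of the forest the edges of such a graph form a partial matching. As every
  edge of the forest has one direction in \<open>R\<close>, this says that no two neighbours of a vertex have the
  same label.\<close>

definition matched :: "'a set \<Rightarrow> 'a rel \<Rightarrow> ('v \<Rightarrow> 'a) \<Rightarrow> 'v set \<Rightarrow> 'v rel \<Rightarrow> bool" where
  "matched L R l V S \<longleftrightarrow> finite V \<and> l ` V \<subseteq> L \<and> S \<subseteq> V \<times> V \<and>
     (\<forall>u v. (u, v) \<in> S \<longrightarrow> (l u, l v) \<in> R) \<and>
     (\<forall>u v w. (u, v) \<in> S \<and> (u, w) \<in> S \<and> l v = l w \<longrightarrow> v = w) \<and>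
     (\<forall>u v w. (v, u) \<in> S \<and> (w, u) \<in> S \<and> l v = l w \<longrightarrow> v = w)"

lemma matchedD:
  assumes "matched L R l V S"
  shows "finite V" and "l ` V \<subseteq> L" and "S \<subseteq> V \<times> V" and "(u, v) \<in> S \<Longrightarrow> (l u, l v) \<in> R"
    and "(u, v) \<in> S \<Longrightarrow> (u, w) \<in> S \<Longrightarrow> l v = l w \<Longrightarrow> v = w"
    and "(v, u) \<in> S \<Longrightarrow> (w, u) \<in> S \<Longrightarrow> l v = l w \<Longrightarrow> v = w"
  using assms unfolding matched_def by simp_all

lemma matchedI:
  assumes "finite V" "l ` V \<subseteq> L" "S \<subseteq> V \<times> V" "\<And>u v. (u, v) \<in> S \<Longrightarrow> (l u, l v) \<in> R"
    and "\<And>u v w. (u, v) \<in> S \<Longrightarrow> (u, w) \<in> S \<Longrightarrow> l v = l w \<Longrightarrow> v = w"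
    and "\<And>u v w. (v, u) \<in> S \<Longrightarrow> (w, u) \<in> S \<Longrightarrow> l v = l w \<Longrightarrow> v = w"
  shows "matched L R l V S"
  unfolding matched_def
  by (intro conjI allI impI assms(1-3), erule assms(4), elim conjE, erule (2) assms(5),
      elim conjE, erule (2) assms(6))

text \<open>Source and target may have vertices of different types. This allows graphs to be put on sum
  types and graphs of objects over different quivers to be compared.\<close>

definition graph_iso ::
  "('v \<Rightarrow> 'u) \<Rightarrow> ('v \<Rightarrow> 'a) \<Rightarrow> 'v set \<Rightarrow> 'v rel \<Rightarrow> ('u \<Rightarrow> 'a) \<Rightarrow> 'u set \<Rightarrow> 'u rel \<Rightarrow> bool" where
  "graph_iso h l V S l' V' S' \<longleftrightarrow> bij_betw h V V' \<and> (\<forall>v\<in>V. l' (h v) = l v) \<and>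
     (\<forall>u\<in>V. \<forall>v\<in>V. (u, v) \<in> S \<longleftrightarrow> (h u, h v) \<in> S')"

lemma graph_iso_inv:
  assumes "graph_iso h l V S l' V' S'"
  shows "graph_iso (inv_into V h) l' V' S' l V S"
proof -
  have b: "bij_betw h V V'" using assms by (simp add: graph_iso_def)
  have "h (inv_into V h x) = x" "inv_into V h x \<in> V" if "x \<in> V'" for x
    using b that by (auto simp: bij_betw_def f_inv_into_f inv_into_into)
  then show ?thesis using assms bij_betw_inv_into[OF b] unfolding graph_iso_def by metis
qed

lemma graph_iso_comp:
  "graph_iso h l V S l' V' S' \<Longrightarrow> graph_iso k l' V' S' l'' V'' S'' \<Longrightarrow> graph_iso (k \<circ> h) l V S l'' V'' S''"
  unfolding graph_iso_def by (auto intro: bij_betw_trans dest: bij_betwE)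

lemma graph_iso_id: "graph_iso id l V S l V S"
  by (simp add: graph_iso_def)

lemma matched_mono:
  assumes m: "matched L R l V S" and U: "U \<subseteq> V" and S': "S' \<subseteq> S" "S' \<subseteq> U \<times> U"
  shows "matched L R l U S'"
proof (rule matchedI)
  show "finite U" "l ` U \<subseteq> L" "S' \<subseteq> U \<times> U"
    using finite_subset[OF U matchedD(1)[OF m]] matchedD(2)[OF m] U S' by auto
  show "(l u, l v) \<in> R" if "(u, v) \<in> S'" for u v
    using matchedD(4)[OF m] that S' by auto
  show "v = w" if "(u, v) \<in> S'" "(u, w) \<in> S'" "l v = l w" for u v w
    using matchedD(5)[OF m, of u v w] that S' by auto
  show "v = w" if "(v, u) \<in> S'" "(w, u) \<in> S'" "l v = l w" for u v w
    using matchedD(6)[OF m, of v u w] that S' by auto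
qed

lemma matched_subset: "matched L R l V S \<Longrightarrow> S' \<subseteq> S \<Longrightarrow> matched L R l V S'"
  by (rule matched_mono[of L R l V S]) (auto dest: matchedD(3))

lemma matched_restrict: "matched L R l V S \<Longrightarrow> U \<subseteq> V \<Longrightarrow> matched L R l U (S \<inter> U \<times> U)"
  by (rule matched_mono[of L R l V S]) auto

lemma matched_iso:
  assumes iso: "graph_iso h l V S l' V' S'" and S': "S' \<subseteq> V' \<times> V'" and m: "matched L R l V S"
  shows "matched L R l' V' S'"
proof -
  have V': "V' = h ` V" and lab: "\<And>v. v \<in> V \<Longrightarrow> l' (h v) = l v"
    and edge: "\<And>u v. u \<in> V \<Longrightarrow> v \<in> V \<Longrightarrow> (h u, h v) \<in> S' \<Longrightarrow> (u, v) \<in> S"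
    using iso by (auto simp: graph_iso_def bij_betw_def)
  have end1: "x \<in> h ` V" and end2: "y \<in> h ` V" if "(x, y) \<in> S'" for x y
    using that S' V' by auto
  show ?thesis
  proof (rule matchedI)
    show "finite V'" "l' ` V' \<subseteq> L" using matchedD(1,2)[OF m] lab by (auto simp: V')
    show "S' \<subseteq> V' \<times> V'" by (rule S')
    show "(l' x, l' y) \<in> R" if xy: "(x, y) \<in> S'" for x y
    proof -
      obtain u v where uv: "u \<in> V" "v \<in> V" "x = h u" "y = h v" using end1[OF xy] end2[OF xy] by blast
      then show ?thesis using edge[of u v] xy lab matchedD(4)[OF m] by simp
    qed
    show "y = z" if xy: "(x, y) \<in> S'" and xz: "(x, z) \<in> S'" and eq: "l' y = l' z" for x y z
    proof -
      obtain u v where uv: "u \<in> V" "v \<in> V" "x = h u" "y = h v" using end1[OF xy] end2[OF xy] by blast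
      obtain w where w: "w \<in> V" "z = h w" using end2[OF xz] by blast
      have "v = w" by (rule matchedD(5)[OF m, of u]) (use edge uv w xy xz eq lab in auto)
      then show ?thesis using uv w by simp
    qed
    show "y = z" if yx: "(y, x) \<in> S'" and zx: "(z, x) \<in> S'" and eq: "l' y = l' z" for x y z
    proof -
      obtain u v where uv: "u \<in> V" "v \<in> V" "x = h u" "y = h v" using end1[OF yx] end2[OF yx] by blast
      obtain w where w: "w \<in> V" "z = h w" using end1[OF zx] by blast
      have "v = w" by (rule matchedD(6)[OF m, of _ u]) (use edge uv w yx zx eq lab in auto)
      then show ?thesis using uv w by simp
    qed
  qed
qed

context forest
begin

text \<open>A path without repetitions is mapped by the labels to a walk without backtracking, hence to a
  path. So the labels embed each connected component as a full subgraph of the forest.\<close>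

lemma component_embeds:
  assumes m: "matched L R l V S" and uv: "(u, v) \<in> (S \<union> S\<inverse>)\<^sup>*"
  shows "l u = l v \<Longrightarrow> u = v" and "(l u, l v) \<in> R \<Longrightarrow> (u, v) \<in> S"
proof -
  obtain p where p: "p \<noteq> []" "hd p = u" "last p = v" "distinct p"
    "successively (\<lambda>x y. (x, y) \<in> S \<union> S\<inverse>) p"
    using rtrancl_distinct_path[OF uv] by blast
  have lR: "(x, y) \<in> S \<Longrightarrow> (l x, l y) \<in> R" for x y using m by (auto simp: matched_def)
  have walk: "successively adj (map l p)"
    unfolding successively_map using p(5) by (rule successively_mono) (use lR in auto)
  have "nonbacktracking (map l p)"
  proof (rule nonbacktracking_mapI[OF _ p(5,4)])
    fix x y z assume xyz: "(x, y) \<in> S \<union> S\<inverse>" "(y, z) \<in> S \<union> S\<inverse>" "x \<noteq> z"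
    show "l x \<noteq> l z"
    proof
      assume eq: "l x = l z"
      consider "(x, y) \<in> S" "(y, z) \<in> S" | "(y, x) \<in> S" "(z, y) \<in> S"
        | "(x, y) \<in> S" "(z, y) \<in> S" | "(y, x) \<in> S" "(y, z) \<in> S" using xyz by blast
      then show False
      proof cases
        case 1 then show False using lR R_antisym eq by metis
      next
        case 2 then show False using lR R_antisym eq by metis
      next
        case 3 then show False using matchedD(6)[OF m] eq xyz(3) by metis
      next
        case 4 then show False using matchedD(5)[OF m] eq xyz(3) by metis
      qed
    qed
  qed
  from nonbacktracking_distinct[OF walk this] have d: "distinct (map l p)" .
  have ends: "map l p \<noteq> []" "hd (map l p) = l u" "last (map l p) = l v" using p by (auto simp: hd_map last_map)
  show "u = v" if "l u = l v"
  proof -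
    have "map l p = [l u]" by (rule unique_path[OF walk _ d]) (use ends that in auto)
    then show ?thesis using p by (cases p) auto
  qed
  show "(u, v) \<in> S" if R: "(l u, l v) \<in> R"
  proof -
    have "map l p = [l u, l v]" by (rule unique_path[OF walk _ d]) (use ends R R_irrefl in auto)
    then obtain x y where "p = [x, y]" by (cases p; cases "tl p") auto
    then have "(u, v) \<in> S \<union> S\<inverse>" using p by auto
    then show ?thesis using lR R R_antisym by blast
  qed
qed

end

section \<open>Labelled graphs of objects\<close>

definition fgraph :: "'a set \<Rightarrow> ('a \<Rightarrow> 'b) \<Rightarrow> ('a \<times> 'b) set" where
  "fgraph V h = (\<lambda>x. (x, h x)) ` V"

lemma in_fgraph [simp]: "(x, y) \<in> fgraph V h \<longleftrightarrow> x \<in> V \<and> y = h x"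
  by (auto simp: fgraph_def)

lemma Domain_fgraph [simp]: "Domain (fgraph V h) = V" and Range_fgraph [simp]: "Range (fgraph V h) = h ` V"
  by (auto simp: Domain_iff Range_iff)

text \<open>\<open>R\<close> is a reference direction of the edges, and \<open>D\<close> consists of the edges whose arrow in \<open>\<Gamma>\<close>
  follows it. The renaming \<open>\<rho>\<close> lets quivers with different vertex sets share the labels \<open>L\<close>, so that
  one and the same graph can be read as an object over several quivers.\<close>

locale oriented_forest = forest L R for L :: "nat set" and R :: "nat rel" +
  fixes \<Gamma> :: quiver and D :: "nat rel" and \<rho> :: "nat \<Rightarrow> nat"
  assumes D_R: "D \<subseteq> R" and rho: "bij_betw \<rho> L (verts \<Gamma>)"
    and arrows_verts: "arrows \<Gamma> \<subseteq> verts \<Gamma> \<times> verts \<Gamma>"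
    and arrows_iff: "a \<in> L \<Longrightarrow> b \<in> L \<Longrightarrow> (\<rho> a, \<rho> b) \<in> arrows \<Gamma> \<longleftrightarrow> (a, b) \<in> D \<or> (b, a) \<in> R - D"
begin

definition lab :: "nat \<times> nat \<Rightarrow> nat" where "lab x = inv_into L \<rho> (snd x)"

text \<open>The arrows of an object, directed by \<open>R\<close>: this graph does not see the orientation of \<open>\<Gamma>\<close>.\<close>

definition sedges :: "sobj \<Rightarrow> (nat \<times> nat) rel" where
  "sedges A = {(x, y). x \<in> sverts A \<and> y \<in> sverts A \<and> fst x = fst y \<and> (lab x, lab y) \<in> R}"

lemma finite_verts: "finite (verts \<Gamma>)"
  using rho finite_L bij_betw_finite by blast

lemma snd_sverts: "A \<in> sobjs \<Gamma> \<Longrightarrow> x \<in> sverts A \<Longrightarrow> snd x \<in> verts \<Gamma>"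
proof -
  assume "A \<in> sobjs \<Gamma>" "x \<in> sverts A"
  then have "A ! fst x \<in> set A" "snd x \<in> A ! fst x" by (auto simp: sverts_def)
  then show ?thesis using \<open>A \<in> sobjs \<Gamma>\<close> by (auto simp: sobjs_def)
qed

lemma lab_L: "A \<in> sobjs \<Gamma> \<Longrightarrow> x \<in> sverts A \<Longrightarrow> lab x \<in> L"
  using snd_sverts[of A x] rho by (auto simp: lab_def bij_betw_def intro!: inv_into_into)

lemma rho_lab: "A \<in> sobjs \<Gamma> \<Longrightarrow> x \<in> sverts A \<Longrightarrow> \<rho> (lab x) = snd x"
  using snd_sverts[of A x] rho by (auto simp: lab_def bij_betw_def intro!: f_inv_into_f)

lemma lab_rho: "a \<in> L \<Longrightarrow> lab (t, \<rho> a) = a"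
  using rho by (simp add: lab_def bij_betw_def)

lemma lab_eq_iff: "A \<in> sobjs \<Gamma> \<Longrightarrow> x \<in> sverts A \<Longrightarrow> B \<in> sobjs \<Gamma> \<Longrightarrow> y \<in> sverts B \<Longrightarrow>
    lab x = lab y \<longleftrightarrow> snd x = snd y"
  using rho_lab by (metis lab_def)

lemma finite_sverts: "A \<in> sobjs \<Gamma> \<Longrightarrow> finite (sverts A)"
proof -
  assume A: "A \<in> sobjs \<Gamma>"
  have "x \<in> {..<length A} \<times> verts \<Gamma>" if x: "x \<in> sverts A" for x
    using snd_sverts[OF A x] x by (cases x) (simp add: sverts_def)
  then have "sverts A \<subseteq> {..<length A} \<times> verts \<Gamma>" by (rule subsetI)
  then show ?thesis by (rule finite_subset) (simp add: finite_verts)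
qed

lemma matched_sobj: assumes A: "A \<in> sobjs \<Gamma>" shows "matched L R lab (sverts A) (sedges A)"
proof (rule matchedI)
  show "finite (sverts A)" using finite_sverts[OF A] .
  show "lab ` sverts A \<subseteq> L" using lab_L[OF A] by auto
  show "sedges A \<subseteq> sverts A \<times> sverts A" by (auto simp: sedges_def)
  show "(lab u, lab v) \<in> R" if "(u, v) \<in> sedges A" for u v using that by (auto simp: sedges_def)
  show "v = w" if "(u, v) \<in> sedges A" "(u, w) \<in> sedges A" "lab v = lab w" for u v w
    using that lab_eq_iff[OF A _ A, of v w] by (auto simp: sedges_def prod_eq_iff)
  show "v = w" if "(v, u) \<in> sedges A" "(w, u) \<in> sedges A" "lab v = lab w" for u v w
    using that lab_eq_iff[OF A _ A, of v w] by (auto simp: sedges_def prod_eq_iff)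
qed

text \<open>The orientation is recovered from the undirected graph and the labels; morphisms can therefore be
  described by graphs alone.\<close>

lemma sarrows_iff: assumes "A \<in> sobjs \<Gamma>"
  shows "(x, y) \<in> sarrows \<Gamma> A \<longleftrightarrow>
    (x, y) \<in> sedges A \<and> (lab x, lab y) \<in> D \<or> (y, x) \<in> sedges A \<and> (lab y, lab x) \<notin> D"
proof (cases "x \<in> sverts A \<and> y \<in> sverts A")
  case True
  then have "(snd x, snd y) \<in> arrows \<Gamma> \<longleftrightarrow> (lab x, lab y) \<in> D \<or> (lab y, lab x) \<in> R - D"
    using arrows_iff[of "lab x" "lab y"] rho_lab[OF assms] lab_L[OF assms] by simp
  then show ?thesis using True D_R by (auto simp: sarrows_def sedges_def)
qed (auto simp: sarrows_def sedges_def)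

lemma sedges_iff: assumes "A \<in> sobjs \<Gamma>"
  shows "(x, y) \<in> sedges A \<longleftrightarrow> (lab x, lab y) \<in> R \<and> ((x, y) \<in> sarrows \<Gamma> A \<or> (y, x) \<in> sarrows \<Gamma> A)"
  unfolding sarrows_iff[OF assms] using R_antisym by (auto simp: sedges_def)

lemma shomD:
  assumes f: "f \<in> shom \<Gamma> A B" and A: "A \<in> sobjs \<Gamma>" and B: "B \<in> sobjs \<Gamma>"
  shows "(x, y) \<in> f \<Longrightarrow> x \<in> sverts A" and "(x, y) \<in> f \<Longrightarrow> y \<in> sverts B"
    and "(x, y) \<in> f \<Longrightarrow> lab y = lab x"
    and "(x, y) \<in> f \<Longrightarrow> (x, y') \<in> f \<Longrightarrow> y = y'" and "(x, y) \<in> f \<Longrightarrow> (x', y) \<in> f \<Longrightarrow> x = x'"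
    and "(x, y) \<in> f \<Longrightarrow> (x', y') \<in> f \<Longrightarrow> (x, x') \<in> sedges A \<longleftrightarrow> (y, y') \<in> sedges B"
proof -
  show v: "x \<in> sverts A" "y \<in> sverts B" if "(x, y) \<in> f" for x y
    using f that by (auto simp: shom_def)
  show l: "lab y = lab x" if "(x, y) \<in> f" for x y
    using f that by (auto simp: shom_def lab_def)
  show "(x, y) \<in> f \<Longrightarrow> (x, y') \<in> f \<Longrightarrow> y = y'" "(x, y) \<in> f \<Longrightarrow> (x', y) \<in> f \<Longrightarrow> x = x'"
    using f unfolding shom_def single_valued_def by blast+
  show "(x, x') \<in> sedges A \<longleftrightarrow> (y, y') \<in> sedges B" if xy: "(x, y) \<in> f" "(x', y') \<in> f"
  proof -
    have "(x, x') \<in> sarrows \<Gamma> A \<longleftrightarrow> (y, y') \<in> sarrows \<Gamma> B" "(x', x) \<in> sarrows \<Gamma> A \<longleftrightarrow> (y', y) \<in> sarrows \<Gamma> B"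
      using f xy by (auto simp: shom_def)
    then show ?thesis unfolding sedges_iff[OF A] sedges_iff[OF B] using l xy by simp
  qed
qed

lemma shomI:
  assumes A: "A \<in> sobjs \<Gamma>" and B: "B \<in> sobjs \<Gamma>"
    and f: "\<And>x y. (x, y) \<in> f \<Longrightarrow> x \<in> sverts A \<and> y \<in> sverts B \<and> lab y = lab x"
    and r: "\<And>x y y'. (x, y) \<in> f \<Longrightarrow> (x, y') \<in> f \<Longrightarrow> y = y'"
    and l: "\<And>x x' y. (x, y) \<in> f \<Longrightarrow> (x', y) \<in> f \<Longrightarrow> x = x'"
    and e: "\<And>x y x' y'. (x, y) \<in> f \<Longrightarrow> (x', y') \<in> f \<Longrightarrow> (x, x') \<in> sedges A \<longleftrightarrow> (y, y') \<in> sedges B"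
  shows "f \<in> shom \<Gamma> A B"
proof -
  have "f \<subseteq> sverts A \<times> sverts B" using f by auto
  moreover have "single_valued f" "single_valued (f\<inverse>)" using r l by (auto simp: single_valued_def)
  moreover have "snd x = snd y" if "(x, y) \<in> f" for x y using f[OF that] lab_eq_iff[OF A _ B] by metis
  moreover have "(x, x') \<in> sarrows \<Gamma> A \<longleftrightarrow> (y, y') \<in> sarrows \<Gamma> B" if "(x, y) \<in> f" "(x', y') \<in> f" for x y x' y'
    unfolding sarrows_iff[OF A] sarrows_iff[OF B]
    using e[OF that] e[OF that(2,1)] f[OF that(1)] f[OF that(2)] by simp
  ultimately show ?thesis unfolding shom_def by blast
qed

lemma shom_pairsI:
  assumes A: "A \<in> sobjs \<Gamma>" and B: "B \<in> sobjs \<Gamma>"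
    and v: "\<And>u. u \<in> U \<Longrightarrow> p u \<in> sverts A" "\<And>u. u \<in> U \<Longrightarrow> q u \<in> sverts B"
      "\<And>u. u \<in> U \<Longrightarrow> lab (q u) = lab (p u)"
    and i: "\<And>u v. u \<in> U \<Longrightarrow> v \<in> U \<Longrightarrow> p u = p v \<longleftrightarrow> u = v"
      "\<And>u v. u \<in> U \<Longrightarrow> v \<in> U \<Longrightarrow> q u = q v \<longleftrightarrow> u = v"
    and e: "\<And>u v. u \<in> U \<Longrightarrow> v \<in> U \<Longrightarrow> (p u, p v) \<in> sedges A \<longleftrightarrow> (q u, q v) \<in> sedges B"
  shows "(\<lambda>u. (p u, q u)) ` U \<in> shom \<Gamma> A B"
proof (rule shomI[OF A B])
  have E: "\<exists>u\<in>U. x = p u \<and> y = q u" if "(x, y) \<in> (\<lambda>u. (p u, q u)) ` U" for x y using that by auto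
  show "x \<in> sverts A \<and> y \<in> sverts B \<and> lab y = lab x" if "(x, y) \<in> (\<lambda>u. (p u, q u)) ` U" for x y
    using E[OF that] v by auto
  show "y = y'" if "(x, y) \<in> (\<lambda>u. (p u, q u)) ` U" "(x, y') \<in> (\<lambda>u. (p u, q u)) ` U" for x y y'
    using E[OF that(1)] E[OF that(2)] i(1) by metis
  show "x = x'" if "(x, y) \<in> (\<lambda>u. (p u, q u)) ` U" "(x', y) \<in> (\<lambda>u. (p u, q u)) ` U" for x x' y
    using E[OF that(1)] E[OF that(2)] i(2) by metis
  show "(x, x') \<in> sedges A \<longleftrightarrow> (y, y') \<in> sedges B"
    if "(x, y) \<in> (\<lambda>u. (p u, q u)) ` U" "(x', y') \<in> (\<lambda>u. (p u, q u)) ` U" for x y x' y'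
    using E[OF that(1)] E[OF that(2)] e by metis
qed

lemma shom_comp:
  assumes f: "f \<in> shom \<Gamma> A B" and g: "g \<in> shom \<Gamma> B C"
    and A: "A \<in> sobjs \<Gamma>" and B: "B \<in> sobjs \<Gamma>" and C: "C \<in> sobjs \<Gamma>"
  shows "f O g \<in> shom \<Gamma> A C"
proof (rule shomI[OF A C])
  show "x \<in> sverts A \<and> z \<in> sverts C \<and> lab z = lab x" if "(x, z) \<in> f O g" for x z
    using that shomD(1,3)[OF f A B] shomD(2,3)[OF g B C] by auto
  show "y = y'" if "(x, y) \<in> f O g" "(x, y') \<in> f O g" for x y y'
    using that shomD(4)[OF f A B] shomD(4)[OF g B C] by (metis relcompEpair)
  show "x = x'" if "(x, y) \<in> f O g" "(x', y) \<in> f O g" for x x' y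
    using that shomD(5)[OF f A B] shomD(5)[OF g B C] by (metis relcompEpair)
  show "(x, x') \<in> sedges A \<longleftrightarrow> (z, z') \<in> sedges C" if "(x, z) \<in> f O g" "(x', z') \<in> f O g" for x z x' z'
    using that shomD(6)[OF f A B] shomD(6)[OF g B C] by (elim relcompEpair) blast
qed

lemma shom_converse:
  assumes f: "f \<in> shom \<Gamma> A B" and A: "A \<in> sobjs \<Gamma>" and B: "B \<in> sobjs \<Gamma>"
  shows "f\<inverse> \<in> shom \<Gamma> B A"
  by (rule shomI[OF B A]) (use shomD[OF f A B] in auto)

lemma sid_shom: "A \<in> sobjs \<Gamma> \<Longrightarrow> sid A \<in> shom \<Gamma> A A"
  by (rule shomI) (auto simp: sid_def)

lemma siso_iff_total:
  assumes A: "A \<in> sobjs \<Gamma>" and B: "B \<in> sobjs \<Gamma>"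
  shows "f \<in> siso \<Gamma> A B \<longleftrightarrow> f \<in> shom \<Gamma> A B \<and> Domain f = sverts A \<and> Range f = sverts B"
proof
  assume f: "f \<in> siso \<Gamma> A B"
  then obtain g where g: "g \<in> shom \<Gamma> B A" "f O g = sid A" "g O f = sid B" by (auto simp: siso_def)
  have fh: "f \<in> shom \<Gamma> A B" using f by (simp add: siso_def)
  have "x \<in> Domain f" if "x \<in> sverts A" for x
  proof -
    have "(x, x) \<in> f O g" unfolding g(2) using that by (auto simp: sid_def)
    then show ?thesis by blast
  qed
  moreover have "x \<in> Range f" if "x \<in> sverts B" for x
  proof -
    have "(x, x) \<in> g O f" unfolding g(3) using that by (auto simp: sid_def)
    then show ?thesis by blast
  qed
  ultimately show "f \<in> shom \<Gamma> A B \<and> Domain f = sverts A \<and> Range f = sverts B"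
    using fh shomD(1,2)[OF fh A B] by blast
next
  assume f: "f \<in> shom \<Gamma> A B \<and> Domain f = sverts A \<and> Range f = sverts B"
  then have fh: "f \<in> shom \<Gamma> A B" and d: "Domain f = sverts A" "Range f = sverts B" by auto
  have 1: "f O f\<inverse> = sid A"
  proof (intro equalityI subrelI)
    fix x y assume "(x, y) \<in> f O f\<inverse>"
    then obtain z where z: "(x, z) \<in> f" "(y, z) \<in> f" by auto
    then have "x = y" by (rule shomD(5)[OF fh A B])
    then show "(x, y) \<in> sid A" using shomD(1)[OF fh A B z(1)] by (simp add: sid_def Id_on_iff)
  next
    fix x y assume "(x, y) \<in> sid A"
    then have "x = y" "x \<in> Domain f" by (auto simp: sid_def d)
    then show "(x, y) \<in> f O f\<inverse>" by auto
  qed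
  have 2: "f\<inverse> O f = sid B"
  proof (intro equalityI subrelI)
    fix x y assume "(x, y) \<in> f\<inverse> O f"
    then obtain z where z: "(z, x) \<in> f" "(z, y) \<in> f" by auto
    then have "x = y" by (rule shomD(4)[OF fh A B])
    then show "(x, y) \<in> sid B" using shomD(2)[OF fh A B z(1)] by (simp add: sid_def Id_on_iff)
  next
    fix x y assume "(x, y) \<in> sid B"
    then have "x = y" "x \<in> Range f" by (auto simp: sid_def d)
    then show "(x, y) \<in> f\<inverse> O f" by auto
  qed
  show "f \<in> siso \<Gamma> A B" unfolding siso_def using fh shom_converse[OF fh A B] 1 2 by auto
qed

lemma graph_iso_siso:
  assumes A: "A \<in> sobjs \<Gamma>" and B: "B \<in> sobjs \<Gamma>"
    and h: "graph_iso h lab (sverts A) (sedges A) lab (sverts B) (sedges B)"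
  shows "fgraph (sverts A) h \<in> siso \<Gamma> A B"
proof -
  have "fgraph (sverts A) h \<in> shom \<Gamma> A B"
    by (rule shomI[OF A B]) (use h in \<open>auto simp: graph_iso_def bij_betw_def dest: inj_onD\<close>)
  moreover have "Domain (fgraph (sverts A) h) = sverts A" "Range (fgraph (sverts A) h) = sverts B"
    using h by (auto simp: graph_iso_def bij_betw_def)
  ultimately show ?thesis by (simp add: siso_iff_total[OF A B])
qed

lemma siso_graph_iso:
  assumes A: "A \<in> sobjs \<Gamma>" and B: "B \<in> sobjs \<Gamma>" and f: "f \<in> siso \<Gamma> A B"
  obtains h where "graph_iso h lab (sverts A) (sedges A) lab (sverts B) (sedges B)"
    "f = fgraph (sverts A) h"
proof -
  have fh: "f \<in> shom \<Gamma> A B" and d: "Domain f = sverts A" "Range f = sverts B"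
    using f siso_iff_total[OF A B] by auto
  note sh = shomD[OF fh A B]
  define h where "h x = (SOME y. (x, y) \<in> f)" for x
  have hx: "(x, h x) \<in> f" if "x \<in> sverts A" for x
    using that d(1) unfolding h_def by (metis DomainE someI)
  have iff: "(x, y) \<in> f \<longleftrightarrow> (x, y) \<in> fgraph (sverts A) h" for x y
    unfolding in_fgraph using sh(1)[of x y] sh(4)[of x y "h x"] hx[of x] by blast
  have eq: "f = fgraph (sverts A) h" by (intro equalityI subrelI) (simp_all only: iff)
  have "inj_on h (sverts A)" using sh(5) hx by (metis inj_onI)
  moreover have "h ` sverts A = sverts B" using d(2) eq by simp
  ultimately have "graph_iso h lab (sverts A) (sedges A) lab (sverts B) (sedges B)"
    unfolding graph_iso_def bij_betw_def using sh(3,6) hx by simp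
  then show ?thesis using eq that by blast
qed

definition cls :: "('v \<Rightarrow> nat) \<Rightarrow> 'v set \<Rightarrow> 'v rel \<Rightarrow> sobj set" where
  "cls l V S = {A \<in> sobjs \<Gamma>. \<exists>h. graph_iso h l V S lab (sverts A) (sedges A)}"

lemma iso_class_cls: assumes A: "A \<in> sobjs \<Gamma>"
  shows "iso_class \<Gamma> A = cls lab (sverts A) (sedges A)"
  unfolding iso_class_def cls_def isomorphic_in_def
  using siso_graph_iso[OF A] graph_iso_siso[OF A] by blast

lemma cls_eqI: assumes h: "graph_iso h l V S l' V' S'" shows "cls l V S = cls l' V' S'"
  unfolding cls_def using graph_iso_comp[OF h] graph_iso_comp[OF graph_iso_inv[OF h]] by blast

text \<open>In a connected part, closure under arrows is the same as closure in the path order of \<open>\<Gamma>\<close>. A part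
  that is not connected can contain the two ends of a directed path that runs outside of it.\<close>

definition connected_obj :: "sobj \<Rightarrow> bool" where
  "connected_obj B \<longleftrightarrow> (\<forall>x\<in>sverts B. \<forall>y\<in>sverts B. fst x = fst y \<longrightarrow>
     (lab x, lab y) \<in> ((R \<union> R\<inverse>) \<inter> (lab ` {z\<in>sverts B. fst z = fst x}) \<times> (lab ` {z\<in>sverts B. fst z = fst x}))\<^sup>*)"

text \<open>The parts of the object are the label sets of the connected components of the graph, which embed
  in the forest.\<close>

lemma realisation:
  assumes m: "matched L R l V S"
  obtains A h where "A \<in> sobjs \<Gamma>" "connected_obj A" "graph_iso h l V S lab (sverts A) (sedges A)"
proof -
  define E where "E = (S \<union> S\<inverse>)\<^sup>*"
  have S: "S \<subseteq> V \<times> V" and lL: "l ` V \<subseteq> L" and fin: "finite V" using matchedD[OF m] by auto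
  have Esym: "(u, v) \<in> E \<Longrightarrow> (v, u) \<in> E" for u v
    unfolding E_def using sym_rtrancl[of "S \<union> S\<inverse>"] by (auto simp: sym_def)
  have Etrans: "(u, v) \<in> E \<Longrightarrow> (v, w) \<in> E \<Longrightarrow> (u, w) \<in> E" for u v w unfolding E_def by simp
  have EV: "v \<in> V" if "(u, v) \<in> E" "u \<in> V" for u v
    using that unfolding E_def by (induction rule: rtrancl_induct) (use S in auto)
  have "finite ((\<lambda>v. E `` {v}) ` V)" using fin by simp
  then obtain cs where cs: "set cs = (\<lambda>v. E `` {v}) ` V" "distinct cs" using finite_distinct_list by blast
  \<comment> \<open>\<open>ix v\<close> is the position of the component of \<open>v\<close> in the list of components.\<close>
  define ix where "ix v = (SOME t. t < length cs \<and> cs ! t = E `` {v})" for v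
  have ix: "ix v < length cs" "cs ! ix v = E `` {v}" if "v \<in> V" for v
  proof -
    have "E `` {v} \<in> set cs" using cs that by auto
    then have "\<exists>t. t < length cs \<and> cs ! t = E `` {v}" by (simp add: in_set_conv_nth)
    then have "ix v < length cs \<and> cs ! ix v = E `` {v}" unfolding ix_def by (rule someI_ex)
    then show "ix v < length cs" "cs ! ix v = E `` {v}" by auto
  qed
  have refl: "(v, v) \<in> E" for v by (simp add: E_def)
  have ix_eq: "ix u = ix v \<longleftrightarrow> (u, v) \<in> E" if "u \<in> V" "v \<in> V" for u v
  proof
    assume "ix u = ix v"
    then have "E `` {u} = E `` {v}" using ix that by metis
    then show "(u, v) \<in> E" using refl[of v] by auto
  next
    assume "(u, v) \<in> E"
    then have "E `` {u} = E `` {v}" using Esym Etrans by blast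
    then show "ix u = ix v" using ix that cs(2) by (metis nth_eq_iff_index_eq)
  qed
  define A where "A = map (\<lambda>c. (\<rho> \<circ> l) ` c) cs"
  define h where "h v = (ix v, \<rho> (l v))" for v
  have cV: "c \<subseteq> V" if "c \<in> set cs" for c using that cs EV by auto
  have A: "A \<in> sobjs \<Gamma>"
  proof -
    have "\<rho> (l v) \<in> verts \<Gamma>" if "c \<in> set cs" "v \<in> c" for c v
      using cV[OF that(1)] that(2) lL bij_betwE[OF rho] by blast
    then show ?thesis by (auto simp: sobjs_def A_def)
  qed
  have lab_h: "lab (h v) = l v" if "v \<in> V" for v using that lL lab_rho by (auto simp: h_def)
  have img: "h ` V = sverts A"
  proof (rule Set.set_eqI, rule iffI)
    fix x assume "x \<in> h ` V"
    then obtain v where v: "v \<in> V" "x = h v" by auto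
    have "v \<in> cs ! ix v" using ix v refl by auto
    then show "x \<in> sverts A" using v ix[OF v(1)] by (auto simp: sverts_def A_def h_def)
  next
    fix x assume "x \<in> sverts A"
    then obtain t v where t: "t < length cs" "v \<in> cs ! t" "x = (t, \<rho> (l v))" by (auto simp: sverts_def A_def)
    have v: "v \<in> V" using cV[OF nth_mem[OF t(1)]] t(2) by blast
    obtain u where u: "u \<in> V" "cs ! t = E `` {u}" using cs(1) t(1) nth_mem by blast
    then have "cs ! t = cs ! ix v" using ix[OF v] t(2) Esym Etrans by blast
    then have "t = ix v" using nth_eq_iff_index_eq[OF cs(2) t(1) ix(1)[OF v]] by (simp only:)
    then show "x \<in> h ` V" using v t by (auto simp: h_def)
  qed
  have "inj_on h V"
  proof (rule inj_onI)
    fix u v assume uv: "u \<in> V" "v \<in> V" "h u = h v"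
    have "(u, v) \<in> E" using uv ix_eq by (simp add: h_def)
    moreover have "l u = l v" using uv lab_h by metis
    ultimately show "u = v" using component_embeds(1)[OF m] unfolding E_def by blast
  qed
  then have bij: "bij_betw h V (sverts A)" using img by (simp add: bij_betw_def)
  have edges: "(u, v) \<in> S \<longleftrightarrow> (h u, h v) \<in> sedges A" if uv: "u \<in> V" "v \<in> V" for u v
  proof
    assume "(u, v) \<in> S"
    then have "(u, v) \<in> E" "(l u, l v) \<in> R" using matchedD(4)[OF m] by (auto simp: E_def)
    moreover have "h u \<in> sverts A" "h v \<in> sverts A" using uv img by auto
    moreover have "fst (h u) = fst (h v) \<longleftrightarrow> (u, v) \<in> E" using uv ix_eq by (simp add: h_def)
    ultimately show "(h u, h v) \<in> sedges A" using uv lab_h by (simp add: sedges_def)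
  next
    assume "(h u, h v) \<in> sedges A"
    then have "fst (h u) = fst (h v)" "(lab (h u), lab (h v)) \<in> R" by (simp_all add: sedges_def)
    then have "(u, v) \<in> E" "(l u, l v) \<in> R" using uv ix_eq lab_h by (simp_all add: h_def)
    then show "(u, v) \<in> S" using component_embeds(2)[OF m] unfolding E_def by blast
  qed
  have iso: "graph_iso h l V S lab (sverts A) (sedges A)"
    using bij edges lab_h by (simp add: graph_iso_def)
  have con: "connected_obj A"
    unfolding connected_obj_def
  proof (intro ballI impI)
    fix x y assume xy: "x \<in> sverts A" "y \<in> sverts A" "fst x = fst y"
    let ?H = "lab ` {z \<in> sverts A. fst z = fst x}"
    obtain u v where u: "u \<in> V" "x = h u" and v: "v \<in> V" "y = h v" using xy img by blast
    have "(u, v) \<in> (S \<union> S\<inverse>)\<^sup>*" using xy u v ix_eq unfolding E_def by (auto simp: h_def)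
    then have "(l u, l v) \<in> ((R \<union> R\<inverse>) \<inter> ?H \<times> ?H)\<^sup>*"
    proof (induction rule: rtrancl_induct)
      case (step w z)
      have wz: "w \<in> V" "z \<in> V" using step S by auto
      have "(u, w) \<in> E" "(u, z) \<in> E" using step by (auto simp: E_def intro: rtrancl_into_rtrancl)
      then have "fst (h w) = fst x" "fst (h z) = fst x" using ix_eq[OF u(1) wz(1)] ix_eq[OF u(1) wz(2)] u(2) by (simp_all add: h_def)
      moreover have "h w \<in> sverts A" "h z \<in> sverts A" using wz img by auto
      ultimately have "lab (h w) \<in> ?H" "lab (h z) \<in> ?H" by auto
      then have "l w \<in> ?H" "l z \<in> ?H" using wz lab_h by simp_all
      moreover have "(l w, l z) \<in> R \<union> R\<inverse>" using step matchedD(4)[OF m] by auto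
      ultimately show ?case using step.IH by (meson IntI SigmaI rtrancl.rtrancl_into_rtrancl)
    qed simp
    then show "(lab x, lab y) \<in> ((R \<union> R\<inverse>) \<inter> ?H \<times> ?H)\<^sup>*" using u v lab_h by simp
  qed
  show ?thesis using that A con iso by blast
qed

lemma cls_self: "A \<in> sobjs \<Gamma> \<Longrightarrow> A \<in> cls lab (sverts A) (sedges A)"
  using graph_iso_id unfolding cls_def by blast

lemma cls_memD:
  assumes "A \<in> cls l V S"
  shows "A \<in> sobjs \<Gamma>" "cls l V S = cls lab (sverts A) (sedges A)" "cls l V S = iso_class \<Gamma> A"
proof -
  obtain h where A: "A \<in> sobjs \<Gamma>" and h: "graph_iso h l V S lab (sverts A) (sedges A)"
    using assms unfolding cls_def by blast
  show "A \<in> sobjs \<Gamma>" by (rule A)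
  show 1: "cls l V S = cls lab (sverts A) (sedges A)" by (rule cls_eqI[OF h])
  show "cls l V S = iso_class \<Gamma> A" unfolding 1 by (rule iso_class_cls[OF A, symmetric])
qed

lemma cls_in_iso_classes: assumes "matched L R l V S" shows "cls l V S \<in> iso_classes \<Gamma>"
proof -
  obtain A h where A: "A \<in> sobjs \<Gamma>" "graph_iso h l V S lab (sverts A) (sedges A)"
    using realisation[OF assms] by blast
  then have "cls l V S = iso_class \<Gamma> A" using cls_eqI[OF A(2)] iso_class_cls[OF A(1)] by simp
  then show ?thesis using A(1) by (simp add: iso_classes_def)
qed

lemma iso_classes_cls: assumes "K \<in> iso_classes \<Gamma>" "A \<in> K"
  shows "A \<in> sobjs \<Gamma>" "K = cls lab (sverts A) (sedges A)"
proof -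
  obtain B where B: "B \<in> sobjs \<Gamma>" "K = iso_class \<Gamma> B" using assms by (auto simp: iso_classes_def)
  then have K: "K = cls lab (sverts B) (sedges B)" using iso_class_cls by simp
  show "A \<in> sobjs \<Gamma>" "K = cls lab (sverts A) (sedges A)"
    using cls_memD(1,2)[of A lab "sverts B" "sedges B"] assms(2) unfolding K by simp_all
qed

lemma rep_in: "K \<in> iso_classes \<Gamma> \<Longrightarrow> rep K \<in> K"
proof -
  assume "K \<in> iso_classes \<Gamma>"
  then obtain B where B: "B \<in> sobjs \<Gamma>" "K = iso_class \<Gamma> B" by (auto simp: iso_classes_def)
  then have "B \<in> K" using iso_class_cls cls_self by simp
  then show ?thesis unfolding rep_def by (rule someI)
qed

lemma mem_cls_iff: assumes B: "B \<in> sobjs \<Gamma>"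
  shows "B \<in> cls l V S \<longleftrightarrow> cls l V S = iso_class \<Gamma> B"
  using cls_memD(3) iso_class_cls[OF B] cls_self[OF B] by metis

end

section \<open>Counting extensions\<close>

lemma Id_on_relcomp: "Domain u \<subseteq> U \<Longrightarrow> Id_on U O u = u"
  by (intro equalityI subrelI) (auto intro!: relcompI IdI simp: Id_on_iff Domain_iff subset_iff)

lemma rtrancl_image:
  assumes "\<And>a b. (a, b) \<in> r \<Longrightarrow> (f a, f b) \<in> s" and "(x, y) \<in> r\<^sup>*"
  shows "(f x, f y) \<in> s\<^sup>*"
  using assms(2) by (induction rule: rtrancl_induct) (auto intro: rtrancl_into_rtrancl assms(1))

context oriented_forest
begin

lemma shom_sarrows: "f \<in> shom \<Gamma> A B \<Longrightarrow> (x, y) \<in> f \<Longrightarrow> (x', y') \<in> f \<Longrightarrow>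
    (x, x') \<in> sarrows \<Gamma> A \<longleftrightarrow> (y, y') \<in> sarrows \<Gamma> B"
  unfolding shom_def by blast

lemma path_in_component:
  assumes B: "B \<in> sobjs \<Gamma>" and con: "connected_obj B" and x: "x \<in> sverts B" and y: "y \<in> sverts B"
    and xy: "fst x = fst y" and path: "(snd x, snd y) \<in> (arrows \<Gamma>)\<^sup>*"
  shows "(x, y) \<in> (sarrows \<Gamma> B)\<^sup>*"
proof -
  define M where "M = {(a, b). (a, b) \<in> D \<or> (b, a) \<in> R - D}"
  let ?H = "lab ` {z \<in> sverts B. fst z = fst x}"
  have M: "M \<subseteq> R \<union> R\<inverse>" "\<And>a b. (a, b) \<in> M \<Longrightarrow> (b, a) \<notin> M"
    using D_R R_antisym by (auto simp: M_def)
  have "(inv_into L \<rho> (snd x), inv_into L \<rho> (snd y)) \<in> M\<^sup>*"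
  proof (rule rtrancl_image[OF _ path])
    fix a b assume ab: "(a, b) \<in> arrows \<Gamma>"
    then have v: "a \<in> \<rho> ` L" "b \<in> \<rho> ` L" using arrows_verts rho by (auto simp: bij_betw_def)
    then show "(inv_into L \<rho> a, inv_into L \<rho> b) \<in> M"
      using ab arrows_iff[OF inv_into_into[OF v(1)] inv_into_into[OF v(2)]]
      by (simp add: f_inv_into_f M_def)
  qed
  then have "(lab x, lab y) \<in> M\<^sup>*" by (simp add: lab_def)
  moreover have "(lab x, lab y) \<in> ((R \<union> R\<inverse>) \<inter> ?H \<times> ?H)\<^sup>*"
    using con x y xy unfolding connected_obj_def by blast
  moreover have "lab x \<in> ?H" using x by blast
  ultimately have *: "(lab x, lab y) \<in> (M \<inter> ?H \<times> ?H)\<^sup>*"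
    using directed_path_in_connected[OF M, of "lab x" "lab y" ?H] by blast
  define k where "k a = (fst x, \<rho> a)" for a
  have k: "k (lab z) = z" if "z \<in> sverts B" "fst z = fst x" for z
    using rho_lab[OF B that(1)] that(2) by (simp add: k_def prod_eq_iff)
  have "(k (lab x), k (lab y)) \<in> (sarrows \<Gamma> B)\<^sup>*"
  proof (rule rtrancl_image[OF _ *])
    fix a b assume ab: "(a, b) \<in> M \<inter> ?H \<times> ?H"
    then obtain z w where z: "z \<in> sverts B" "fst z = fst x" "a = lab z"
      and w: "w \<in> sverts B" "fst w = fst x" "b = lab w" by auto
    have "(lab z, lab w) \<in> D \<or> (lab w, lab z) \<in> R - D" using ab z w by (auto simp: M_def)
    then have "(z, w) \<in> sarrows \<Gamma> B" using z w D_R unfolding sarrows_iff[OF B] sedges_def by auto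
    then show "(k a, k b) \<in> sarrows \<Gamma> B" using k z w by simp
  qed
  then show ?thesis using k x y xy by simp
qed

text \<open>A single arrow is a path, so a sub-quiver that is closed in the path order is closed under the
  arrows of the middle term.\<close>

lemma admissible_mono_D:
  assumes A: "A \<in> sobjs \<Gamma>" and B: "B \<in> sobjs \<Gamma>" and f: "admissible_mono \<Gamma> A B f"
  shows "sverts A \<subseteq> Domain f" and "\<And>x y. x \<in> Range f \<Longrightarrow> (x, y) \<in> sarrows \<Gamma> B \<Longrightarrow> y \<in> Range f"
proof -
  obtain ps \<alpha> \<beta> where ps: "\<forall>(J, H)\<in>set ps. basic_mono \<Gamma> J H"
    and \<alpha>: "\<alpha> \<in> siso \<Gamma> A (map fst ps)" and \<beta>: "\<beta> \<in> siso \<Gamma> (map snd ps) B"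
    and f: "f = \<alpha> O sid (map fst ps) O \<beta>"
    using f unfolding admissible_mono_def by blast
  have bm: "basic_mono \<Gamma> (fst (ps ! t)) (snd (ps ! t))" if "t < length ps" for t
    using ps nth_mem[OF that] by (auto simp: case_prod_beta)
  have P: "map fst ps \<in> sobjs \<Gamma>" "map snd ps \<in> sobjs \<Gamma>"
  proof -
    have "fst p \<subseteq> verts \<Gamma> \<and> snd p \<subseteq> verts \<Gamma>" if "p \<in> set ps" for p
      using bspec[OF ps that] unfolding basic_mono_def case_prod_beta by blast
    then show "map fst ps \<in> sobjs \<Gamma>" "map snd ps \<in> sobjs \<Gamma>" by (auto simp: sobjs_def)
  qed
  have sub: "sverts (map fst ps) \<subseteq> sverts (map snd ps)"
    by (auto simp: sverts_def intro: subsetD[OF conjunct1[OF bm[unfolded basic_mono_def]]])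
  have a: "Domain \<alpha> = sverts A" "Range \<alpha> = sverts (map fst ps)"
    and b: "\<beta> \<in> shom \<Gamma> (map snd ps) B" "Domain \<beta> = sverts (map snd ps)" "Range \<beta> = sverts B"
    using \<alpha> \<beta> siso_iff_total[OF A P(1)] siso_iff_total[OF P(2) B] by auto
  show "sverts A \<subseteq> Domain f"
  proof
    fix x assume "x \<in> sverts A"
    then obtain p where p: "(x, p) \<in> \<alpha>" using a(1) by blast
    then have pP: "p \<in> sverts (map fst ps)" using a(2) by blast
    then obtain q where q: "(p, q) \<in> \<beta>" using sub b(2) by blast
    have "(x, q) \<in> f" unfolding f using p pP q by (auto simp: sid_def)
    then show "x \<in> Domain f" by blast
  qed
  show "y \<in> Range f" if x: "x \<in> Range f" and xy: "(x, y) \<in> sarrows \<Gamma> B" for x y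
  proof -
    obtain p where p: "p \<in> sverts (map fst ps)" "(p, x) \<in> \<beta>"
      using x unfolding f by (auto simp: sid_def)
    have "y \<in> sverts B" using xy by (simp add: sarrows_def)
    then obtain q where q: "(q, y) \<in> \<beta>" using b(3) by blast
    have "(p, q) \<in> sarrows \<Gamma> (map snd ps)" using shom_sarrows[OF b(1) p(2) q] xy by simp
    then have pq: "fst p = fst q" "(snd p, snd q) \<in> arrows \<Gamma>" "q \<in> sverts (map snd ps)"
      by (auto simp: sarrows_def)
    have t: "fst q < length ps" "snd p \<in> fst (ps ! fst q)" "snd q \<in> snd (ps ! fst q)"
      using p(1) pq by (auto simp: sverts_def)
    have "path_le \<Gamma> (snd q) (snd p)" using pq by (simp add: path_le_def r_into_rtrancl)
    then have "snd q \<in> fst (ps ! fst q)" using bm[OF t(1)] t unfolding basic_mono_def by blast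
    then have qP: "q \<in> sverts (map fst ps)" using t by (cases q) (simp add: sverts_def)
    then obtain z where "(z, q) \<in> \<alpha>" using a(2) by blast
    then have "(z, y) \<in> f" unfolding f using qP q by (auto simp: sid_def)
    then show ?thesis by blast
  qed
qed

lemma admissible_epi_D:
  assumes B: "B \<in> sobjs \<Gamma>" and C: "C \<in> sobjs \<Gamma>" and g: "admissible_epi \<Gamma> B C g"
  shows "sverts C \<subseteq> Range g"
proof
  fix x assume x: "x \<in> sverts C"
  obtain ps \<alpha> \<beta> where ps: "\<forall>(H, K)\<in>set ps. basic_epi \<Gamma> H K"
    and \<alpha>: "\<alpha> \<in> siso \<Gamma> B (map fst ps)" and \<beta>: "\<beta> \<in> siso \<Gamma> (map snd ps) C"
    and g: "g = \<alpha> O sid (map snd ps) O \<beta>"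
    using g unfolding admissible_epi_def by blast
  have be: "basic_epi \<Gamma> (fst (ps ! t)) (snd (ps ! t))" if "t < length ps" for t
    using ps nth_mem[OF that] by (auto simp: case_prod_beta)
  have P: "map fst ps \<in> sobjs \<Gamma>" "map snd ps \<in> sobjs \<Gamma>"
  proof -
    have "fst p \<subseteq> verts \<Gamma> \<and> snd p \<subseteq> verts \<Gamma>" if "p \<in> set ps" for p
      using bspec[OF ps that] unfolding basic_epi_def case_prod_beta by blast
    then show "map fst ps \<in> sobjs \<Gamma>" "map snd ps \<in> sobjs \<Gamma>" by (auto simp: sobjs_def)
  qed
  have sub: "sverts (map snd ps) \<subseteq> sverts (map fst ps)"
    by (auto simp: sverts_def intro: subsetD[OF conjunct1[OF be[unfolded basic_epi_def]]])
  have a: "Range \<alpha> = sverts (map fst ps)" and b: "\<beta> \<in> shom \<Gamma> (map snd ps) C" "Range \<beta> = sverts C"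
    using \<alpha> \<beta> siso_iff_total[OF B P(1)] siso_iff_total[OF P(2) C] by auto
  obtain k where k: "(k, x) \<in> \<beta>" using x b(2) by blast
  have kP: "k \<in> sverts (map snd ps)" using shomD(1)[OF b(1) P(2) C k] .
  then obtain z where "(z, k) \<in> \<alpha>" using sub a by blast
  then have "(z, x) \<in> g" unfolding g using k kP by (auto simp: sid_def)
  then show "x \<in> Range g" by blast
qed

lemma Nil_sobj: "[] \<in> sobjs \<Gamma>" and sverts_Nil: "sverts [] = {}"
  by (auto simp: sobjs_def sverts_def)

text \<open>A vertex of the middle term that is neither in the image of \<open>f\<close> nor in the domain of \<open>g\<close> is the
  image of a morphism from a one-vertex object that composes with \<open>g\<close> to zero; the pullback property
  forces it into the image of \<open>f\<close>.\<close>

lemma admissible_sequence_D: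
  assumes A: "A \<in> sobjs \<Gamma>" and B: "B \<in> sobjs \<Gamma>" and C: "C \<in> sobjs \<Gamma>"
    and s: "admissible_sequence \<Gamma> A B C f g"
  shows "f \<in> shom \<Gamma> A B" "g \<in> shom \<Gamma> B C" "Domain f = sverts A" "Range g = sverts C"
    "Range f \<inter> Domain g = {}" "Range f \<union> Domain g = sverts B"
    "\<And>x y. x \<in> Range f \<Longrightarrow> (x, y) \<in> sarrows \<Gamma> B \<Longrightarrow> y \<in> Range f"
proof -
  have mono: "admissible_mono \<Gamma> A B f" and epi: "admissible_epi \<Gamma> B C g"
    and pb: "pullback_square \<Gamma> A B [] C f {} g {}"
    using s by (auto simp: admissible_sequence_def bicartesian_square_def)
  show f: "f \<in> shom \<Gamma> A B" and g: "g \<in> shom \<Gamma> B C"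
    using pb by (auto simp: pullback_square_def commutative_square_def)
  have fg: "f O g = {}" using pb by (auto simp: pullback_square_def commutative_square_def)
  show "Domain f = sverts A" using admissible_mono_D(1)[OF A B mono] shomD(1)[OF f A B] by blast
  show "Range g = sverts C" using admissible_epi_D[OF B C epi] shomD(2)[OF g B C] by blast
  show "Range f \<inter> Domain g = {}" using fg by blast
  show "x \<in> Range f \<Longrightarrow> (x, y) \<in> sarrows \<Gamma> B \<Longrightarrow> y \<in> Range f" for x y
    by (rule admissible_mono_D(2)[OF A B mono])
  have "v \<in> Range f \<union> Domain g" if v: "v \<in> sverts B" for v
  proof (rule ccontr)
    assume n: "v \<notin> Range f \<union> Domain g"
    let ?Z = "[{snd v}]" and ?p = "{((0::nat, snd v), v)}"
    have sv: "sverts ?Z = {(0, snd v)}" by (auto simp: sverts_def)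
    have Z: "?Z \<in> sobjs \<Gamma>" using snd_sverts[OF B v] by (simp add: sobjs_def)
    have p: "?p \<in> shom \<Gamma> ?Z B"
      by (rule shomI[OF Z B]) (use v R_irrefl in \<open>auto simp: sv lab_def sedges_def\<close>)
    have q: "{} \<in> shom \<Gamma> ?Z []" by (rule shomI[OF Z Nil_sobj]) auto
    have "?p O g = {} O {}" using n by auto
    then obtain u where "u O f = ?p"
      using pb Z p q unfolding pullback_square_def by (metis (no_types, lifting))
    then have "v \<in> Range f" by blast
    then show False using n by simp
  qed
  then show "Range f \<union> Domain g = sverts B" using shomD(2)[OF f A B] shomD(1)[OF g B C] by blast
qed

text \<open>A connected middle term is cut, part by part, into the image of \<open>f\<close> and the domain of \<open>g\<close>; this
  exhibits \<open>f\<close> and \<open>g\<close> as disjoint unions of basic morphisms. The universal morphisms of the square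
  are the composites with the converse relations of \<open>f\<close> and \<open>g\<close>.\<close>

lemma admissible_sequence_I:
  assumes A: "A \<in> sobjs \<Gamma>" and B: "B \<in> sobjs \<Gamma>" and C: "C \<in> sobjs \<Gamma>" and con: "connected_obj B"
    and f: "f \<in> shom \<Gamma> A B" and g: "g \<in> shom \<Gamma> B C" and dom: "Domain f = sverts A" and ran: "Range g = sverts C"
    and disj: "Range f \<inter> Domain g = {}" and cover: "Range f \<union> Domain g = sverts B"
    and closed: "\<And>x y. x \<in> Range f \<Longrightarrow> (x, y) \<in> sarrows \<Gamma> B \<Longrightarrow> y \<in> Range f"
  shows "admissible_sequence \<Gamma> A B C f g"
proof -
  have closed': "y \<in> Range f" if "(x, y) \<in> (sarrows \<Gamma> B)\<^sup>*" "x \<in> Range f" for x y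
    using that by (induction rule: rtrancl_induct) (auto intro: closed)
  have fB: "Range f \<subseteq> sverts B" and gB: "Domain g \<subseteq> sverts B" using cover by auto
  have BH: "B ! t \<subseteq> verts \<Gamma>" if "t < length B" for t using B that by (auto simp: sobjs_def)
  have reach: "(t, b) \<in> Range f" if "(t, a) \<in> Range f" "b \<in> B ! t" "t < length B" "path_le \<Gamma> b a" for t a b
  proof -
    have "(t, a) \<in> sverts B" "(t, b) \<in> sverts B" using that fB by (auto simp: sverts_def)
    then have "((t, a), (t, b)) \<in> (sarrows \<Gamma> B)\<^sup>*"
      using path_in_component[OF B con, of "(t, a)" "(t, b)"] that(4) by (simp add: path_le_def)
    then show ?thesis using closed' that(1) by blast
  qed
  define sub where "sub U = map (\<lambda>t. {j. (t, j) \<in> U}) [0..<length B]" for U :: "(nat \<times> nat) set"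
  have sv_sub: "sverts (sub U) = U" if "U \<subseteq> sverts B" for U
    using that by (auto simp: sub_def sverts_def)
  have sub_obj: "sub U \<in> sobjs \<Gamma>" if "U \<subseteq> sverts B" for U
    using that BH by (auto simp: sub_def sobjs_def sverts_def)
  have sedges_sub: "(x, y) \<in> sedges (sub U) \<longleftrightarrow> x \<in> U \<and> y \<in> U \<and> (x, y) \<in> sedges B" if "U \<subseteq> sverts B" for U x y
    using that sv_sub[OF that] by (auto simp: sedges_def)
  have B_nth: "map ((!) B) [0..<length B] = B" by (rule map_nth)
  have sidB: "sid B \<in> siso \<Gamma> B B"
    unfolding siso_iff_total[OF B B] using sid_shom[OF B] by (auto simp: sid_def)
  have "admissible_mono \<Gamma> A B f"
    unfolding admissible_mono_def
  proof (intro exI[of _ "map (\<lambda>t. ({j. (t, j) \<in> Range f}, B ! t)) [0..<length B]"] conjI bexI)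
    let ?ps = "map (\<lambda>t. ({j. (t, j) \<in> Range f}, B ! t)) [0..<length B]"
    have fst: "map fst ?ps = sub (Range f)" by (simp add: sub_def)
    have snd: "map snd ?ps = B" using B_nth by (simp add: o_def)
    show "\<forall>(J, H)\<in>set ?ps. basic_mono \<Gamma> J H"
    proof (clarsimp simp: basic_mono_def, intro conjI)
      fix t assume t: "t < length B"
      show "{j. (t, j) \<in> Range f} \<subseteq> B ! t" using fB by (auto simp: sverts_def)
      show "B ! t \<subseteq> verts \<Gamma>" using BH t .
      show "\<forall>a. (t, a) \<in> Range f \<longrightarrow> {b \<in> B ! t. path_le \<Gamma> b a} \<subseteq> {j. (t, j) \<in> Range f}"
        using reach t by blast
    qed
    have "f \<in> shom \<Gamma> A (sub (Range f))"
      by (rule shomI[OF A sub_obj[OF fB]])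
        (use shomD[OF f A B] sv_sub[OF fB] sedges_sub[OF fB] in blast)+
    then show "f \<in> siso \<Gamma> A (map fst ?ps)"
      unfolding fst siso_iff_total[OF A sub_obj[OF fB]] using dom sv_sub[OF fB] by simp
    show "sid B \<in> siso \<Gamma> (map snd ?ps) B" unfolding snd by (rule sidB)
    have "f O Id_on (Range f) O Id_on (sverts B) = f" using fB by auto
    then show "f = f O sid (map fst ?ps) O sid B" unfolding fst sid_def sv_sub[OF fB] by simp
  qed
  moreover have "admissible_epi \<Gamma> B C g"
    unfolding admissible_epi_def
  proof (intro exI[of _ "map (\<lambda>t. (B ! t, {j. (t, j) \<in> Domain g})) [0..<length B]"] conjI bexI)
    let ?ps = "map (\<lambda>t. (B ! t, {j. (t, j) \<in> Domain g})) [0..<length B]"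
    have snd: "map snd ?ps = sub (Domain g)" by (simp add: sub_def)
    have fst: "map fst ?ps = B" using B_nth by (simp add: o_def)
    show "\<forall>(H, K)\<in>set ?ps. basic_epi \<Gamma> H K"
    proof (clarsimp simp: basic_epi_def, intro conjI)
      fix t assume t: "t < length B"
      show "{j. (t, j) \<in> Domain g} \<subseteq> B ! t" using gB by (auto simp: sverts_def)
      show "B ! t \<subseteq> verts \<Gamma>" using BH t .
      have "(t, b) \<in> Domain g" if a: "(t, a) \<in> Domain g" and b: "b \<in> B ! t" "path_le \<Gamma> a b" for a b
      proof (rule ccontr)
        assume "(t, b) \<notin> Domain g"
        then have "(t, b) \<in> Range f" using cover b(1) t by (auto simp: sverts_def)
        moreover have "a \<in> B ! t" using a gB by (auto simp: sverts_def)
        ultimately have "(t, a) \<in> Range f" using reach t b(2) by blast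
        then show False using a disj by blast
      qed
      then show "\<forall>a. (t, a) \<in> Domain g \<longrightarrow> {b \<in> B ! t. path_le \<Gamma> a b} \<subseteq> {j. (t, j) \<in> Domain g}"
        by blast
    qed
    have "g \<in> shom \<Gamma> (sub (Domain g)) C"
      by (rule shomI[OF sub_obj[OF gB] C])
        (use shomD[OF g B C] sv_sub[OF gB] sedges_sub[OF gB] in blast)+
    then show "g \<in> siso \<Gamma> (map snd ?ps) C"
      unfolding snd siso_iff_total[OF sub_obj[OF gB] C] using ran sv_sub[OF gB] by simp
    show "sid B \<in> siso \<Gamma> B (map fst ?ps)" unfolding fst by (rule sidB)
    have "Id_on (sverts B) O Id_on (Domain g) O g = g" using gB by auto
    then show "g = sid B O sid (map snd ?ps) O g" unfolding snd sid_def sv_sub[OF gB] by simp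
  qed
  moreover have comm: "commutative_square \<Gamma> A B [] C f {} g {}"
    using A B C Nil_sobj f g disj shomI[OF A Nil_sobj, of "{}"] shomI[OF Nil_sobj C, of "{}"]
    unfolding commutative_square_def by auto
  moreover have "pullback_square \<Gamma> A B [] C f {} g {}"
    unfolding pullback_square_def
  proof (intro conjI comm ballI impI)
    fix Z p q assume Z: "Z \<in> sobjs \<Gamma>" and p: "p \<in> shom \<Gamma> Z B" and q: "q \<in> shom \<Gamma> Z []"
      and pg: "p O g = q O {}"
    have q0: "q = {}" using shomD(2)[OF q Z Nil_sobj] by (auto simp: sverts_Nil)
    have pf: "Range p \<subseteq> Range f" using pg shomD(2)[OF p Z B] cover by blast
    have ff: "f\<inverse> O f = Id_on (Range f)"
      by (intro equalityI subrelI) (use shomD(4)[OF f A B] in \<open>auto simp: Id_on_iff\<close>)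
    have ff': "f O f\<inverse> = Id_on (sverts A)"
      by (intro equalityI subrelI) (use shomD(5)[OF f A B] dom in \<open>auto simp: Id_on_iff\<close>)
    show "\<exists>!u. u \<in> shom \<Gamma> Z A \<and> u O f = p \<and> u O {} = q"
    proof (rule ex1I[of _ "p O f\<inverse>"])
      have "p O Id_on (Range f) = p" using pf by auto
      then have "(p O f\<inverse>) O f = p" by (simp add: O_assoc ff)
      then show "p O f\<inverse> \<in> shom \<Gamma> Z A \<and> (p O f\<inverse>) O f = p \<and> (p O f\<inverse>) O {} = q"
        using shom_comp[OF p shom_converse[OF f A B] Z B A] q0 by simp
    next
      fix u assume u: "u \<in> shom \<Gamma> Z A \<and> u O f = p \<and> u O {} = q"
      then have "u O Id_on (sverts A) = u" using shomD(2)[OF _ Z A] by auto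
      then show "u = p O f\<inverse>" using u ff' by (metis O_assoc)
    qed
  qed
  moreover have "pushout_square \<Gamma> A B [] C f {} g {}"
    unfolding pushout_square_def
  proof (intro conjI comm ballI impI)
    fix Z p q assume Z: "Z \<in> sobjs \<Gamma>" and p: "p \<in> shom \<Gamma> B Z" and q: "q \<in> shom \<Gamma> [] Z"
      and fp: "f O p = {} O q"
    have q0: "q = {}" using shomD(1)[OF q Nil_sobj Z] by (auto simp: sverts_Nil)
    have pg: "Domain p \<subseteq> Domain g" using fp shomD(1)[OF p B Z] cover by blast
    have gg: "g O g\<inverse> = Id_on (Domain g)"
      by (intro equalityI subrelI) (use shomD(5)[OF g B C] in \<open>auto simp: Id_on_iff\<close>)
    have gg': "g\<inverse> O g = Id_on (sverts C)"
      by (intro equalityI subrelI) (use shomD(4)[OF g B C] ran in \<open>auto simp: Id_on_iff\<close>)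
    show "\<exists>!u. u \<in> shom \<Gamma> C Z \<and> g O u = p \<and> {} O u = q"
    proof (rule ex1I[of _ "g\<inverse> O p"])
      have "Id_on (Domain g) O p = p" using pg by (rule Id_on_relcomp)
      then have "g O (g\<inverse> O p) = p" by (simp add: O_assoc[symmetric] gg)
      then show "g\<inverse> O p \<in> shom \<Gamma> C Z \<and> g O (g\<inverse> O p) = p \<and> {} O (g\<inverse> O p) = q"
        using shom_comp[OF shom_converse[OF g B C] p C B Z] q0 by simp
    next
      fix u assume u: "u \<in> shom \<Gamma> C Z \<and> g O u = p \<and> {} O u = q"
      then have "Domain u \<subseteq> sverts C" using shomD(1)[OF _ C Z, of u] by blast
      then have "Id_on (sverts C) O u = u" by (rule Id_on_relcomp)
      then show "u = g\<inverse> O p" using u gg' by (metis O_assoc)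
    qed
  qed
  ultimately show ?thesis unfolding admissible_sequence_def bicartesian_square_def by blast
qed

end

lemma card_quotient_kernel:
  "card (S // {(x, y). x \<in> S \<and> y \<in> S \<and> e x = e y}) = card (e ` S)"
proof -
  let ?r = "{(x, y). x \<in> S \<and> y \<in> S \<and> e x = e y}"
  have "bij_betw (\<lambda>T. {x \<in> S. e x = T}) (e ` S) (S // ?r)"
    unfolding bij_betw_def
  proof
    show "inj_on (\<lambda>T. {x \<in> S. e x = T}) (e ` S)"
    proof (rule inj_onI)
      fix T T' assume "T \<in> e ` S" and eq: "{x \<in> S. e x = T} = {x \<in> S. e x = T'}"
      then obtain x where x: "x \<in> {x \<in> S. e x = T}" by blast
      moreover have "x \<in> {x \<in> S. e x = T'}" using x unfolding eq .
      ultimately show "T = T'" by simp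
    qed
    have "(\<lambda>T. {x \<in> S. e x = T}) ` e ` S = (\<lambda>x. ?r `` {x}) ` S"
      unfolding image_image by (rule image_cong) auto
    also have "\<dots> = S // ?r" unfolding quotient_def by blast
    finally show "(\<lambda>T. {x \<in> S. e x = T}) ` e ` S = S // ?r" .
  qed
  from bij_betw_same_card[OF this] show ?thesis by (rule sym)
qed

context oriented_forest
begin

text \<open>In an extension of \<open>C\<close> by \<open>A\<close> the subobject is \<open>A\<close>, so that new arrows start in \<open>C\<close> and end in
  \<open>A\<close>. An edge of \<open>T\<close> from \<open>VC\<close> to \<open>VA\<close> thus has its arrow along \<open>R\<close>, and an edge from \<open>VA\<close> to
  \<open>VC\<close> has it against \<open>R\<close>.\<close>

definition glue :: "('v \<Rightarrow> nat) \<Rightarrow> 'v set \<Rightarrow> 'v rel \<Rightarrow> 'v set \<Rightarrow> 'v rel \<Rightarrow> 'v rel set" where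
  "glue l VA SA VC SC = {T. matched L R l (VA \<union> VC) T \<and> T \<inter> VA \<times> VA = SA \<and> T \<inter> VC \<times> VC = SC \<and>
     (\<forall>u v. (u, v) \<in> T \<longrightarrow> (u \<in> VC \<and> v \<in> VA \<longrightarrow> (l u, l v) \<in> D) \<and> (u \<in> VA \<and> v \<in> VC \<longrightarrow> (l u, l v) \<notin> D))}"

text \<open>The bijection from the vertices of \<open>A\<close> and \<open>C\<close>, given as graphs on \<open>VA\<close> and \<open>VC\<close>, to the middle
  term of an exact sequence.\<close>

definition ext_map :: "('v \<Rightarrow> nat \<times> nat) \<Rightarrow> ('v \<Rightarrow> nat \<times> nat) \<Rightarrow> 'v set \<Rightarrow> sobj \<times> smor \<times> smor \<Rightarrow> 'v \<Rightarrow> nat \<times> nat" where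
  "ext_map a c VA x u = (case x of (B, f, g) \<Rightarrow>
     if u \<in> VA then SOME y. (a u, y) \<in> f else SOME y. (y, c u) \<in> g)"

text \<open>The edges of the middle term, pulled back to \<open>VA \<union> VC\<close>. This is a complete invariant of the
  equivalence class of the sequence.\<close>

definition ext_graph :: "('v \<Rightarrow> nat \<times> nat) \<Rightarrow> ('v \<Rightarrow> nat \<times> nat) \<Rightarrow> 'v set \<Rightarrow> 'v set \<Rightarrow> sobj \<times> smor \<times> smor \<Rightarrow> 'v rel" where
  "ext_graph a c VA VC x = {(u, v). u \<in> VA \<union> VC \<and> v \<in> VA \<union> VC \<and>
     (ext_map a c VA x u, ext_map a c VA x v) \<in> sedges (fst x)}"

context
  fixes l :: "'v \<Rightarrow> nat" and VA VC :: "'v set" and SA SC :: "'v rel"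
    and A B C :: sobj and a c :: "'v \<Rightarrow> nat \<times> nat"
  assumes A: "A \<in> sobjs \<Gamma>" and B: "B \<in> sobjs \<Gamma>" and C: "C \<in> sobjs \<Gamma>"
    and isoA: "graph_iso a l VA SA lab (sverts A) (sedges A)"
    and isoC: "graph_iso c l VC SC lab (sverts C) (sedges C)"
    and SA: "SA \<subseteq> VA \<times> VA" and SC: "SC \<subseteq> VC \<times> VC" and disj: "VA \<inter> VC = {}"
begin

lemma
  shows a_inj: "u \<in> VA \<Longrightarrow> v \<in> VA \<Longrightarrow> a u = a v \<longleftrightarrow> u = v" and a_img: "a ` VA = sverts A"
    and a_lab: "u \<in> VA \<Longrightarrow> lab (a u) = l u"
    and a_edge: "u \<in> VA \<Longrightarrow> v \<in> VA \<Longrightarrow> (a u, a v) \<in> sedges A \<longleftrightarrow> (u, v) \<in> SA"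
    and c_inj: "u \<in> VC \<Longrightarrow> v \<in> VC \<Longrightarrow> c u = c v \<longleftrightarrow> u = v" and c_img: "c ` VC = sverts C"
    and c_lab: "u \<in> VC \<Longrightarrow> lab (c u) = l u"
    and c_edge: "u \<in> VC \<Longrightarrow> v \<in> VC \<Longrightarrow> (c u, c v) \<in> sedges C \<longleftrightarrow> (u, v) \<in> SC"
  using isoA isoC by (auto simp: graph_iso_def bij_betw_def dest: inj_onD)

lemma ext_sequencesD:
  assumes x: "(B', f, g) \<in> ext_sequences \<Gamma> C A B"
  shows "B' \<in> sobjs \<Gamma>" "isomorphic_in \<Gamma> B' B" "admissible_sequence \<Gamma> A B' C f g"
  using x by (auto simp: ext_sequences_def)

lemma ext_map_mem:
  assumes x: "(B', f, g) \<in> ext_sequences \<Gamma> C A B"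
  defines "h \<equiv> ext_map a c VA (B', f, g)"
  shows "u \<in> VA \<Longrightarrow> (a u, h u) \<in> f" and "u \<in> VC \<Longrightarrow> (h u, c u) \<in> g"
proof -
  note s = admissible_sequence_D[OF A ext_sequencesD(1)[OF x] C ext_sequencesD(3)[OF x]]
  show "(a u, h u) \<in> f" if u: "u \<in> VA"
  proof -
    have "a u \<in> Domain f" using u a_img s(3) by auto
    then have "\<exists>y. (a u, y) \<in> f" by blast
    then have "(a u, SOME y. (a u, y) \<in> f) \<in> f" by (rule someI_ex)
    then show ?thesis using u by (simp add: h_def ext_map_def)
  qed
  show "(h u, c u) \<in> g" if u: "u \<in> VC"
  proof -
    have "c u \<in> Range g" using u c_img s(4) by auto
    then have "\<exists>y. (y, c u) \<in> g" by blast
    then have "(SOME y. (y, c u) \<in> g, c u) \<in> g" by (rule someI_ex)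
    moreover have "u \<notin> VA" using u disj by auto
    ultimately show ?thesis by (simp add: h_def ext_map_def)
  qed
qed

lemma ext_map_props:
  assumes x: "(B', f, g) \<in> ext_sequences \<Gamma> C A B"
  defines "h \<equiv> ext_map a c VA (B', f, g)"
  shows "f = (\<lambda>u. (a u, h u)) ` VA" "g = (\<lambda>u. (h u, c u)) ` VC"
    "graph_iso h l (VA \<union> VC) (ext_graph a c VA VC (B', f, g)) lab (sverts B') (sedges B')"
proof -
  have B': "B' \<in> sobjs \<Gamma>" using ext_sequencesD[OF x] by simp
  note s = admissible_sequence_D[OF A B' C ext_sequencesD(3)[OF x]]
  note hA = ext_map_mem(1)[OF x, folded h_def] and hC = ext_map_mem(2)[OF x, folded h_def]
  note sf = shomD[OF s(1) A B'] and sg = shomD[OF s(2) B' C]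
  show f: "f = (\<lambda>u. (a u, h u)) ` VA"
  proof (intro equalityI subrelI)
    fix p q assume pq: "(p, q) \<in> f"
    then obtain u where u: "u \<in> VA" "p = a u" using sf(1) a_img by blast
    then have "q = h u" using sf(4) pq hA by blast
    then show "(p, q) \<in> (\<lambda>u. (a u, h u)) ` VA" using u by blast
  qed (use hA in auto)
  show g: "g = (\<lambda>u. (h u, c u)) ` VC"
  proof (intro equalityI subrelI)
    fix p q assume pq: "(p, q) \<in> g"
    then obtain u where u: "u \<in> VC" "q = c u" using sg(2) c_img by blast
    then have "p = h u" using sg(5) pq hC by blast
    then show "(p, q) \<in> (\<lambda>u. (h u, c u)) ` VC" using u by blast
  qed (use hC in auto)
  have rf: "Range f = h ` VA" and dg: "Domain g = h ` VC" unfolding f g by force+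
  have "inj_on h (VA \<union> VC)"
  proof (rule inj_onI)
    fix u v assume u: "u \<in> VA \<union> VC" and v: "v \<in> VA \<union> VC" and eq: "h u = h v"
    consider "u \<in> VA" "v \<in> VA" | "u \<in> VC" "v \<in> VC" | "u \<in> VA" "v \<in> VC" | "u \<in> VC" "v \<in> VA"
      using u v by blast
    then show "u = v"
    proof cases
      case 1
      then have "a u = a v" using sf(5) hA eq by metis
      then show ?thesis using a_inj 1 by simp
    next
      case 2
      then have "c u = c v" using sg(4) hC eq by metis
      then show ?thesis using c_inj 2 by simp
    next
      case 3
      then have "h u \<in> Range f \<inter> Domain g" unfolding rf dg using eq by (metis IntI imageI)
      then show ?thesis using s(5) by simp
    next
      case 4
      then have "h u \<in> Range f \<inter> Domain g" unfolding rf dg using eq by (metis IntI imageI)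
      then show ?thesis using s(5) by simp
    qed
  qed
  moreover have "h ` (VA \<union> VC) = sverts B'" using s(6) rf dg by (simp add: image_Un)
  ultimately have "bij_betw h (VA \<union> VC) (sverts B')" by (simp add: bij_betw_def)
  moreover have "lab (h u) = l u" if "u \<in> VA \<union> VC" for u
  proof (cases "u \<in> VA")
    case True then show ?thesis using sf(3)[OF hA] a_lab by simp
  next
    case False
    then have "u \<in> VC" using that by simp
    then show ?thesis using sg(3)[OF hC] c_lab by simp
  qed
  ultimately show "graph_iso h l (VA \<union> VC) (ext_graph a c VA VC (B', f, g)) lab (sverts B') (sedges B')"
    unfolding graph_iso_def by (simp add: ext_graph_def h_def)
qed

lemma ext_graph_glue:
  assumes x: "(B', f, g) \<in> ext_sequences \<Gamma> C A B"
  shows "ext_graph a c VA VC (B', f, g) \<in> glue l VA SA VC SC"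
    and "B \<in> cls l (VA \<union> VC) (ext_graph a c VA VC (B', f, g))"
proof -
  define h where "h = ext_map a c VA (B', f, g)"
  let ?T = "ext_graph a c VA VC (B', f, g)"
  have B': "B' \<in> sobjs \<Gamma>" and BB: "isomorphic_in \<Gamma> B' B" using ext_sequencesD[OF x] by simp_all
  note s = admissible_sequence_D[OF A B' C ext_sequencesD(3)[OF x]]
  note hA = ext_map_mem(1)[OF x, folded h_def] and hC = ext_map_mem(2)[OF x, folded h_def]
  note p = ext_map_props[OF x, folded h_def]
  have T: "(u, v) \<in> ?T \<longleftrightarrow> u \<in> VA \<union> VC \<and> v \<in> VA \<union> VC \<and> (h u, h v) \<in> sedges B'" for u v
    by (simp add: ext_graph_def h_def)
  have lh: "u \<in> VA \<union> VC \<Longrightarrow> lab (h u) = l u" for u using p(3) by (simp add: graph_iso_def)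
  have "matched L R l (VA \<union> VC) ?T"
    by (rule matched_iso[OF graph_iso_inv[OF p(3)] _ matched_sobj[OF B']]) (auto simp: T)
  moreover have "?T \<inter> VA \<times> VA = SA"
  proof (intro equalityI subrelI)
    fix u v assume "(u, v) \<in> ?T \<inter> VA \<times> VA"
    then show "(u, v) \<in> SA" using shomD(6)[OF s(1) A B' hA hA, of u v] a_edge T by auto
  next
    fix u v assume uv: "(u, v) \<in> SA"
    then have "u \<in> VA" "v \<in> VA" using SA by auto
    then show "(u, v) \<in> ?T \<inter> VA \<times> VA" using shomD(6)[OF s(1) A B' hA hA, of u v] a_edge T uv by auto
  qed
  moreover have "?T \<inter> VC \<times> VC = SC"
  proof (intro equalityI subrelI)
    fix u v assume "(u, v) \<in> ?T \<inter> VC \<times> VC"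
    then show "(u, v) \<in> SC" using shomD(6)[OF s(2) B' C hC hC, of u v] c_edge T by auto
  next
    fix u v assume uv: "(u, v) \<in> SC"
    then have "u \<in> VC" "v \<in> VC" using SC by auto
    then show "(u, v) \<in> ?T \<inter> VC \<times> VC" using shomD(6)[OF s(2) B' C hC hC, of u v] c_edge T uv by auto
  qed
  moreover have "(l u, l v) \<in> D" if "(u, v) \<in> ?T" "u \<in> VC" "v \<in> VA" for u v
  proof (rule ccontr)
    assume "(l u, l v) \<notin> D"
    then have "(h v, h u) \<in> sarrows \<Gamma> B'" using that T lh by (simp add: sarrows_iff[OF B'])
    then have "h u \<in> Range f" using s(7)[of "h v"] hA that by blast
    then show False using hC that s(5) by blast
  qed
  moreover have "(l u, l v) \<notin> D" if "(u, v) \<in> ?T" "u \<in> VA" "v \<in> VC" for u v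
  proof
    assume "(l u, l v) \<in> D"
    then have "(h u, h v) \<in> sarrows \<Gamma> B'" using that T lh by (simp add: sarrows_iff[OF B'])
    then have "h v \<in> Range f" using s(7)[of "h u"] hA that by blast
    then show False using hC that s(5) by blast
  qed
  ultimately show "?T \<in> glue l VA SA VC SC" by (simp add: glue_def)
  have "B \<in> iso_class \<Gamma> B'" using BB B by (simp add: iso_class_def)
  then show "B \<in> cls l (VA \<union> VC) ?T" unfolding iso_class_cls[OF B'] cls_eqI[OF p(3)] .
qed

text \<open>An equivalence has to match the two bijections from \<open>VA \<union> VC\<close>, so it is determined; it is an
  isomorphism exactly when both sequences induce the same edges.\<close>

lemma ext_equiv_iff:
  assumes x1: "(B1, f1, g1) \<in> ext_sequences \<Gamma> C A B" and x2: "(B2, f2, g2) \<in> ext_sequences \<Gamma> C A B"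
  shows "(\<exists>\<phi>\<in>siso \<Gamma> B1 B2. f1 O \<phi> = f2 \<and> \<phi> O g2 = g1) \<longleftrightarrow>
    ext_graph a c VA VC (B1, f1, g1) = ext_graph a c VA VC (B2, f2, g2)" (is "?L \<longleftrightarrow> ?T1 = ?T2")
proof -
  let ?V = "VA \<union> VC"
  define h1 where "h1 = ext_map a c VA (B1, f1, g1)"
  define h2 where "h2 = ext_map a c VA (B2, f2, g2)"
  have B1: "B1 \<in> sobjs \<Gamma>" and B2: "B2 \<in> sobjs \<Gamma>"
    using ext_sequencesD[OF x1] ext_sequencesD[OF x2] by simp_all
  note s1 = admissible_sequence_D[OF A B1 C ext_sequencesD(3)[OF x1]]
  note s2 = admissible_sequence_D[OF A B2 C ext_sequencesD(3)[OF x2]]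
  note m1 = ext_map_mem[OF x1, folded h1_def] and m2 = ext_map_mem[OF x2, folded h2_def]
  note p1 = ext_map_props[OF x1, folded h1_def] and p2 = ext_map_props[OF x2, folded h2_def]
  have T1: "(u, v) \<in> ?T1 \<longleftrightarrow> u \<in> ?V \<and> v \<in> ?V \<and> (h1 u, h1 v) \<in> sedges B1" for u v
    by (simp add: ext_graph_def h1_def)
  have T2: "(u, v) \<in> ?T2 \<longleftrightarrow> u \<in> ?V \<and> v \<in> ?V \<and> (h2 u, h2 v) \<in> sedges B2" for u v
    by (simp add: ext_graph_def h2_def)
  have h1V: "h1 ` ?V = sverts B1" and h1inj: "inj_on h1 ?V" and h2inj: "inj_on h2 ?V"
    using p1(3) p2(3) by (auto simp: graph_iso_def bij_betw_def)
  show ?thesis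
  proof
    assume ?L
    then obtain \<phi> where \<phi>: "\<phi> \<in> siso \<Gamma> B1 B2" "f1 O \<phi> = f2" "\<phi> O g2 = g1" by blast
    obtain k where k: "graph_iso k lab (sverts B1) (sedges B1) lab (sverts B2) (sedges B2)"
      and \<phi>k: "\<phi> = fgraph (sverts B1) k" using siso_graph_iso[OF B1 B2 \<phi>(1)] .
    have h2: "h2 u = k (h1 u)" if u: "u \<in> ?V" for u
    proof (cases "u \<in> VA")
      case True
      have "h1 u \<in> sverts B1" using h1V u by blast
      then have "(h1 u, k (h1 u)) \<in> \<phi>" by (simp add: \<phi>k)
      then have "(a u, k (h1 u)) \<in> f2" using m1(1)[OF True] \<phi>(2) by blast
      then show ?thesis using shomD(4)[OF s2(1) A B2 m2(1)[OF True]] by blast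
    next
      case False
      then have uC: "u \<in> VC" using u by simp
      then have "(h1 u, c u) \<in> \<phi> O g2" using m1(2) \<phi>(3) by simp
      then obtain z where "(h1 u, z) \<in> \<phi>" and z: "(z, c u) \<in> g2" by blast
      then have "z = k (h1 u)" by (simp add: \<phi>k)
      then show ?thesis using shomD(5)[OF s2(2) B2 C z m2(2)[OF uC]] by simp
    qed
    have "(u, v) \<in> ?T1 \<longleftrightarrow> (u, v) \<in> ?T2" for u v
    proof (cases "u \<in> ?V \<and> v \<in> ?V")
      case True
      then have "h1 u \<in> sverts B1" "h1 v \<in> sverts B1" using h1V by blast+
      then show ?thesis unfolding T1 T2 using True k h2 by (simp add: graph_iso_def)
    qed (auto simp: T1 T2)
    then show "?T1 = ?T2" by (intro equalityI subrelI) (simp_all only:)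
  next
    assume eq: "?T1 = ?T2"
    define k where "k = h2 \<circ> inv_into ?V h1"
    have k: "k (h1 u) = h2 u" if "u \<in> ?V" for u using inv_into_f_f[OF h1inj that] by (simp add: k_def)
    have "graph_iso k lab (sverts B1) (sedges B1) lab (sverts B2) (sedges B2)"
      unfolding k_def by (rule graph_iso_comp[OF graph_iso_inv[OF p1(3)]]) (use p2(3) eq in simp)
    then have \<phi>: "fgraph (sverts B1) k \<in> siso \<Gamma> B1 B2" by (rule graph_iso_siso[OF B1 B2])
    have h1B: "h1 u \<in> sverts B1" if "u \<in> ?V" for u using h1V that by blast
    have "f1 O fgraph (sverts B1) k = f2"
    proof (intro equalityI subrelI)
      fix p q assume "(p, q) \<in> f1 O fgraph (sverts B1) k"
      then obtain u where "u \<in> VA" "p = a u" "q = k (h1 u)" using p1(1) by auto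
      then show "(p, q) \<in> f2" using k m2(1) by simp
    next
      fix p q assume "(p, q) \<in> f2"
      then obtain u where u: "u \<in> VA" "p = a u" "q = h2 u" using p2(1) by auto
      then have "(h1 u, q) \<in> fgraph (sverts B1) k" using k h1B by simp
      then show "(p, q) \<in> f1 O fgraph (sverts B1) k" using m1(1) u by blast
    qed
    moreover have "fgraph (sverts B1) k O g2 = g1"
    proof (intro equalityI subrelI)
      fix p q assume "(p, q) \<in> fgraph (sverts B1) k O g2"
      then have p: "p \<in> sverts B1" "(k p, q) \<in> g2" by auto
      obtain w where w: "w \<in> ?V" "p = h1 w" using p(1) h1V by blast
      obtain u where u: "u \<in> VC" "k p = h2 u" "q = c u" using p(2) p2(2) by auto
      have "w = u" using inj_onD[OF h2inj, of w u] k w u by simp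
      then show "(p, q) \<in> g1" using m1(2) u w by simp
    next
      fix p q assume "(p, q) \<in> g1"
      then obtain u where u: "u \<in> VC" "p = h1 u" "q = c u" using p1(2) by auto
      then have "(p, h2 u) \<in> fgraph (sverts B1) k" using k h1B by simp
      then show "(p, q) \<in> fgraph (sverts B1) k O g2" using m2(2) u by blast
    qed
    ultimately show ?L using \<phi> by blast
  qed
qed

text \<open>The middle term is realised with connected parts, so that closure under arrows suffices for
  admissibility.\<close>

lemma ext_graph_surj:
  assumes T: "T \<in> glue l VA SA VC SC" and BT: "B \<in> cls l (VA \<union> VC) T"
  shows "\<exists>x\<in>ext_sequences \<Gamma> C A B. ext_graph a c VA VC x = T"
proof -
  let ?V = "VA \<union> VC"
  have m: "matched L R l ?V T" and TA: "T \<inter> VA \<times> VA = SA" and TC: "T \<inter> VC \<times> VC = SC"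
    using T by (auto simp: glue_def)
  have TD: "(u, v) \<in> T \<Longrightarrow> u \<in> VC \<Longrightarrow> v \<in> VA \<Longrightarrow> (l u, l v) \<in> D"
    "(u, v) \<in> T \<Longrightarrow> u \<in> VA \<Longrightarrow> v \<in> VC \<Longrightarrow> (l u, l v) \<notin> D" for u v
    using T by (auto simp: glue_def)
  obtain B' h where B': "B' \<in> sobjs \<Gamma>" "connected_obj B'"
    and h: "graph_iso h l ?V T lab (sverts B') (sedges B')" using realisation[OF m] .
  have hinj: "h u = h v \<longleftrightarrow> u = v" if "u \<in> ?V" "v \<in> ?V" for u v
    using h that by (auto simp: graph_iso_def bij_betw_def dest: inj_onD)
  have hV: "h ` ?V = sverts B'" and hl: "\<And>u. u \<in> ?V \<Longrightarrow> lab (h u) = l u"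
    and he: "\<And>u v. u \<in> ?V \<Longrightarrow> v \<in> ?V \<Longrightarrow> (h u, h v) \<in> sedges B' \<longleftrightarrow> (u, v) \<in> T"
    using h by (auto simp: graph_iso_def bij_betw_def)
  define f where "f = (\<lambda>u. (a u, h u)) ` VA"
  define g where "g = (\<lambda>u. (h u, c u)) ` VC"
  have hB: "h u \<in> sverts B'" if "u \<in> ?V" for u using hV that by blast
  have f: "f \<in> shom \<Gamma> A B'"
    unfolding f_def
    by (rule shom_pairsI[OF A B'(1)]) (use a_img a_lab a_inj a_edge hB hl hinj he TA in auto)
  have g: "g \<in> shom \<Gamma> B' C"
    unfolding g_def
    by (rule shom_pairsI[OF B'(1) C]) (use c_img c_lab c_inj c_edge hB hl hinj he TC in auto)
  have rf: "Range f = h ` VA" and dg: "Domain g = h ` VC" unfolding f_def g_def by force+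
  have df: "Domain f = sverts A" and rg: "Range g = sverts C" unfolding f_def g_def a_img[symmetric] c_img[symmetric] by force+
  have "h u \<noteq> h v" if "u \<in> VA" "v \<in> VC" for u v using hinj that disj by auto
  then have disj': "Range f \<inter> Domain g = {}" unfolding rf dg by blast
  have cover: "Range f \<union> Domain g = sverts B'" unfolding rf dg using hV by (simp add: image_Un)
  have closed: "y \<in> Range f" if x: "x \<in> Range f" and xy: "(x, y) \<in> sarrows \<Gamma> B'" for x y
  proof (rule ccontr)
    assume n: "y \<notin> Range f"
    have "y \<in> sverts B'" using xy by (simp add: sarrows_def)
    then obtain v where v: "v \<in> VC" "y = h v" using n cover dg by blast
    obtain u where u: "u \<in> VA" "x = h u" using x rf by blast
    show False using xy TD u v he hl unfolding sarrows_iff[OF B'(1)] by auto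
  qed
  have "admissible_sequence \<Gamma> A B' C f g"
    by (rule admissible_sequence_I[OF A B'(1) C B'(2) f g df rg disj' cover closed])
  moreover have "isomorphic_in \<Gamma> B' B"
  proof -
    have "B \<in> iso_class \<Gamma> B'" using BT cls_eqI[OF h] iso_class_cls[OF B'(1)] by simp
    then show ?thesis by (simp add: iso_class_def)
  qed
  ultimately have x: "(B', f, g) \<in> ext_sequences \<Gamma> C A B" using B'(1) by (simp add: ext_sequences_def)
  have hu: "ext_map a c VA (B', f, g) u = h u" if u: "u \<in> ?V" for u
  proof (cases "u \<in> VA")
    case True
    have "(a u, h u) \<in> f" using True by (simp add: f_def)
    then show ?thesis using shomD(4)[OF f A B'(1) ext_map_mem(1)[OF x True]] by blast
  next
    case False
    then have uC: "u \<in> VC" using u by simp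
    then have "(h u, c u) \<in> g" by (simp add: g_def)
    then show ?thesis using shomD(5)[OF g B'(1) C ext_map_mem(2)[OF x uC]] by blast
  qed
  have "(u, v) \<in> ext_graph a c VA VC (B', f, g) \<longleftrightarrow> (u, v) \<in> T" for u v
    using hu he matchedD(3)[OF m] by (auto simp: ext_graph_def)
  then have "ext_graph a c VA VC (B', f, g) = T" by (intro equalityI subrelI) (simp_all only:)
  then show ?thesis using x by blast
qed

lemma card_Ext_aux: "card (Ext \<Gamma> C A B) = card {T \<in> glue l VA SA VC SC. B \<in> cls l (VA \<union> VC) T}"
proof -
  let ?S = "ext_sequences \<Gamma> C A B" and ?e = "ext_graph a c VA VC"
  have "ext_equiv \<Gamma> C A B = {(x, y). x \<in> ?S \<and> y \<in> ?S \<and> ?e x = ?e y}"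
  proof (intro equalityI subrelI)
    fix x y :: "sobj \<times> smor \<times> smor"
    obtain B1 f1 g1 B2 f2 g2 where xy: "x = (B1, f1, g1)" "y = (B2, f2, g2)" by (metis prod_cases3)
    have *: "(x, y) \<in> ext_equiv \<Gamma> C A B \<longleftrightarrow> x \<in> ?S \<and> y \<in> ?S \<and> ?e x = ?e y"
      unfolding xy ext_equiv_def mem_Collect_eq prod.case
      using ext_equiv_iff[of B1 f1 g1 B2 f2 g2] by blast
    show "(x, y) \<in> {(x, y). x \<in> ?S \<and> y \<in> ?S \<and> ?e x = ?e y}" if "(x, y) \<in> ext_equiv \<Gamma> C A B"
      using that unfolding * by simp
    show "(x, y) \<in> ext_equiv \<Gamma> C A B" if "(x, y) \<in> {(x, y). x \<in> ?S \<and> y \<in> ?S \<and> ?e x = ?e y}"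
      using that unfolding * by simp
  qed
  then have "card (Ext \<Gamma> C A B) = card (?e ` ?S)"
    unfolding Ext_def by (simp only: card_quotient_kernel)
  also have "?e ` ?S = {T \<in> glue l VA SA VC SC. B \<in> cls l (VA \<union> VC) T}"
  proof (intro equalityI subsetI)
    fix T assume "T \<in> ?e ` ?S"
    then obtain B' f g where "(B', f, g) \<in> ?S" "T = ?e (B', f, g)" by (metis imageE prod_cases3)
    then show "T \<in> {T \<in> glue l VA SA VC SC. B \<in> cls l (VA \<union> VC) T}" using ext_graph_glue by simp
  next
    fix T assume "T \<in> {T \<in> glue l VA SA VC SC. B \<in> cls l (VA \<union> VC) T}"
    then show "T \<in> ?e ` ?S" using ext_graph_surj by blast
  qed
  finally show ?thesis .
qed

end

text \<open>Extensions are counted by edge sets on the disjoint union of the two graphs, for any choice of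
  graphs representing the two classes.\<close>

theorem card_Ext:
  assumes "A \<in> cls l VA SA" "C \<in> cls l VC SC" "B \<in> sobjs \<Gamma>"
    and "SA \<subseteq> VA \<times> VA" "SC \<subseteq> VC \<times> VC" "VA \<inter> VC = {}"
  shows "card (Ext \<Gamma> C A B) = card {T \<in> glue l VA SA VC SC. B \<in> cls l (VA \<union> VC) T}"
proof -
  obtain a c where "graph_iso a l VA SA lab (sverts A) (sedges A)" "graph_iso c l VC SC lab (sverts C) (sedges C)"
    "A \<in> sobjs \<Gamma>" "C \<in> sobjs \<Gamma>" using assms unfolding cls_def by blast
  then show ?thesis using card_Ext_aux assms by blast
qed

end

section \<open>Reversing arrows\<close>

lemma alternating_sum_Pow:
  "finite X \<Longrightarrow> (\<Sum>Y\<in>Pow X. (- 1) ^ card Y) = (if X = {} then 1 else (0 :: 'k::comm_ring_1))"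
  using prod_diff_conv_sum[of X "\<lambda>_. 1 :: 'k" "\<lambda>_. 1"] by (simp add: prod_zero_iff power_0_left card_eq_0_iff)

text \<open>Summing over isomorphism classes with multiplicities amounts to summing over graphs. All
  identities between structure constants are proved on the level of graphs in this way.\<close>

lemma sum_fibres:
  fixes \<Phi> :: "'b \<Rightarrow> 'k::field_char_0"
  assumes "finite E" "finite N" "f ` E \<subseteq> N"
  shows "(\<Sum>K\<in>N. of_nat (card {T \<in> E. f T = K}) * \<Phi> K) = (\<Sum>T\<in>E. \<Phi> (f T))"
proof -
  have "(\<Sum>T\<in>{T \<in> E. f T = K}. \<Phi> (f T)) = of_nat (card {T \<in> E. f T = K}) * \<Phi> K" for K
    by (simp add: sum.cong[of "{T \<in> E. f T = K}" _ "\<lambda>T. \<Phi> (f T)" "\<lambda>_. \<Phi> K"])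
  then show ?thesis using sum.group[OF assms, of "\<lambda>T. \<Phi> (f T)"] by simp
qed

lemma sum_fibres_support:
  fixes \<Phi> :: "'b \<Rightarrow> 'k::field_char_0"
  assumes E: "finite E" and N: "finite N" "\<And>K. K \<in> f ` E \<Longrightarrow> \<Phi> K \<noteq> 0 \<Longrightarrow> K \<in> N"
  shows "(\<Sum>K\<in>N. of_nat (card {T \<in> E. f T = K}) * \<Phi> K) = (\<Sum>T\<in>E. \<Phi> (f T))"
proof -
  have "(\<Sum>K\<in>N. of_nat (card {T \<in> E. f T = K}) * \<Phi> K)
      = (\<Sum>K\<in>N \<union> f ` E. of_nat (card {T \<in> E. f T = K}) * \<Phi> K)"
    by (rule sum.mono_neutral_left) (use E N in auto)
  also have "\<dots> = (\<Sum>T\<in>E. \<Phi> (f T))" by (rule sum_fibres) (use E N in auto)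
  finally show ?thesis .
qed

section \<open>Adding edges of given types\<close>

definition type_edges :: "'a rel \<Rightarrow> ('v \<Rightarrow> 'a) \<Rightarrow> 'v rel \<Rightarrow> 'v rel" where
  "type_edges F l S = {(u, v) \<in> S. (l u, l v) \<in> F}"

definition edge_sign :: "'a rel \<Rightarrow> ('v \<Rightarrow> 'a) \<Rightarrow> 'v rel \<Rightarrow> 'k::field_char_0" where
  "edge_sign F l S = (- 1) ^ card (type_edges F l S)"

definition added :: "'a set \<Rightarrow> 'a rel \<Rightarrow> 'a rel \<Rightarrow> ('v \<Rightarrow> 'a) \<Rightarrow> 'v set \<Rightarrow> 'v rel \<Rightarrow> 'v rel set" where
  "added L R F l V S = {T. matched L R l V T \<and> S \<subseteq> T \<and> (\<forall>u v. (u, v) \<in> T - S \<longrightarrow> (l u, l v) \<in> F)}"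

lemma edge_sign_square: "edge_sign F l S * edge_sign F l S = (1 :: 'k::field_char_0)"
  by (simp add: edge_sign_def power_add[symmetric] mult_2[symmetric])

lemma finite_matched_sets:
  assumes "finite V" shows "finite {T. matched L R l V T}"
  by (rule finite_subset[of _ "Pow (V \<times> V)"]) (use assms in \<open>auto dest: matchedD(3)\<close>)

lemma finite_added: "finite V \<Longrightarrow> finite (added L R F l V S)"
  by (rule finite_subset[OF _ finite_matched_sets]) (auto simp: added_def)

lemma added_subset: "T \<in> added L R F l V S \<Longrightarrow> T \<subseteq> V \<times> V"
  unfolding added_def using matchedD(3) by blast

lemma finite_edges: "matched L R l V S \<Longrightarrow> finite S"
  using matchedD(1,3) by (metis finite_SigmaI finite_subset)

lemma edge_sign_Un:
  assumes "finite S" "finite S'" "S \<inter> S' = {}"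
  shows "edge_sign F l (S \<union> S') = (edge_sign F l S * edge_sign F l S' :: 'k::field_char_0)"
proof -
  have "type_edges F l (S \<union> S') = type_edges F l S \<union> type_edges F l S'" by (auto simp: type_edges_def)
  moreover have "card (type_edges F l S \<union> type_edges F l S') = card (type_edges F l S) + card (type_edges F l S')"
    by (rule card_Un_disjoint) (use assms in \<open>auto simp: type_edges_def intro: finite_subset\<close>)
  ultimately show ?thesis by (simp add: edge_sign_def power_add)
qed

lemma edge_sign_all:
  assumes "\<And>u v. (u, v) \<in> Y \<Longrightarrow> (l u, l v) \<in> F" shows "edge_sign F l Y = (- 1) ^ card Y"
proof -
  have "type_edges F l Y = Y" using assms by (auto simp: type_edges_def)
  then show ?thesis by (simp add: edge_sign_def)
qed

lemma edge_sign_none: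
  assumes "\<And>u v. (u, v) \<in> Y \<Longrightarrow> (l u, l v) \<notin> F" shows "edge_sign F l Y = 1"
proof -
  have "type_edges F l Y = {}" using assms by (auto simp: type_edges_def)
  then show ?thesis by (simp add: edge_sign_def)
qed

context
  fixes h :: "'v \<Rightarrow> 'u" and l :: "'v \<Rightarrow> 'a" and V S l' V' S'
  assumes iso: "graph_iso h l V S l' V' S'" and S: "S \<subseteq> V \<times> V" and S': "S' \<subseteq> V' \<times> V'"
begin

abbreviation "edge_image \<equiv> (`) (map_prod h h)"

lemma iso_vertex:
  shows "\<And>u v. u \<in> V \<Longrightarrow> v \<in> V \<Longrightarrow> h u = h v \<Longrightarrow> u = v" and "h ` V = V'"
    and "\<And>u. u \<in> V \<Longrightarrow> l' (h u) = l u" and "\<And>u. u \<in> V \<Longrightarrow> h u \<in> V'"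
  using iso by (auto simp: graph_iso_def bij_betw_def dest: inj_onD)

lemma iso_edge: "u \<in> V \<Longrightarrow> v \<in> V \<Longrightarrow> (h u, h v) \<in> S' \<longleftrightarrow> (u, v) \<in> S"
  using iso by (simp add: graph_iso_def)

lemma edge_image_inj: "inj_on (map_prod h h) (V \<times> V)"
  using iso_vertex(1) by (auto simp: inj_on_def)

lemma edge_image_surj: "edge_image (V \<times> V) = V' \<times> V'"
  using iso_vertex(2) by (auto simp: map_prod_def image_iff)

lemma edge_image_mem: assumes "T \<subseteq> V \<times> V" "u \<in> V" "v \<in> V" shows "(h u, h v) \<in> edge_image T \<longleftrightarrow> (u, v) \<in> T"
proof
  assume "(h u, h v) \<in> edge_image T"
  then obtain x y where "(x, y) \<in> T" "h u = h x" "h v = h y" by auto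
  then show "(u, v) \<in> T" using iso_vertex(1)[of u x] iso_vertex(1)[of v y] assms by auto
qed force

lemma edge_image_iso: "T \<subseteq> V \<times> V \<Longrightarrow> graph_iso h l V T l' V' (edge_image T)"
  using iso edge_image_mem unfolding graph_iso_def by auto

lemma edge_image_sub: "T \<subseteq> V \<times> V \<Longrightarrow> edge_image T \<subseteq> V' \<times> V'"
  using edge_image_surj by (metis image_mono)

lemma edge_image_S: "edge_image S = S'"
proof (intro equalityI subrelI)
  fix x y assume "(x, y) \<in> edge_image S"
  then obtain u v where "(u, v) \<in> S" "x = h u" "y = h v" by auto
  then show "(x, y) \<in> S'" using S iso by (auto simp: graph_iso_def)
next
  fix x y assume xy: "(x, y) \<in> S'"
  then obtain u v where u: "u \<in> V" "x = h u" and v: "v \<in> V" "y = h v" using S' iso_vertex(2) by blast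
  then have "(u, v) \<in> S" using xy iso by (auto simp: graph_iso_def)
  then show "(x, y) \<in> edge_image S" using u v by force
qed

lemma edge_sign_iso: "edge_sign F l S = edge_sign F l' S'"
proof -
  have "type_edges F l' S' = edge_image (type_edges F l S)"
  proof (intro equalityI subrelI)
    fix x y assume "(x, y) \<in> type_edges F l' S'"
    then have "(x, y) \<in> edge_image S" "(l' x, l' y) \<in> F" by (auto simp: type_edges_def edge_image_S)
    then obtain u v where uv: "(u, v) \<in> S" "x = h u" "y = h v" by auto
    then have "(u, v) \<in> type_edges F l S" using S iso_vertex(3) \<open>(l' x, l' y) \<in> F\<close> by (auto simp: type_edges_def)
    then show "(x, y) \<in> edge_image (type_edges F l S)" using uv by force
  next
    fix x y assume "(x, y) \<in> edge_image (type_edges F l S)"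
    then obtain u v where uv: "(u, v) \<in> S" "(l u, l v) \<in> F" "x = h u" "y = h v" by (auto simp: type_edges_def)
    then have "(x, y) \<in> edge_image S" by force
    then show "(x, y) \<in> type_edges F l' S'" using uv S iso_vertex(3) by (auto simp: type_edges_def edge_image_S)
  qed
  moreover have "inj_on (map_prod h h) (type_edges F l S)"
    by (rule inj_on_subset[OF edge_image_inj]) (use S in \<open>auto simp: type_edges_def\<close>)
  ultimately show ?thesis by (simp add: edge_sign_def card_image)
qed

lemma added_iso: "bij_betw edge_image (added L R F l V S) (added L R F l' V' S')"
proof -
  have sub: "T \<subseteq> V \<times> V" if "T \<in> added L R F l V S" for T
    using added_subset[OF that] .
  have inj: "inj_on edge_image (added L R F l V S)"
  proof (rule inj_onI)
    fix T T' assume T: "T \<in> added L R F l V S" "T' \<in> added L R F l V S" "edge_image T = edge_image T'"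
    then show "T = T'" by (simp only: inj_on_image_eq_iff[OF edge_image_inj sub sub])
  qed
  have "edge_image ` added L R F l V S = added L R F l' V' S'"
  proof (intro equalityI subsetI)
    fix T' assume "T' \<in> edge_image ` added L R F l V S"
    then obtain T where T: "T \<in> added L R F l V S" "T' = edge_image T" by blast
    then have m: "matched L R l V T" "S \<subseteq> T" by (auto simp: added_def)
    have "matched L R l' V' T'" unfolding T(2) by (rule matched_iso[OF edge_image_iso edge_image_sub m(1)]) (use sub T in auto)
    moreover have "S' \<subseteq> T'" using m(2) T(2) edge_image_S by (metis image_mono)
    moreover have "(l' x, l' y) \<in> F" if xy: "(x, y) \<in> T' - S'" for x y
    proof -
      obtain u v where uv: "(u, v) \<in> T" "x = h u" "y = h v" using xy T(2) by auto
      have uV: "u \<in> V" "v \<in> V" using uv sub[OF T(1)] by auto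
      have "(u, v) \<notin> S" using uv xy edge_image_S by force
      then have "(l u, l v) \<in> F" using uv T(1) by (auto simp: added_def)
      then show ?thesis using uv uV iso_vertex(3) by simp
    qed
    ultimately show "T' \<in> added L R F l' V' S'" by (auto simp: added_def)
  next
    fix T' assume T': "T' \<in> added L R F l' V' S'"
    then have m: "matched L R l' V' T'" "S' \<subseteq> T'" by (auto simp: added_def)
    define T where "T = {(u, v). u \<in> V \<and> v \<in> V \<and> (h u, h v) \<in> T'}"
    have TV: "T \<subseteq> V \<times> V" by (auto simp: T_def)
    have iso_T: "graph_iso h l V T l' V' T'" using iso by (simp add: graph_iso_def T_def)
    have "matched L R l V T" by (rule matched_iso[OF graph_iso_inv[OF iso_T] TV m(1)])
    moreover have "S \<subseteq> T"
    proof (rule subrelI)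
      fix u v assume uv: "(u, v) \<in> S"
      then have V: "u \<in> V" "v \<in> V" using S by auto
      then have "(h u, h v) \<in> T'" using iso_edge uv m(2) by blast
      then show "(u, v) \<in> T" using V by (simp add: T_def)
    qed
    moreover have "(l u, l v) \<in> F" if "(u, v) \<in> T - S" for u v
    proof -
      have V: "u \<in> V" "v \<in> V" and "(h u, h v) \<in> T'" using that by (simp_all add: T_def)
      moreover have "(h u, h v) \<notin> S'" using that iso_edge[OF V] by simp
      ultimately have "(l' (h u), l' (h v)) \<in> F" using T' unfolding added_def by blast
      then show ?thesis using iso_vertex(3) V by simp
    qed
    ultimately have TT: "T \<in> added L R F l V S" by (auto simp: added_def)
    have "T' = edge_image T"
    proof (intro equalityI subrelI)
      fix x y assume xy: "(x, y) \<in> T'"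
      then obtain u v where u: "u \<in> V" "x = h u" and v: "v \<in> V" "y = h v"
        using matchedD(3)[OF m(1)] iso_vertex(2) by blast
      then have "(u, v) \<in> T" using xy by (simp add: T_def)
      then show "(x, y) \<in> edge_image T" using u v by force
    qed (auto simp: T_def)
    then show "T' \<in> edge_image ` added L R F l V S" using TT by blast
  qed
  then show ?thesis using inj by (simp add: bij_betw_def)
qed

end

text \<open>Both orientations live on the same forest, and \<open>F\<close> is the set of edges whose arrows differ.\<close>

locale arrow_reversal =
  X: oriented_forest L R \<Gamma> D \<rho> + Y: oriented_forest L R \<Gamma>' D' \<rho>'
  for L R \<Gamma> D \<rho> \<Gamma>' D' \<rho>' +
  fixes F :: "nat rel"
  assumes F: "F \<subseteq> R" and D': "e \<in> R \<Longrightarrow> e \<in> D' \<longleftrightarrow> (e \<in> D \<longleftrightarrow> e \<notin> F)"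
begin

text \<open>The matrix of the isomorphism in the bases of isomorphism classes.\<close>

definition transition :: "sobj set \<Rightarrow> sobj set \<Rightarrow> 'k::field_char_0" where
  "transition K K' = edge_sign F X.lab (X.sedges (rep K)) *
     of_nat (card {T \<in> added L R F X.lab (sverts (rep K)) (X.sedges (rep K)).
       Y.cls X.lab (sverts (rep K)) T = K'})"

text \<open>The chosen representative of a class may be replaced by any graph that represents it.\<close>

lemma transition_cls:
  assumes m: "matched L R l V S"
  shows "transition (X.cls l V S) K' =
    (edge_sign F l S * of_nat (card {T \<in> added L R F l V S. Y.cls l V T = K'}) :: 'k::field_char_0)"
proof -
  let ?A = "rep (X.cls l V S)"
  have "?A \<in> X.cls l V S" using X.rep_in X.cls_in_iso_classes[OF m] .
  then obtain h where A: "?A \<in> sobjs \<Gamma>" and h: "graph_iso h l V S X.lab (sverts ?A) (X.sedges ?A)"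
    unfolding X.cls_def by blast
  have SV: "S \<subseteq> V \<times> V" "X.sedges ?A \<subseteq> sverts ?A \<times> sverts ?A"
    using matchedD(3)[OF m] matchedD(3)[OF X.matched_sobj[OF A]] by auto
  let ?h = "(`) (map_prod h h)"
  have b: "bij_betw ?h (added L R F l V S) (added L R F X.lab (sverts ?A) (X.sedges ?A))"
    by (rule added_iso[OF h SV])
  have c: "Y.cls X.lab (sverts ?A) (?h T) = Y.cls l V T" if "T \<in> added L R F l V S" for T
    by (rule Y.cls_eqI[symmetric, OF edge_image_iso[OF h SV]]) (rule added_subset[OF that])
  have "bij_betw ?h {T \<in> added L R F l V S. Y.cls l V T = K'}
      {T \<in> added L R F X.lab (sverts ?A) (X.sedges ?A). Y.cls X.lab (sverts ?A) T = K'}"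
    unfolding bij_betw_def
  proof
    show "inj_on ?h {T \<in> added L R F l V S. Y.cls l V T = K'}"
      using b by (auto simp: bij_betw_def intro: inj_on_subset)
    show "?h ` {T \<in> added L R F l V S. Y.cls l V T = K'} =
        {T \<in> added L R F X.lab (sverts ?A) (X.sedges ?A). Y.cls X.lab (sverts ?A) T = K'}"
    proof (intro equalityI subsetI)
      fix T' assume "T' \<in> ?h ` {T \<in> added L R F l V S. Y.cls l V T = K'}"
      then obtain T where T: "T \<in> added L R F l V S" "Y.cls l V T = K'" "T' = ?h T" by blast
      then show "T' \<in> {T \<in> added L R F X.lab (sverts ?A) (X.sedges ?A). Y.cls X.lab (sverts ?A) T = K'}"
        using bij_betwE[OF b] c[OF T(1)] by simp
    next
      fix T' assume T': "T' \<in> {T \<in> added L R F X.lab (sverts ?A) (X.sedges ?A). Y.cls X.lab (sverts ?A) T = K'}"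
      then obtain T where T: "T \<in> added L R F l V S" "T' = ?h T" using b unfolding bij_betw_def by blast
      then show "T' \<in> ?h ` {T \<in> added L R F l V S. Y.cls l V T = K'}" using T' c[OF T(1)] by simp
    qed
  qed
  from bij_betw_same_card[OF this] show ?thesis
    unfolding transition_def by (simp add: edge_sign_iso[OF h SV])
qed

lemma sum_transition:
  assumes m: "matched L R l V S" and N: "finite N"
    and supp: "\<And>T. T \<in> added L R F l V S \<Longrightarrow> \<Phi> (Y.cls l V T) \<noteq> 0 \<Longrightarrow> Y.cls l V T \<in> N"
  shows "(\<Sum>K'\<in>N. transition (X.cls l V S) K' * \<Phi> K') =
    (edge_sign F l S * (\<Sum>T\<in>added L R F l V S. \<Phi> (Y.cls l V T)) :: 'k::field_char_0)"
proof -
  have fin: "finite (added L R F l V S)" using finite_added matchedD(1)[OF m] .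
  have "(\<Sum>K'\<in>N. transition (X.cls l V S) K' * \<Phi> K') =
      edge_sign F l S * (\<Sum>K'\<in>N. of_nat (card {T \<in> added L R F l V S. Y.cls l V T = K'}) * \<Phi> K')"
    by (simp add: transition_cls[OF m] sum_distrib_left mult.assoc)
  also have "(\<Sum>K'\<in>N. of_nat (card {T \<in> added L R F l V S. Y.cls l V T = K'}) * \<Phi> K')
      = (\<Sum>T\<in>added L R F l V S. \<Phi> (Y.cls l V T))"
    by (rule sum_fibres_support[OF fin N]) (use supp in auto)
  finally show ?thesis .
qed

lemma transition_support:
  assumes "K \<in> iso_classes \<Gamma>"
  shows "finite {K'. transition K K' \<noteq> (0 :: 'k::field_char_0)}"
    and "{K'. transition K K' \<noteq> (0 :: 'k)} \<subseteq> iso_classes \<Gamma>'"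
proof -
  let ?A = "rep K"
  have A: "?A \<in> sobjs \<Gamma>" using X.iso_classes_cls(1)[OF assms X.rep_in[OF assms]] .
  let ?E = "added L R F X.lab (sverts ?A) (X.sedges ?A)"
  have sub: "{K'. transition K K' \<noteq> (0 :: 'k)} \<subseteq> Y.cls X.lab (sverts ?A) ` ?E"
  proof
    fix K' assume "K' \<in> {K'. transition K K' \<noteq> (0 :: 'k)}"
    then have "card {T \<in> ?E. Y.cls X.lab (sverts ?A) T = K'} \<noteq> 0" by (auto simp: transition_def)
    then have "{T \<in> ?E. Y.cls X.lab (sverts ?A) T = K'} \<noteq> {}" by (metis card.empty)
    then show "K' \<in> Y.cls X.lab (sverts ?A) ` ?E" by blast
  qed
  have "finite ?E" by (rule finite_added[OF X.finite_sverts[OF A]])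
  then show "finite {K'. transition K K' \<noteq> (0 :: 'k)}" using sub by (meson finite_imageI finite_subset)
  have "Y.cls X.lab (sverts ?A) ` ?E \<subseteq> iso_classes \<Gamma>'"
    using Y.cls_in_iso_classes by (auto simp: added_def)
  then show "{K'. transition K K' \<noteq> (0 :: 'k)} \<subseteq> iso_classes \<Gamma>'" using sub by blast
qed

text \<open>The intermediate graphs \<open>T\<close> arise from \<open>S\<close> by adding arbitrary subsets of \<open>U - S\<close>, and every added
  edge changes the sign.\<close>

lemma signed_added_sum:
  assumes U: "U \<in> added L R F l V S" and m: "matched L R l V S"
  shows "(\<Sum>T\<in>{T. T \<in> added L R F l V S \<and> U \<in> added L R F l V T}. edge_sign F l T) =
    (if U = S then edge_sign F l S else 0 :: 'k::field_char_0)"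
proof -
  have mU: "matched L R l V U" and SU: "S \<subseteq> U" and UF: "\<And>u v. (u, v) \<in> U - S \<Longrightarrow> (l u, l v) \<in> F"
    using U by (auto simp: added_def)
  have finU: "finite U" using finite_edges[OF mU] .
  let ?E = "{T. T \<in> added L R F l V S \<and> U \<in> added L R F l V T}"
  have E: "?E = (\<lambda>Y. S \<union> Y) ` Pow (U - S)"
  proof (intro equalityI subsetI)
    fix T assume "T \<in> ?E"
    then have "S \<subseteq> T" "T \<subseteq> U" by (auto simp: added_def)
    then have "T = S \<union> (T - S)" "T - S \<in> Pow (U - S)" by auto
    then show "T \<in> (\<lambda>Y. S \<union> Y) ` Pow (U - S)" by blast
  next
    fix T assume "T \<in> (\<lambda>Y. S \<union> Y) ` Pow (U - S)"
    then have T: "S \<subseteq> T" "T \<subseteq> U" using SU by auto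
    have "matched L R l V T" by (rule matched_subset[OF mU T(2)])
    then show "T \<in> ?E" using T UF mU by (auto simp: added_def)
  qed
  have inj: "inj_on (\<lambda>Y. S \<union> Y) (Pow (U - S))" by (rule inj_onI) blast
  have sgn: "edge_sign F l (S \<union> Y) = (edge_sign F l S * (- 1) ^ card Y :: 'k)" if Y: "Y \<in> Pow (U - S)" for Y
  proof -
    have "edge_sign F l (S \<union> Y) = (edge_sign F l S * edge_sign F l Y :: 'k)"
      by (rule edge_sign_Un) (use Y finU SU in \<open>auto intro: finite_subset\<close>)
    moreover have "edge_sign F l Y = ((- 1) ^ card Y :: 'k)" by (rule edge_sign_all) (use Y UF in auto)
    ultimately show ?thesis by simp
  qed
  have "(\<Sum>T\<in>?E. edge_sign F l T) = (\<Sum>Y\<in>Pow (U - S). edge_sign F l S * (- 1) ^ card Y :: 'k)"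
    unfolding E sum.reindex[OF inj] o_def by (rule sum.cong) (use sgn in auto)
  also have "\<dots> = edge_sign F l S * (if U - S = {} then 1 else 0)"
    using alternating_sum_Pow[of "U - S", where 'k = 'k] finU by (simp add: sum_distrib_left[symmetric])
  finally show ?thesis using SU by auto
qed

lemma added_trans: "T \<in> added L R F l V S \<Longrightarrow> U \<in> added L R F l V T \<Longrightarrow> U \<in> added L R F l V S"
  unfolding added_def by blast

lemma added_refl: "matched L R l V S \<Longrightarrow> S \<in> added L R F l V S"
  by (simp add: added_def)

end

sublocale arrow_reversal \<subseteq> inverse: arrow_reversal L R \<Gamma>' D' \<rho>' \<Gamma> D \<rho> F
  by unfold_locales (use F D' in auto)

context arrow_reversal
begin

lemma transition_inverse:
  assumes K: "K \<in> iso_classes \<Gamma>" and N: "finite N" "{K'. transition K K' \<noteq> (0 :: 'k)} \<subseteq> N"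
  shows "(\<Sum>K'\<in>N. transition K K' * inverse.transition K' K'') = (if K = K'' then 1 else 0 :: 'k::field_char_0)"
proof -
  have A: "rep K \<in> sobjs \<Gamma>" and KA: "K = X.cls X.lab (sverts (rep K)) (X.sedges (rep K))"
    using X.iso_classes_cls[OF K X.rep_in[OF K]] by auto
  define l V S where "l = X.lab" and "V = sverts (rep K)" and "S = X.sedges (rep K)"
  have m: "matched L R l V S" unfolding l_def V_def S_def by (rule X.matched_sobj[OF A])
  have KS: "K = X.cls l V S" unfolding l_def V_def S_def by (rule KA)
  let ?P = "added L R F l V"
  have finV: "finite V" using matchedD(1)[OF m] .
  have finP: "finite (?P T)" for T using finite_added[OF finV] .
  have inN: "Y.cls l V T \<in> N" if T: "T \<in> ?P S" for T
  proof -
    have "card {T' \<in> ?P S. Y.cls l V T' = Y.cls l V T} \<noteq> 0" using T finP by auto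
    then have "transition K (Y.cls l V T) \<noteq> (0 :: 'k)"
      unfolding KS transition_cls[OF m] by (simp add: edge_sign_def)
    then show ?thesis using N by blast
  qed
  have "(\<Sum>K'\<in>N. transition K K' * inverse.transition K' K'' :: 'k)
      = edge_sign F l S * (\<Sum>T\<in>?P S. inverse.transition (Y.cls l V T) K'')"
    unfolding KS by (rule sum_transition[OF m N(1)]) (use inN in auto)
  also have "(\<Sum>T\<in>?P S. inverse.transition (Y.cls l V T) K'' :: 'k)
      = (\<Sum>T\<in>?P S. \<Sum>U\<in>?P T. edge_sign F l T * of_bool (X.cls l V U = K''))"
  proof (rule sum.cong[OF refl])
    fix T assume "T \<in> ?P S"
    then have mT: "matched L R l V T" by (simp add: added_def)
    show "inverse.transition (Y.cls l V T) K'' = (\<Sum>U\<in>?P T. edge_sign F l T * of_bool (X.cls l V U = K'') :: 'k)"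
      unfolding inverse.transition_cls[OF mT] using finP[of T]
      by (simp add: sum_distrib_left[symmetric] of_bool_def sum.If_cases Int_def)
  qed
  also have "\<dots> = (\<Sum>U\<in>?P S. \<Sum>T\<in>{T. T \<in> ?P S \<and> U \<in> ?P T}. edge_sign F l T * of_bool (X.cls l V U = K''))"
  proof -
    have "(\<Sum>U\<in>?P T. edge_sign F l T * of_bool (X.cls l V U = K'') :: 'k)
        = (\<Sum>U\<in>{U \<in> ?P S. U \<in> ?P T}. edge_sign F l T * of_bool (X.cls l V U = K''))" if "T \<in> ?P S" for T
    proof -
      have "{U \<in> ?P S. U \<in> ?P T} = ?P T" using added_trans[OF that] by blast
      then show ?thesis by simp
    qed
    then have "(\<Sum>T\<in>?P S. \<Sum>U\<in>?P T. edge_sign F l T * of_bool (X.cls l V U = K'') :: 'k)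
        = (\<Sum>T\<in>?P S. \<Sum>U\<in>{U \<in> ?P S. U \<in> ?P T}. edge_sign F l T * of_bool (X.cls l V U = K''))"
      by (rule sum.cong[OF refl])
    also have "\<dots> = (\<Sum>U\<in>?P S. \<Sum>T\<in>{T \<in> ?P S. U \<in> ?P T}. edge_sign F l T * of_bool (X.cls l V U = K''))"
      by (rule sum.swap_restrict[OF finP finP])
    finally show ?thesis by simp
  qed
  also have "\<dots> = (\<Sum>U\<in>?P S. (if U = S then edge_sign F l S * of_bool (X.cls l V U = K'') else 0))"
    by (intro sum.cong refl)
      (simp add: sum_distrib_right[symmetric] signed_added_sum[OF _ m])
  also have "\<dots> = edge_sign F l S * of_bool (K = K'')"
    using finP[of S] added_refl[OF m] by (simp add: KS)
  finally show ?thesis by (simp add: mult.assoc[symmetric] edge_sign_square)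
qed

end

section \<open>Compatibility with products\<close>

lemma card_fibre_nonzero: "finite E \<Longrightarrow> T \<in> E \<Longrightarrow> card {T' \<in> E. f T' = f T} \<noteq> 0"
proof -
  assume "finite E" "T \<in> E"
  then have "finite {T' \<in> E. f T' = f T}" and "T \<in> {T' \<in> E. f T' = f T}" by simp_all
  then show ?thesis unfolding card_eq_0_iff by blast
qed

context oriented_forest
begin

definition ext_count :: "sobj set \<Rightarrow> sobj set \<Rightarrow> sobj set \<Rightarrow> nat" where
  "ext_count K1 K2 K = (if K \<in> iso_classes \<Gamma> then card (Ext \<Gamma> (rep K2) (rep K1) (rep K)) else 0)"

lemma ext_count_cls:
  assumes A: "matched L R l VA SA" and C: "matched L R l VC SC" and disj: "VA \<inter> VC = {}"
  shows "ext_count (cls l VA SA) (cls l VC SC) K = card {T \<in> glue l VA SA VC SC. cls l (VA \<union> VC) T = K}"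
proof (cases "K \<in> iso_classes \<Gamma>")
  case True
  have K: "rep K \<in> sobjs \<Gamma>" using iso_classes_cls(1)[OF True rep_in[OF True]] .
  have "K = iso_class \<Gamma> (rep K)"
    using iso_classes_cls(2)[OF True rep_in[OF True]] iso_class_cls[OF K] by (rule trans[OF _ sym])
  then have "rep K \<in> cls l (VA \<union> VC) T \<longleftrightarrow> cls l (VA \<union> VC) T = K" for T
    using mem_cls_iff[OF K, of l "VA \<union> VC" T] by metis
  then show ?thesis
    using card_Ext[OF rep_in[OF cls_in_iso_classes[OF A]] rep_in[OF cls_in_iso_classes[OF C]] K
        matchedD(3)[OF A] matchedD(3)[OF C] disj] True by (simp add: ext_count_def)
next
  case False
  then have e: "{T \<in> glue l VA SA VC SC. cls l (VA \<union> VC) T = K} = {}"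
    using cls_in_iso_classes by (auto simp: glue_def)
  show ?thesis unfolding e using False by (simp add: ext_count_def)
qed

lemma finite_glue:
  assumes "finite VA" "finite VC" shows "finite (glue l VA SA VC SC)"
  by (rule finite_subset[OF _ finite_matched_sets[of "VA \<union> VC" L R l]]) (use assms in \<open>auto simp: glue_def\<close>)

text \<open>Gluing needs graphs with disjoint vertex sets; the sum type provides them.\<close>

lemma disjoint_representatives:
  assumes K1: "K1 \<in> iso_classes \<Gamma>" and K2: "K2 \<in> iso_classes \<Gamma>"
  obtains l :: "(nat \<times> nat) + (nat \<times> nat) \<Rightarrow> nat" and VA SA VC SC
  where "matched L R l VA SA" "matched L R l VC SC" "VA \<inter> VC = {}" "K1 = cls l VA SA" "K2 = cls l VC SC"
proof -
  let ?A = "rep K1" and ?C = "rep K2" and ?l = "case_sum lab lab"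
  have A: "?A \<in> sobjs \<Gamma>" "K1 = cls lab (sverts ?A) (sedges ?A)"
    using iso_classes_cls[OF K1 rep_in[OF K1]] by auto
  have C: "?C \<in> sobjs \<Gamma>" "K2 = cls lab (sverts ?C) (sedges ?C)"
    using iso_classes_cls[OF K2 rep_in[OF K2]] by auto
  have isoA: "graph_iso Inl lab (sverts ?A) (sedges ?A) ?l (Inl ` sverts ?A) (map_prod Inl Inl ` sedges ?A)"
    by (auto simp: graph_iso_def bij_betw_def inj_on_def)
  have isoC: "graph_iso Inr lab (sverts ?C) (sedges ?C) ?l (Inr ` sverts ?C) (map_prod Inr Inr ` sedges ?C)"
    by (auto simp: graph_iso_def bij_betw_def inj_on_def)
  have mA: "matched L R ?l (Inl ` sverts ?A) (map_prod Inl Inl ` sedges ?A)"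
    by (rule matched_iso[OF isoA _ matched_sobj[OF A(1)]]) (auto simp: sedges_def)
  have mC: "matched L R ?l (Inr ` sverts ?C) (map_prod Inr Inr ` sedges ?C)"
    by (rule matched_iso[OF isoC _ matched_sobj[OF C(1)]]) (auto simp: sedges_def)
  show ?thesis
    by (rule that[OF mA mC]) (use A(2) C(2) cls_eqI[OF isoA] cls_eqI[OF isoC] in auto)
qed

lemma ext_count_support:
  assumes K: "K1 \<in> iso_classes \<Gamma>" "K2 \<in> iso_classes \<Gamma>"
  shows "finite {K. ext_count K1 K2 K \<noteq> 0}"
proof -
  obtain l :: "(nat \<times> nat) + (nat \<times> nat) \<Rightarrow> nat" and VA SA VC SC where
    A: "matched L R l VA SA" and C: "matched L R l VC SC" and d: "VA \<inter> VC = {}"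
    and e: "K1 = cls l VA SA" "K2 = cls l VC SC" using disjoint_representatives[OF K] .
  have "{K. ext_count K1 K2 K \<noteq> 0} \<subseteq> cls l (VA \<union> VC) ` glue l VA SA VC SC"
  proof
    fix K assume "K \<in> {K. ext_count K1 K2 K \<noteq> 0}"
    then have "card {T \<in> glue l VA SA VC SC. cls l (VA \<union> VC) T = K} \<noteq> 0"
      unfolding e ext_count_cls[OF A C d] by (rule CollectD)
    then have "{T \<in> glue l VA SA VC SC. cls l (VA \<union> VC) T = K} \<noteq> {}"
      by (rule contrapos_nn) (simp only: card.empty)
    then show "K \<in> cls l (VA \<union> VC) ` glue l VA SA VC SC" by blast
  qed
  then show ?thesis
    using finite_glue matchedD(1)[OF A] matchedD(1)[OF C] by (meson finite_imageI finite_subset)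
qed

lemma sum_ext_count:
  fixes \<Phi> :: "sobj set \<Rightarrow> 'k::field_char_0"
  assumes A: "matched L R l VA SA" and C: "matched L R l VC SC" and disj: "VA \<inter> VC = {}"
    and N: "finite N" "{K. ext_count (cls l VA SA) (cls l VC SC) K \<noteq> 0} \<subseteq> N"
  shows "(\<Sum>K\<in>N. of_nat (ext_count (cls l VA SA) (cls l VC SC) K) * \<Phi> K)
    = (\<Sum>T\<in>glue l VA SA VC SC. \<Phi> (cls l (VA \<union> VC) T))"
proof -
  have fin: "finite (glue l VA SA VC SC)" using finite_glue matchedD(1)[OF A] matchedD(1)[OF C] .
  have "cls l (VA \<union> VC) T \<in> N" if "T \<in> glue l VA SA VC SC" for T
  proof -
    have "{T' \<in> glue l VA SA VC SC. cls l (VA \<union> VC) T' = cls l (VA \<union> VC) T} \<noteq> {}" using that by blast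
    then have "ext_count (cls l VA SA) (cls l VC SC) (cls l (VA \<union> VC) T) \<noteq> 0"
      unfolding ext_count_cls[OF A C disj] using fin by (simp add: card_eq_0_iff)
    then show ?thesis using N by blast
  qed
  then show ?thesis unfolding ext_count_cls[OF A C disj] by (intro sum_fibres_support[OF fin N(1)]) auto
qed

end

context arrow_reversal
begin

text \<open>For a fixed final graph \<open>T\<close>, the glued graphs from which \<open>T\<close> arises differ by arbitrary subsets
  of those cross edges of \<open>T\<close> over \<open>F\<close> whose arrows in \<open>\<Gamma>\<close> point from \<open>VC\<close> to \<open>VA\<close>. The signs cancel unless
  there are none of them, and then all cross edges over \<open>F\<close> are directed as needed in \<open>\<Gamma>'\<close>.\<close>

lemma signed_glue_sum:
  assumes A: "matched L R l VA SA" and C: "matched L R l VC SC" and disj: "VA \<inter> VC = {}"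
    and m: "matched L R l (VA \<union> VC) T"
  shows "(\<Sum>T1\<in>{T1 \<in> X.glue l VA SA VC SC. T \<in> added L R F l (VA \<union> VC) T1}. edge_sign F l T1) =
    (if T \<inter> VA \<times> VA \<in> added L R F l VA SA \<and> T \<inter> VC \<times> VC \<in> added L R F l VC SC
        \<and> T \<in> Y.glue l VA (T \<inter> VA \<times> VA) VC (T \<inter> VC \<times> VC)
     then edge_sign F l SA * edge_sign F l SC else 0 :: 'k::field_char_0)"
proof -
  let ?V = "VA \<union> VC"
  let ?E = "{T1 \<in> X.glue l VA SA VC SC. T \<in> added L R F l ?V T1}"
  let ?cross = "VA \<times> VC \<union> VC \<times> VA"
  \<comment> \<open>\<open>N\<close>: cross edges whose arrows agree in both quivers. \<open>M\<close>: cross edges that may either be glued in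
    \<open>\<Gamma>\<close> or be added afterwards.\<close>
  define good where "good u v \<longleftrightarrow> (u \<in> VC \<and> v \<in> VA \<longrightarrow> (l u, l v) \<in> D) \<and> (u \<in> VA \<and> v \<in> VC \<longrightarrow> (l u, l v) \<notin> D)" for u v
  define N where "N = {(u, v) \<in> T \<inter> ?cross. (l u, l v) \<notin> F}"
  define M where "M = {(u, v) \<in> T \<inter> ?cross. (l u, l v) \<in> F \<and> good u v}"
  define P where "P \<longleftrightarrow> T \<inter> VA \<times> VA \<in> added L R F l VA SA \<and> T \<inter> VC \<times> VC \<in> added L R F l VC SC
    \<and> (\<forall>u v. (u, v) \<in> N \<longrightarrow> good u v)"
  have SA: "SA \<subseteq> VA \<times> VA" and SC: "SC \<subseteq> VC \<times> VC" using matchedD(3)[OF A] matchedD(3)[OF C] .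
  have TV: "T \<subseteq> ?V \<times> ?V" using matchedD(3)[OF m] .
  have finT: "finite T" using finite_edges[OF m] .
  have mA: "matched L R l VA (T \<inter> VA \<times> VA)" and mC: "matched L R l VC (T \<inter> VC \<times> VC)"
    by (rule matched_restrict[OF m]; blast)+
  have glueX: "T1 \<in> X.glue l VA SA VC SC \<longleftrightarrow> matched L R l ?V T1 \<and> T1 \<inter> VA \<times> VA = SA \<and> T1 \<inter> VC \<times> VC = SC
      \<and> (\<forall>u v. (u, v) \<in> T1 \<longrightarrow> good u v)" for T1
    by (simp add: X.glue_def good_def)
  have not_cross: "good u v" if "(u, v) \<in> VA \<times> VA \<union> VC \<times> VC" for u v
    using that disj by (auto simp: good_def)
  have target: "T \<in> Y.glue l VA (T \<inter> VA \<times> VA) VC (T \<inter> VC \<times> VC) \<longleftrightarrow> (\<forall>u v. (u, v) \<in> N \<longrightarrow> good u v) \<and> M = {}"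
  proof -
    define good' where "good' u v \<longleftrightarrow> (u \<in> VC \<and> v \<in> VA \<longrightarrow> (l u, l v) \<in> D') \<and> (u \<in> VA \<and> v \<in> VC \<longrightarrow> (l u, l v) \<notin> D')" for u v
    have g: "T \<in> Y.glue l VA (T \<inter> VA \<times> VA) VC (T \<inter> VC \<times> VC) \<longleftrightarrow> (\<forall>u v. (u, v) \<in> T \<longrightarrow> good' u v)"
      using m by (simp add: Y.glue_def good'_def)
    have c: "good' u v \<longleftrightarrow> (if (l u, l v) \<in> F then \<not> good u v else good u v)" if "(u, v) \<in> T \<inter> ?cross" for u v
    proof -
      have "(l u, l v) \<in> D' \<longleftrightarrow> ((l u, l v) \<in> D \<longleftrightarrow> (l u, l v) \<notin> F)"
        using D'[of "(l u, l v)"] matchedD(4)[OF m] that by blast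
      then show ?thesis using that disj by (auto simp: good'_def good_def)
    qed
    have n: "good' u v" if "(u, v) \<in> T" "(u, v) \<notin> ?cross" for u v using that by (auto simp: good'_def)
    show ?thesis unfolding g
    proof
      assume *: "\<forall>u v. (u, v) \<in> T \<longrightarrow> good' u v"
      show "(\<forall>u v. (u, v) \<in> N \<longrightarrow> good u v) \<and> M = {}"
      proof (intro conjI allI impI equals0I)
        show "good u v" if "(u, v) \<in> N" for u v using that * c[of u v] by (auto simp: N_def)
        show False if "e \<in> M" for e using that * c by (cases e) (auto simp: M_def)
      qed
    next
      assume *: "(\<forall>u v. (u, v) \<in> N \<longrightarrow> good u v) \<and> M = {}"
      show "\<forall>u v. (u, v) \<in> T \<longrightarrow> good' u v"
      proof (intro allI impI)
        fix u v assume uv: "(u, v) \<in> T"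
        show "good' u v"
        proof (cases "(u, v) \<in> ?cross")
          case True
          have "(u, v) \<notin> M" using * by simp
          then show ?thesis using * c[of u v] uv True by (auto simp: N_def M_def)
        qed (use n uv in blast)
      qed
    qed
  qed
  show ?thesis
  proof (cases P)
    case False
    have e: "?E = {}"
    proof (rule ccontr)
      assume "?E \<noteq> {}"
      then obtain T1 where T1: "T1 \<in> X.glue l VA SA VC SC" "T \<in> added L R F l ?V T1" by blast
      have sub: "T1 \<subseteq> T" and dF: "\<And>u v. (u, v) \<in> T \<Longrightarrow> (u, v) \<notin> T1 \<Longrightarrow> (l u, l v) \<in> F"
        using T1(2) by (auto simp: added_def)
      have r: "T1 \<inter> VA \<times> VA = SA" "T1 \<inter> VC \<times> VC = SC" "\<And>u v. (u, v) \<in> T1 \<Longrightarrow> good u v"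
        using T1(1) by (auto simp: glueX)
      have "T \<inter> VA \<times> VA \<in> added L R F l VA SA" "T \<inter> VC \<times> VC \<in> added L R F l VC SC"
        unfolding added_def using mA mC sub dF r(1,2) by blast+
      moreover have "good u v" if "(u, v) \<in> N" for u v
        using that dF[of u v] r(3) by (auto simp: N_def)
      ultimately show False using False by (simp add: P_def)
    qed
    show ?thesis unfolding e using False target by (auto simp: P_def)
  next
    case True
    let ?B = "SA \<union> SC \<union> N"
    have SAT: "SA \<subseteq> T" and SCT: "SC \<subseteq> T" using True by (auto simp: P_def added_def)
    have BM: "?B \<inter> M = {}" using SA SC disj by (auto simp: N_def M_def)
    have dec: "T1 \<inter> VA \<times> VA \<union> T1 \<inter> VC \<times> VC \<union> T1 \<inter> ?cross = T1" if "T1 \<subseteq> T" for T1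
      using that TV by blast
    have E: "?E = (\<lambda>Y. ?B \<union> Y) ` Pow M"
    proof (intro equalityI subsetI)
      fix T1 assume "T1 \<in> ?E"
      then have T1: "T1 \<in> X.glue l VA SA VC SC" "T \<in> added L R F l ?V T1" by auto
      have sub: "T1 \<subseteq> T" and dF: "\<And>u v. (u, v) \<in> T \<Longrightarrow> (u, v) \<notin> T1 \<Longrightarrow> (l u, l v) \<in> F"
        using T1(2) by (auto simp: added_def)
      have r: "T1 \<inter> VA \<times> VA = SA" "T1 \<inter> VC \<times> VC = SC" "\<And>u v. (u, v) \<in> T1 \<Longrightarrow> good u v"
        using T1(1) by (auto simp: glueX)
      have "N \<subseteq> T1" using dF by (auto simp: N_def)
      moreover have "T1 \<inter> ?cross \<subseteq> N \<union> M" using sub r(3) by (auto simp: N_def M_def)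
      moreover have "N \<subseteq> ?cross" "M \<subseteq> ?cross" by (auto simp: N_def M_def)
      ultimately have cr: "T1 \<inter> ?cross = N \<union> (T1 \<inter> M)" by blast
      have "T1 = SA \<union> SC \<union> (N \<union> (T1 \<inter> M))"
        using dec[OF sub] unfolding r(1,2) cr by (rule sym)
      then have "T1 = ?B \<union> (T1 \<inter> M)" by (simp only: Un_assoc)
      then show "T1 \<in> (\<lambda>Y. ?B \<union> Y) ` Pow M" by blast
    next
      fix T1 assume "T1 \<in> (\<lambda>Y. ?B \<union> Y) ` Pow M"
      then obtain Y where Y: "Y \<subseteq> M" "T1 = ?B \<union> Y" by blast
      have NY: "N \<union> Y \<subseteq> T \<inter> ?cross" using Y(1) by (auto simp: N_def M_def)
      have sub: "T1 \<subseteq> T" using SAT SCT NY Y(2) by blast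
      have cr: "(VA \<times> VA) \<inter> ?cross = {}" "(VC \<times> VC) \<inter> ?cross = {}" "(VA \<times> VA) \<inter> (VC \<times> VC) = {}" using disj by auto
      have T1: "T1 = SA \<union> SC \<union> (N \<union> Y)" using Y(2) by blast
      have "T1 \<inter> VA \<times> VA = SA" "T1 \<inter> VC \<times> VC = SC"
        using SA SC NY cr unfolding T1 by blast+
      moreover have "good u v" if uvT: "(u, v) \<in> T1" for u v
      proof -
        consider "(u, v) \<in> VA \<times> VA \<union> VC \<times> VC" | "(u, v) \<in> N" | "(u, v) \<in> M"
          using uvT Y SA SC by blast
        then show ?thesis using not_cross True by cases (auto simp: P_def M_def)
      qed
      moreover have "matched L R l ?V T1" by (rule matched_subset[OF m sub])
      ultimately have "T1 \<in> X.glue l VA SA VC SC" by (simp add: glueX)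
      moreover have "(l u, l v) \<in> F" if uv: "(u, v) \<in> T - T1" for u v
      proof -
        consider "(u, v) \<in> T \<inter> VA \<times> VA - SA" | "(u, v) \<in> T \<inter> VC \<times> VC - SC" | "(u, v) \<in> T \<inter> ?cross" "(u, v) \<notin> N"
          using uv TV Y(2) by blast
        then show ?thesis using True by cases (auto simp: P_def added_def N_def)
      qed
      ultimately show "T1 \<in> ?E" using m sub by (auto simp: added_def)
    qed
    have inj: "inj_on (\<lambda>Y. ?B \<union> Y) (Pow M)" using BM by (intro inj_onI) blast
    have fin: "finite SA" "finite SC" "finite N" "finite M"
      using finite_edges[OF A] finite_edges[OF C] finT by (auto simp: N_def M_def intro: finite_subset)
    have sgn: "edge_sign F l (?B \<union> Y) = (edge_sign F l SA * edge_sign F l SC * (- 1) ^ card Y :: 'k)"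
      if Y: "Y \<in> Pow M" for Y
    proof -
      have finY: "finite Y" using Y fin finite_subset by blast
      have "edge_sign F l (?B \<union> Y) = (edge_sign F l ?B * edge_sign F l Y :: 'k)"
        by (rule edge_sign_Un) (use fin finY Y BM in blast)+
      also have "edge_sign F l ?B = (edge_sign F l (SA \<union> SC) * edge_sign F l N :: 'k)"
        by (rule edge_sign_Un) (use fin SA SC disj in \<open>auto simp: N_def\<close>)
      also have "edge_sign F l (SA \<union> SC) = (edge_sign F l SA * edge_sign F l SC :: 'k)"
        by (rule edge_sign_Un) (use fin SA SC disj in auto)
      also have "edge_sign F l N = (1 :: 'k)" by (rule edge_sign_none) (auto simp: N_def)
      also have "edge_sign F l Y = ((- 1) ^ card Y :: 'k)"
        by (rule edge_sign_all) (use Y in \<open>auto simp: M_def\<close>)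
      finally show ?thesis by simp
    qed
    have "(\<Sum>T1\<in>?E. edge_sign F l T1) = (\<Sum>Y\<in>Pow M. edge_sign F l SA * edge_sign F l SC * (- 1) ^ card Y :: 'k)"
      unfolding E sum.reindex[OF inj] o_def by (rule sum.cong[OF refl]) (rule sgn)
    also have "\<dots> = edge_sign F l SA * edge_sign F l SC * (if M = {} then 1 else 0)"
      using alternating_sum_Pow[OF fin(4), where 'k = 'k] by (simp add: sum_distrib_left[symmetric])
    finally show ?thesis using True target by (auto simp: P_def)
  qed
qed

text \<open>Both sides are sums over the final graph \<open>T\<close>. On the right, \<open>T\<close> determines \<open>TA\<close> and \<open>TC\<close> as its
  restrictions; on the left, the coefficient of \<open>T\<close> has just been computed.\<close>

lemma sum_over_glued_added:
  fixes \<psi> :: "'v rel \<Rightarrow> 'k::field_char_0"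
  assumes A: "matched L R l VA SA" and C: "matched L R l VC SC" and disj: "VA \<inter> VC = {}"
  defines "V \<equiv> VA \<union> VC"
  shows "(\<Sum>T1\<in>X.glue l VA SA VC SC. edge_sign F l T1 * (\<Sum>T\<in>added L R F l V T1. \<psi> T)) =
    edge_sign F l SA * edge_sign F l SC * (\<Sum>TA\<in>added L R F l VA SA. \<Sum>TC\<in>added L R F l VC SC.
      \<Sum>T\<in>Y.glue l VA TA VC TC. \<psi> T)"
proof -
  let ?M = "{T. matched L R l V T}"
  let ?GX = "X.glue l VA SA VC SC" and ?PA = "added L R F l VA SA" and ?PC = "added L R F l VC SC"
  have fV: "finite VA" "finite VC" "finite V" using matchedD(1)[OF A] matchedD(1)[OF C] by (auto simp: V_def)
  have fM: "finite ?M" using finite_matched_sets[OF fV(3)] .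
  have fG: "finite ?GX" using X.finite_glue[OF fV(1,2)] .
  have fP: "finite ?PA" "finite ?PC" using finite_added fV by blast+
  define Z where "Z T \<longleftrightarrow> T \<inter> VA \<times> VA \<in> ?PA \<and> T \<inter> VC \<times> VC \<in> ?PC \<and> T \<in> Y.glue l VA (T \<inter> VA \<times> VA) VC (T \<inter> VC \<times> VC)" for T
  have addM: "added L R F l V T1 = {T \<in> ?M. T \<in> added L R F l V T1}" for T1 by (auto simp: added_def)
  have "(\<Sum>T1\<in>?GX. edge_sign F l T1 * (\<Sum>T\<in>added L R F l V T1. \<psi> T))
      = (\<Sum>T1\<in>?GX. \<Sum>T\<in>{T \<in> ?M. T \<in> added L R F l V T1}. edge_sign F l T1 * \<psi> T)"
    using addM by (simp add: sum_distrib_left)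
  also have "\<dots> = (\<Sum>T\<in>?M. \<Sum>T1\<in>{T1 \<in> ?GX. T \<in> added L R F l V T1}. edge_sign F l T1 * \<psi> T)"
    by (rule sum.swap_restrict[OF fG fM])
  also have "\<dots> = (\<Sum>T\<in>?M. (if Z T then edge_sign F l SA * edge_sign F l SC else 0) * \<psi> T)"
  proof (rule sum.cong[OF refl])
    fix T assume "T \<in> ?M"
    then have m: "matched L R l (VA \<union> VC) T" by (simp add: V_def)
    show "(\<Sum>T1\<in>{T1 \<in> ?GX. T \<in> added L R F l V T1}. edge_sign F l T1 * \<psi> T)
        = (if Z T then edge_sign F l SA * edge_sign F l SC else 0) * \<psi> T"
      unfolding sum_distrib_right[symmetric] Z_def V_def signed_glue_sum[OF A C disj m] ..
  qed
  also have "\<dots> = edge_sign F l SA * edge_sign F l SC * (\<Sum>T\<in>{T \<in> ?M. Z T}. \<psi> T)"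
  proof -
    have "(\<Sum>T\<in>{T \<in> ?M. Z T}. \<psi> T) = (\<Sum>T\<in>?M. if Z T then \<psi> T else 0)"
      using fM by (rule sum.inter_filter)
    then show ?thesis by (simp add: sum_distrib_left) (rule sum.cong, auto)
  qed
  also have "(\<Sum>T\<in>{T \<in> ?M. Z T}. \<psi> T) = (\<Sum>q\<in>(SIGMA p:?PA \<times> ?PC. Y.glue l VA (fst p) VC (snd p)). \<psi> (snd q))"
  proof (rule sum.reindex_bij_witness[of _ snd "\<lambda>T. ((T \<inter> VA \<times> VA, T \<inter> VC \<times> VC), T)"])
    fix T assume "T \<in> {T \<in> ?M. Z T}"
    then show "((T \<inter> VA \<times> VA, T \<inter> VC \<times> VC), T) \<in> (SIGMA p:?PA \<times> ?PC. Y.glue l VA (fst p) VC (snd p))"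
      by (simp add: Z_def)
  next
    fix q assume q: "q \<in> (SIGMA p:?PA \<times> ?PC. Y.glue l VA (fst p) VC (snd p))"
    obtain TA TC T where qq: "q = ((TA, TC), T)" by (metis prod.exhaust)
    have *: "TA \<in> ?PA" "TC \<in> ?PC" "T \<in> Y.glue l VA TA VC TC" using q by (simp_all add: qq)
    then have **: "T \<inter> VA \<times> VA = TA" "T \<inter> VC \<times> VC = TC" "matched L R l V T" by (auto simp: Y.glue_def V_def)
    show "snd q \<in> {T \<in> ?M. Z T}" using * ** by (simp add: qq Z_def)
    show "((snd q \<inter> VA \<times> VA, snd q \<inter> VC \<times> VC), snd q) = q" using ** by (simp add: qq)
  qed auto
  also have "\<dots> = (\<Sum>p\<in>?PA \<times> ?PC. \<Sum>T\<in>Y.glue l VA (fst p) VC (snd p). \<psi> T)"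
    by (subst sum.Sigma) (use fP Y.finite_glue[OF fV(1,2)] in \<open>auto simp: case_prod_unfold\<close>)
  also have "\<dots> = (\<Sum>TA\<in>?PA. \<Sum>TC\<in>?PC. \<Sum>T\<in>Y.glue l VA TA VC TC. \<psi> T)"
    unfolding sum.cartesian_product by (rule sum.cong) auto
  finally show ?thesis .
qed

lemma transition_mult:
  assumes K: "K1 \<in> iso_classes \<Gamma>" "K2 \<in> iso_classes \<Gamma>"
    and N: "finite N" "{K. X.ext_count K1 K2 K \<noteq> 0} \<subseteq> N"
    and N1: "finite N1" "{K'. transition K1 K' \<noteq> (0 :: 'k)} \<subseteq> N1"
    and N2: "finite N2" "{K'. transition K2 K' \<noteq> (0 :: 'k)} \<subseteq> N2"
  shows "(\<Sum>K\<in>N. of_nat (X.ext_count K1 K2 K) * transition K K') =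
    (\<Sum>K1'\<in>N1. \<Sum>K2'\<in>N2. transition K1 K1' * transition K2 K2' * of_nat (Y.ext_count K1' K2' K') :: 'k::field_char_0)"
proof -
  obtain l :: "(nat \<times> nat) + (nat \<times> nat) \<Rightarrow> nat" and VA SA VC SC where
    A: "matched L R l VA SA" and C: "matched L R l VC SC" and d: "VA \<inter> VC = {}"
    and e: "K1 = X.cls l VA SA" "K2 = X.cls l VC SC" using X.disjoint_representatives[OF K] .
  let ?V = "VA \<union> VC" and ?\<psi> = "\<lambda>T. of_bool (Y.cls l (VA \<union> VC) T = K') :: 'k"
  have fV: "finite VA" "finite VC" "finite ?V" using matchedD(1)[OF A] matchedD(1)[OF C] by auto
  have inN: "Y.cls l V T \<in> N0" if m: "matched L R l V S" and N0: "{K'. transition (X.cls l V S) K' \<noteq> (0 :: 'k)} \<subseteq> N0"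
    and T: "T \<in> added L R F l V S" for V S T N0
  proof -
    have "card {T' \<in> added L R F l V S. Y.cls l V T' = Y.cls l V T} \<noteq> 0"
      by (rule card_fibre_nonzero[OF finite_added[OF matchedD(1)[OF m]] T])
    then have "transition (X.cls l V S) (Y.cls l V T) \<noteq> (0 :: 'k)"
      unfolding transition_cls[OF m] by (simp add: edge_sign_def)
    then show ?thesis using N0 by blast
  qed
  have "(\<Sum>K\<in>N. of_nat (X.ext_count K1 K2 K) * transition K K')
      = (\<Sum>T1\<in>X.glue l VA SA VC SC. transition (X.cls l ?V T1) K' :: 'k)"
    unfolding e by (rule X.sum_ext_count[OF A C d N(1) N(2)[unfolded e]])
  also have "\<dots> = (\<Sum>T1\<in>X.glue l VA SA VC SC. edge_sign F l T1 * (\<Sum>T\<in>added L R F l ?V T1. ?\<psi> T))"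
  proof (rule sum.cong[OF refl])
    fix T1 assume "T1 \<in> X.glue l VA SA VC SC"
    then have m: "matched L R l ?V T1" by (simp add: X.glue_def)
    show "transition (X.cls l ?V T1) K' = edge_sign F l T1 * (\<Sum>T\<in>added L R F l ?V T1. ?\<psi> T)"
      unfolding transition_cls[OF m] using finite_added[OF fV(3), of L R F l T1]
      by (simp add: of_bool_def sum.If_cases Int_def)
  qed
  also have "\<dots> = edge_sign F l SA * edge_sign F l SC * (\<Sum>TA\<in>added L R F l VA SA. \<Sum>TC\<in>added L R F l VC SC.
      \<Sum>T\<in>Y.glue l VA TA VC TC. ?\<psi> T)"
    by (rule sum_over_glued_added[OF A C d])
  also have "(\<Sum>TA\<in>added L R F l VA SA. \<Sum>TC\<in>added L R F l VC SC. \<Sum>T\<in>Y.glue l VA TA VC TC. ?\<psi> T)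
      = (\<Sum>TA\<in>added L R F l VA SA. \<Sum>TC\<in>added L R F l VC SC. of_nat (Y.ext_count (Y.cls l VA TA) (Y.cls l VC TC) K'))"
  proof (intro sum.cong refl)
    fix TA TC assume "TA \<in> added L R F l VA SA" "TC \<in> added L R F l VC SC"
    then have m: "matched L R l VA TA" "matched L R l VC TC" by (auto simp: added_def)
    show "(\<Sum>T\<in>Y.glue l VA TA VC TC. ?\<psi> T) = of_nat (Y.ext_count (Y.cls l VA TA) (Y.cls l VC TC) K')"
      unfolding Y.ext_count_cls[OF m d] using Y.finite_glue[OF fV(1,2), of l TA TC]
      by (simp add: of_bool_def sum.If_cases Int_def)
  qed
  also have "edge_sign F l SA * edge_sign F l SC * \<dots> = edge_sign F l SA * (\<Sum>TA\<in>added L R F l VA SA.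
      \<Sum>K2'\<in>N2. transition K2 K2' * of_nat (Y.ext_count (Y.cls l VA TA) K2' K'))"
  proof -
    have "(\<Sum>K2'\<in>N2. transition K2 K2' * of_nat (Y.ext_count (Y.cls l VA TA) K2' K') :: 'k) = edge_sign F l SC *
       (\<Sum>TC\<in>added L R F l VC SC. of_nat (Y.ext_count (Y.cls l VA TA) (Y.cls l VC TC) K'))" for TA
      unfolding e by (rule sum_transition[OF C N2(1)]) (use inN[OF C N2(2)[unfolded e]] in blast)
    then show ?thesis by (simp add: sum_distrib_left mult.assoc)
  qed
  also have "\<dots> = (\<Sum>K1'\<in>N1. transition K1 K1' * (\<Sum>K2'\<in>N2. transition K2 K2' * of_nat (Y.ext_count K1' K2' K')))"
    unfolding e(1) by (rule sum_transition[OF A N1(1), symmetric]) (use inN[OF A N1(2)[unfolded e]] in blast)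
  finally show ?thesis by (simp add: sum_distrib_left mult.assoc)
qed

end

section \<open>The isomorphism of Hall algebras\<close>

context arrow_reversal
begin

definition reversal :: "(sobj set \<Rightarrow> 'k::field_char_0) \<Rightarrow> sobj set \<Rightarrow> 'k" where
  "reversal x K' = (\<Sum>K | x K \<noteq> 0. x K * transition K K')"

lemma reversal_superset:
  assumes "finite M" "{K. x K \<noteq> 0} \<subseteq> M"
  shows "reversal x K' = (\<Sum>K\<in>M. x K * transition K K')"
  unfolding reversal_def by (rule sum.mono_neutral_left) (use assms in auto)

text \<open>A finite set of classes that contains the support of the image of \<open>x\<close> and of every basis element
  involved in \<open>x\<close>.\<close>

definition targets :: "(sobj set \<Rightarrow> 'k::field_char_0) \<Rightarrow> sobj set set" where
  "targets x = (\<Union>K\<in>{K. x K \<noteq> 0}. {K'. transition K K' \<noteq> (0 :: 'k)})"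

lemma targets:
  assumes "finite {K. x K \<noteq> (0 :: 'k::field_char_0)}" "{K. x K \<noteq> 0} \<subseteq> iso_classes \<Gamma>"
  shows "finite (targets x)" and "targets x \<subseteq> iso_classes \<Gamma>'"
    and "{K'. reversal x K' \<noteq> 0} \<subseteq> targets x"
    and "x K \<noteq> 0 \<Longrightarrow> {K'. transition K K' \<noteq> (0 :: 'k)} \<subseteq> targets x"
proof -
  show "finite (targets x)"
    unfolding targets_def using assms transition_support(1)[where 'k = 'k] by (intro finite_UN_I) auto
  show "targets x \<subseteq> iso_classes \<Gamma>'"
    unfolding targets_def using assms(2) transition_support(2)[where 'k = 'k] by blast
  show "{K'. transition K K' \<noteq> (0 :: 'k)} \<subseteq> targets x" if "x K \<noteq> 0" using that by (auto simp: targets_def)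
  show "{K'. reversal x K' \<noteq> 0} \<subseteq> targets x"
  proof (rule subsetI, rule ccontr)
    fix K' assume "K' \<in> {K'. reversal x K' \<noteq> 0}" and n: "K' \<notin> targets x"
    moreover have "reversal x K' = 0"
      unfolding reversal_def by (rule sum.neutral) (use n in \<open>auto simp: targets_def\<close>)
    ultimately show False by simp
  qed
qed

lemma hall_carrier: "x \<in> carrier (hall_algebra G) \<longleftrightarrow> finite {K. x K \<noteq> 0} \<and> {K. x K \<noteq> 0} \<subseteq> iso_classes G"
  by (simp add: hall_algebra_def)

lemma reversal_closed:
  fixes x :: "sobj set \<Rightarrow> 'k::field_char_0"
  assumes x: "x \<in> carrier (hall_algebra \<Gamma>)" shows "reversal x \<in> carrier (hall_algebra \<Gamma>')"
proof -
  have fx: "finite {K. x K \<noteq> 0}" and sx: "{K. x K \<noteq> 0} \<subseteq> iso_classes \<Gamma>" using x by (auto simp: hall_carrier)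
  define M where "M = targets x"
  note M = targets[OF fx sx, folded M_def]
  show ?thesis unfolding hall_carrier using finite_subset[OF M(3,1)] subset_trans[OF M(3,2)] by simp
qed

end

context arrow_reversal
begin

lemma reversal_inverse:
  fixes x :: "sobj set \<Rightarrow> 'k::field_char_0"
  assumes x: "x \<in> carrier (hall_algebra \<Gamma>)" shows "inverse.reversal (reversal x) = x"
proof
  fix K''
  have fx: "finite {K. x K \<noteq> 0}" and sx: "{K. x K \<noteq> 0} \<subseteq> iso_classes \<Gamma>" using x by (auto simp: hall_carrier)
  define M where "M = targets x"
  note M = targets[OF fx sx, folded M_def]
  have "inverse.reversal (reversal x) K'' = (\<Sum>K'\<in>M. reversal x K' * inverse.transition K' K'')"
    by (rule inverse.reversal_superset[OF M(1,3)])
  also have "\<dots> = (\<Sum>K'\<in>M. \<Sum>K | x K \<noteq> 0. x K * (transition K K' * inverse.transition K' K''))"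
    by (simp add: reversal_def sum_distrib_right mult.assoc)
  also have "\<dots> = (\<Sum>K | x K \<noteq> 0. x K * (\<Sum>K'\<in>M. transition K K' * inverse.transition K' K''))"
    by (subst sum.swap) (simp add: sum_distrib_left)
  also have "\<dots> = (\<Sum>K | x K \<noteq> 0. x K * (if K = K'' then 1 else 0))"
  proof (rule sum.cong[OF refl])
    fix K assume "K \<in> {K. x K \<noteq> 0}"
    then have K: "K \<in> iso_classes \<Gamma>" "x K \<noteq> 0" using sx by auto
    show "x K * (\<Sum>K'\<in>M. transition K K' * inverse.transition K' K'') = x K * (if K = K'' then 1 else 0)"
      unfolding transition_inverse[OF K(1) M(1) M(4)[OF K(2)]] ..
  qed
  also have "\<dots> = (\<Sum>K | x K \<noteq> 0. if K = K'' then x K else 0)" by (rule sum.cong) auto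
  also have "\<dots> = x K''" unfolding sum.delta[OF fx] by simp
  finally show "inverse.reversal (reversal x) K'' = x K''" .
qed

lemma hall_mult:
  "mult (hall_algebra \<Gamma>) x y K = (\<Sum>A | x A \<noteq> 0. \<Sum>C | y C \<noteq> (0 :: 'k::field_char_0). x A * y C * of_nat (X.ext_count A C K))"
  by (simp add: hall_algebra_def X.ext_count_def)

lemma hall_mult':
  "mult (hall_algebra \<Gamma>') x y K = (\<Sum>A | x A \<noteq> 0. \<Sum>C | y C \<noteq> (0 :: 'k::field_char_0). x A * y C * of_nat (Y.ext_count A C K))"
  by (simp add: hall_algebra_def Y.ext_count_def)

lemma reversal_mult:
  fixes x y :: "sobj set \<Rightarrow> 'k::field_char_0"
  assumes x: "x \<in> carrier (hall_algebra \<Gamma>)" and y: "y \<in> carrier (hall_algebra \<Gamma>)"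
  shows "reversal (x \<otimes>\<^bsub>hall_algebra \<Gamma>\<^esub> y) = reversal x \<otimes>\<^bsub>hall_algebra \<Gamma>'\<^esub> reversal y"
proof
  fix K'
  let ?X = "{K. x K \<noteq> 0}" and ?Y = "{K. y K \<noteq> 0}"
  have fx: "finite ?X" "?X \<subseteq> iso_classes \<Gamma>" and fy: "finite ?Y" "?Y \<subseteq> iso_classes \<Gamma>"
    using x y by (auto simp: hall_carrier)
  define M1 where "M1 = targets x"
  note M1 = targets[OF fx, folded M1_def]
  define M2 where "M2 = targets y"
  note M2 = targets[OF fy, folded M2_def]
  define N where "N = (\<Union>A\<in>?X. \<Union>C\<in>?Y. {K. X.ext_count A C K \<noteq> 0})"
  have finN: "finite N" unfolding N_def using fx fy X.ext_count_support by (intro finite_UN_I) auto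
  have subN: "{K. X.ext_count A C K \<noteq> 0} \<subseteq> N" if "A \<in> ?X" "C \<in> ?Y" for A C using that by (auto simp: N_def)
  have supp: "{K. (x \<otimes>\<^bsub>hall_algebra \<Gamma>\<^esub> y) K \<noteq> 0} \<subseteq> N"
  proof (rule subsetI, rule ccontr)
    fix K assume "K \<in> {K. (x \<otimes>\<^bsub>hall_algebra \<Gamma>\<^esub> y) K \<noteq> 0}" and n: "K \<notin> N"
    moreover have "(x \<otimes>\<^bsub>hall_algebra \<Gamma>\<^esub> y) K = 0"
      unfolding hall_mult by (intro sum.neutral ballI) (use n in \<open>auto simp: N_def\<close>)
    ultimately show False by simp
  qed
  have "reversal (x \<otimes>\<^bsub>hall_algebra \<Gamma>\<^esub> y) K' = (\<Sum>K\<in>N. (x \<otimes>\<^bsub>hall_algebra \<Gamma>\<^esub> y) K * transition K K')"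
    by (rule reversal_superset[OF finN supp])
  also have "\<dots> = (\<Sum>K\<in>N. \<Sum>A\<in>?X. \<Sum>C\<in>?Y. x A * y C * (of_nat (X.ext_count A C K) * transition K K'))"
    by (simp add: hall_mult sum_distrib_right mult.assoc)
  also have "\<dots> = (\<Sum>A\<in>?X. \<Sum>K\<in>N. \<Sum>C\<in>?Y. x A * y C * (of_nat (X.ext_count A C K) * transition K K'))"
    by (rule sum.swap)
  also have "\<dots> = (\<Sum>A\<in>?X. \<Sum>C\<in>?Y. x A * y C * (\<Sum>K\<in>N. of_nat (X.ext_count A C K) * transition K K'))"
    by (rule sum.cong[OF refl], subst sum.swap) (simp add: sum_distrib_left)
  also have "\<dots> = (\<Sum>A\<in>?X. \<Sum>C\<in>?Y. x A * y C * (\<Sum>A'\<in>M1. \<Sum>C'\<in>M2.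
      transition A A' * transition C C' * of_nat (Y.ext_count A' C' K')))"
  proof (rule sum.cong[OF refl], rule sum.cong[OF refl], rule arg_cong2[where f = "(*)", OF refl])
    fix A C assume AC: "A \<in> ?X" "C \<in> ?Y"
    then show "(\<Sum>K\<in>N. of_nat (X.ext_count A C K) * transition K K') = (\<Sum>A'\<in>M1. \<Sum>C'\<in>M2.
      transition A A' * transition C C' * of_nat (Y.ext_count A' C' K') :: 'k)"
      using fx fy by (intro transition_mult[OF _ _ finN subN[OF AC] M1(1) M1(4) M2(1) M2(4)]) auto
  qed
  also have "\<dots> = (\<Sum>A\<in>?X. \<Sum>C\<in>?Y. \<Sum>A'\<in>M1. \<Sum>C'\<in>M2.
      x A * transition A A' * (y C * transition C C') * of_nat (Y.ext_count A' C' K'))"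
    by (simp add: sum_distrib_left mult_ac)
  also have "\<dots> = (\<Sum>A\<in>?X. \<Sum>A'\<in>M1. \<Sum>C\<in>?Y. \<Sum>C'\<in>M2.
      x A * transition A A' * (y C * transition C C') * of_nat (Y.ext_count A' C' K'))"
    by (rule sum.cong[OF refl], rule sum.swap)
  also have "\<dots> = (\<Sum>A'\<in>M1. \<Sum>A\<in>?X. \<Sum>C'\<in>M2. \<Sum>C\<in>?Y.
      x A * transition A A' * (y C * transition C C') * of_nat (Y.ext_count A' C' K'))"
    by (subst sum.swap) (intro sum.cong refl sum.swap)
  also have "\<dots> = (\<Sum>A'\<in>M1. \<Sum>C'\<in>M2. \<Sum>A\<in>?X. \<Sum>C\<in>?Y.
      x A * transition A A' * (y C * transition C C') * of_nat (Y.ext_count A' C' K'))"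
    by (intro sum.cong refl sum.swap)
  also have "\<dots> = (\<Sum>A'\<in>M1. \<Sum>C'\<in>M2. reversal x A' * reversal y C' * of_nat (Y.ext_count A' C' K'))"
    unfolding reversal_def sum_product by (simp add: sum_distrib_right)
  also have "\<dots> = (\<Sum>A' | reversal x A' \<noteq> 0. \<Sum>C' | reversal y C' \<noteq> 0. reversal x A' * reversal y C' * of_nat (Y.ext_count A' C' K'))"
  proof -
    have "(\<Sum>C'\<in>M2. reversal x A' * reversal y C' * of_nat (Y.ext_count A' C' K'))
      = (\<Sum>C' | reversal y C' \<noteq> 0. reversal x A' * reversal y C' * of_nat (Y.ext_count A' C' K'))" for A'
      by (rule sum.mono_neutral_right) (use M2 in auto)
    then show ?thesis by (simp only:) (rule sum.mono_neutral_right, use M1 in auto)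
  qed
  also have "\<dots> = (reversal x \<otimes>\<^bsub>hall_algebra \<Gamma>'\<^esub> reversal y) K'" by (rule hall_mult'[symmetric])
  finally show "reversal (x \<otimes>\<^bsub>hall_algebra \<Gamma>\<^esub> y) K' = (reversal x \<otimes>\<^bsub>hall_algebra \<Gamma>'\<^esub> reversal y) K'" .
qed

lemma reversal_one:
  "reversal (one (hall_algebra \<Gamma>)) = (one (hall_algebra \<Gamma>') :: sobj set \<Rightarrow> 'k::field_char_0)"
proof
  fix K'
  have eX: "iso_class \<Gamma> [] = X.cls X.lab {} {}" and eY: "iso_class \<Gamma>' [] = Y.cls Y.lab {} {}"
    using X.iso_class_cls[OF X.Nil_sobj] Y.iso_class_cls[OF Y.Nil_sobj]
    by (simp_all add: X.sverts_Nil X.sedges_def Y.sedges_def)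
  have m: "matched L R X.lab {} {}" by (rule matchedI) auto
  have a: "added L R F X.lab {} {} = {{}}"
    using m by (auto simp: added_def dest: matchedD(3))
  have YY: "Y.cls X.lab {} {} = iso_class \<Gamma>' []"
    unfolding eY by (rule Y.cls_eqI[of id]) (simp add: graph_iso_def)
  have "(\<Sum>K | (if K = iso_class \<Gamma> [] then 1 else 0) \<noteq> (0::'k). (if K = iso_class \<Gamma> [] then 1 else 0) * transition K K')
     = transition (iso_class \<Gamma> []) K'" by simp
  also have "\<dots> = (if K' = iso_class \<Gamma>' [] then 1 else 0)"
  proof -
    have "{T \<in> {{}}. Y.cls X.lab {} T = K'} = (if K' = iso_class \<Gamma>' [] then {{}} else {})" using YY by auto
    then show ?thesis unfolding eX transition_cls[OF m] a by (simp add: edge_sign_def type_edges_def)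
  qed
  finally show "reversal (one (hall_algebra \<Gamma>)) K' = (one (hall_algebra \<Gamma>') K' :: 'k)"
    by (simp add: hall_algebra_def reversal_def)
qed

lemma reversal_add:
  fixes x y :: "sobj set \<Rightarrow> 'k::field_char_0"
  assumes x: "x \<in> carrier (hall_algebra \<Gamma>)" and y: "y \<in> carrier (hall_algebra \<Gamma>)"
  shows "reversal (\<lambda>K. x K + y K) = (\<lambda>K'. reversal x K' + reversal y K')"
proof
  fix K'
  let ?M = "{K. x K \<noteq> 0} \<union> {K. y K \<noteq> 0}"
  have M: "finite ?M" using x y by (simp add: hall_carrier)
  have "reversal (\<lambda>K. x K + y K) K' = (\<Sum>K\<in>?M. (x K + y K) * transition K K')"
    by (rule reversal_superset[OF M]) auto
  also have "\<dots> = reversal x K' + reversal y K'"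
    using reversal_superset[OF M, of x K'] reversal_superset[OF M, of y K'] by (simp add: distrib_right sum.distrib)
  finally show "reversal (\<lambda>K. x K + y K) K' = reversal x K' + reversal y K'" .
qed

lemma reversal_smult:
  fixes x :: "sobj set \<Rightarrow> 'k::field_char_0"
  assumes x: "x \<in> carrier (hall_algebra \<Gamma>)"
  shows "reversal (\<lambda>K. c * x K) = (\<lambda>K'. c * reversal x K')"
proof
  fix K'
  have "reversal (\<lambda>K. c * x K) K' = (\<Sum>K | x K \<noteq> 0. c * x K * transition K K')"
    by (rule reversal_superset) (use x in \<open>auto simp: hall_carrier\<close>)
  then show "reversal (\<lambda>K. c * x K) K' = c * reversal x K'"
    by (simp add: reversal_def sum_distrib_left mult.assoc)
qed

end

theorem (in arrow_reversal) reversal_algebra_iso: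
  "(reversal :: (sobj set \<Rightarrow> 'k::field_char_0) \<Rightarrow> _) \<in> algebra_iso (hall_algebra \<Gamma>) (hall_algebra \<Gamma>')"
proof -
  have "bij_betw reversal (carrier (hall_algebra \<Gamma>)) (carrier (hall_algebra \<Gamma>' :: ('k, sobj set \<Rightarrow> 'k) module))"
    by (rule bij_betw_byWitness[of _ inverse.reversal])
      (use reversal_inverse inverse.reversal_inverse reversal_closed inverse.reversal_closed in auto)
  moreover have "reversal \<in> ring_hom (hall_algebra \<Gamma>) (hall_algebra \<Gamma>' :: ('k, sobj set \<Rightarrow> 'k) module)"
  proof (rule ring_hom_memI)
    fix x y :: "sobj set \<Rightarrow> 'k" assume x: "x \<in> carrier (hall_algebra \<Gamma>)" and y: "y \<in> carrier (hall_algebra \<Gamma>)"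
    show "reversal x \<in> carrier (hall_algebra \<Gamma>')" by (rule reversal_closed[OF x])
    show "reversal (x \<otimes>\<^bsub>hall_algebra \<Gamma>\<^esub> y) = reversal x \<otimes>\<^bsub>hall_algebra \<Gamma>'\<^esub> reversal y"
      by (rule reversal_mult[OF x y])
    show "reversal (x \<oplus>\<^bsub>hall_algebra \<Gamma>\<^esub> y) = reversal x \<oplus>\<^bsub>hall_algebra \<Gamma>'\<^esub> reversal y"
      using reversal_add[OF x y] by (simp add: hall_algebra_def)
  next
    show "reversal (\<one>\<^bsub>hall_algebra \<Gamma>\<^esub>) = (\<one>\<^bsub>hall_algebra \<Gamma>'\<^esub> :: sobj set \<Rightarrow> 'k)" by (rule reversal_one)
  qed
  moreover have "reversal (c \<odot>\<^bsub>hall_algebra \<Gamma>\<^esub> x) = c \<odot>\<^bsub>hall_algebra \<Gamma>'\<^esub> reversal x"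
    if "x \<in> carrier (hall_algebra \<Gamma>)" for c :: 'k and x
    using reversal_smult[OF that, of c] by (simp add: hall_algebra_def)
  ultimately show ?thesis by (simp add: algebra_iso_def ring_iso_def)
qed

section \<open>Finite Coxeter groups\<close>

locale finite_coxeter =
  fixes G :: "'w monoid" and s :: "'n::finite \<Rightarrow> 'w"
  assumes coxeter: "coxeter_system G s" and fin: "finite (carrier G)"
begin

abbreviation "wp \<equiv> word_prod G s"
abbreviation "len \<equiv> cox_length G s"
abbreviation "B \<equiv> cox_form G s"
abbreviation "\<sigma> \<equiv> simple_reflection G s"
abbreviation "act \<equiv> word_act G s"
abbreviation "\<alpha> \<equiv> (simple_root :: 'n \<Rightarrow> real ^ 'n)"

definition m :: "'n \<Rightarrow> 'n \<Rightarrow> nat" where "m i j = group.ord G (s i \<otimes>\<^bsub>G\<^esub> s j)"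

sublocale group G
  using coxeter by (simp add: coxeter_system_def)

lemma s_closed [simp]: "s i \<in> carrier G"
  using coxeter by (auto simp: coxeter_system_def)

lemma s_sq [simp]: "s i \<otimes>\<^bsub>G\<^esub> s i = \<one>\<^bsub>G\<^esub>"
  using coxeter by (auto simp: coxeter_system_def)

lemma s_inv: "inv\<^bsub>G\<^esub> s i = s i"
  by (simp add: inv_equality)

lemma wp_Nil [simp]: "wp [] = \<one>\<^bsub>G\<^esub>"
  and wp_Cons [simp]: "wp (i # w) = s i \<otimes>\<^bsub>G\<^esub> wp w"
  by (simp_all add: word_prod_def)

lemma wp_closed [simp]: "wp w \<in> carrier G"
  by (induction w) auto

lemma wp_append [simp]: "wp (v @ w) = wp v \<otimes>\<^bsub>G\<^esub> wp w"
  by (induction v) (auto simp: m_assoc)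

lemma wp_rev: "wp (rev w) = inv\<^bsub>G\<^esub> wp w"
  by (induction w) (auto simp: inv_mult_group s_inv)

lemma m_self [simp]: "m i i = 1"
  by (simp add: m_def)

lemma m_ge2: "i \<noteq> j \<Longrightarrow> m i j \<ge> 2"
proof -
  assume ij: "i \<noteq> j"
  have "m i j \<ge> 1" using ord_ge_1[OF fin] by (simp add: m_def)
  moreover have "m i j \<noteq> 1"
  proof
    assume "m i j = 1"
    then have "s i \<otimes>\<^bsub>G\<^esub> s j = \<one>\<^bsub>G\<^esub>" using ord_eq_1[of "s i \<otimes>\<^bsub>G\<^esub> s j"] by (simp add: m_def)
    then have "s i = s j" using s_inv inv_equality by fastforce
    then show False using ij coxeter by (auto simp: coxeter_system_def inj_def)
  qed
  ultimately show ?thesis by linarith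
qed

lemma m_sym: "m i j = m j i"
proof -
  have "inv\<^bsub>G\<^esub> (s i \<otimes>\<^bsub>G\<^esub> s j) = s j \<otimes>\<^bsub>G\<^esub> s i" by (simp add: inv_mult_group s_inv)
  then show ?thesis using ord_inv[of "s i \<otimes>\<^bsub>G\<^esub> s j"] by (simp add: m_def)
qed

section \<open>The geometric action\<close>

lemma B_add_left: "B (x + y) z = B x z + B y z"
  and B_scale_left: "B (c *\<^sub>R x) z = c * B x z"
  and B_add_right: "B z (x + y) = B z x + B z y"
  and B_scale_right: "B z (c *\<^sub>R x) = c * B z x"
  by (simp_all add: cox_form_def algebra_simps sum.distrib sum_distrib_left sum_subtractf sum_negf)

lemma B_sym: "B x y = B y x"
proof -
  have "B x y = (\<Sum>j\<in>UNIV. \<Sum>i\<in>UNIV. x $ i * y $ j * (- cos (pi / real (m i j))))"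
    unfolding cox_form_def m_def by (rule sum.swap)
  also have "\<dots> = B y x" unfolding cox_form_def m_def[symmetric]
    by (intro sum.cong refl) (simp add: m_sym)
  finally show ?thesis .
qed

lemma B_minus_left: "B (- x) z = - B x z"
  using B_scale_left[of "-1" x z] by simp
lemma B_minus_right: "B z (- x) = - B z x"
  using B_scale_right[of z "-1" x] by simp
lemma B_diff_left: "B (x - y) z = B x z - B y z"
  using B_add_left[of x "-y" z] B_minus_left by simp
lemma B_diff_right: "B z (x - y) = B z x - B z y"
  using B_add_right[of z x "-y"] B_minus_right by simp

lemmas B_linear = B_add_left B_add_right B_scale_left B_scale_right B_minus_left B_minus_right
  B_diff_left B_diff_right

lemma B_simple: "B (\<alpha> i) (\<alpha> j) = - cos (pi / real (m i j))"
proof -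
  have "B (\<alpha> i) (\<alpha> j) = (\<Sum>a\<in>UNIV. \<Sum>b\<in>UNIV. if b = j then (if a = i then - cos (pi / real (m a b)) else 0) else 0)"
    unfolding cox_form_def m_def[symmetric] by (intro sum.cong refl) (auto simp: simple_root_def axis_def)
  then show ?thesis by simp
qed

lemma B_simple_self [simp]: "B (\<alpha> i) (\<alpha> i) = 1"
  by (simp add: B_simple)

definition reflect :: "real ^ 'n \<Rightarrow> real ^ 'n \<Rightarrow> real ^ 'n" where
  "reflect b v = v - (2 * B b v) *\<^sub>R b"

lemma simple_reflection_eq: "\<sigma> i v = reflect (\<alpha> i) v"
  by (simp add: simple_reflection_def reflect_def)

lemma reflect_linear: "linear (reflect b)"
  by (rule linearI) (simp_all add: reflect_def B_linear algebra_simps scaleR_add_left)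

lemma reflect_involution: "B b b = 1 \<Longrightarrow> reflect b (reflect b v) = v"
  by (simp add: reflect_def B_linear algebra_simps)

lemma reflect_isometry: "B b b = 1 \<Longrightarrow> B (reflect b x) (reflect b y) = B x y"
  by (simp add: reflect_def B_linear algebra_simps B_sym[of x b])

lemma reflect_self: "B b b = 1 \<Longrightarrow> reflect b b = - b"
  by (simp add: reflect_def scaleR_2)

lemma reflect_minus: "reflect (- b) = reflect b"
  by (simp add: reflect_def fun_eq_iff B_linear)

lemma act_Nil [simp]: "act [] v = v"
  and act_Cons [simp]: "act (i # w) v = \<sigma> i (act w v)"
  and act_append [simp]: "act (u @ w) v = act u (act w v)"
  by (simp_all add: word_act_def)

lemma sigma_sq [simp]: "\<sigma> i (\<sigma> i v) = v"
  by (simp add: simple_reflection_eq reflect_involution)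

lemma sigma_linear: "linear (\<sigma> i)"
  using reflect_linear[of "\<alpha> i"] by (simp add: simple_reflection_eq[abs_def])

lemma act_linear: "linear (act w)"
proof (induction w)
  case Nil
  have "act [] = id" by auto
  then show ?case by (simp add: linear_id[unfolded id_def] id_def)
next
  case (Cons i w)
  have "act (i # w) = \<sigma> i \<circ> act w" by auto
  then show ?case using linear_compose[OF Cons sigma_linear, of i] by (simp only:)
qed

lemma act_isometry: "B (act w x) (act w y) = B x y"
  by (induction w) (auto simp: simple_reflection_eq reflect_isometry)

lemma act_rev [simp]: "act (rev w) (act w v) = v"
  by (induction w arbitrary: v) auto

lemma act_rev' [simp]: "act w (act (rev w) v) = v"
  using act_rev[of "rev w"] by simp

lemma act_minus: "act w (- v) = - act w v"
  by (rule linear_neg[OF act_linear])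

lemma act_reflect: "act w (reflect b v) = reflect (act w b) (act w v)"
  by (simp add: reflect_def linear_diff[OF act_linear] linear_scale[OF act_linear] act_isometry)

lemma root_norm: "B (act w (\<alpha> i)) (act w (\<alpha> i)) = 1"
  by (simp add: act_isometry)

section \<open>Alternating words\<close>

fun alt :: "'n \<Rightarrow> 'n \<Rightarrow> nat \<Rightarrow> 'n list" where
  "alt a b 0 = []"
| "alt a b (Suc k) = (if even k then b else a) # alt a b k"

lemma length_alt [simp]: "length (alt a b k) = k"
  by (induction k) auto

lemma alt_add: "alt a b (j + k) = (if even k then alt a b j else alt b a j) @ alt a b k"
  by (induction j) auto

lemma alt_snoc: "alt a b (Suc k) = alt b a k @ [b]"
  using alt_add[of a b k 1] by simp

lemma rev_alt: "rev (alt a b k) = (if even k then alt b a k else alt a b k)"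
proof (induction k arbitrary: a b)
  case (Suc k)
  show ?case by (subst alt_snoc) (auto simp: Suc)
qed simp

lemma alt_double: "concat (replicate k [a, b]) = alt a b (2 * k)"
  by (induction k) auto

lemma wp_alt_double: "wp (alt a b (2 * k)) = (s a \<otimes>\<^bsub>G\<^esub> s b) [^]\<^bsub>G\<^esub> k"
proof (induction k)
  case (Suc k)
  have "alt a b (2 * Suc k) = a # b # alt a b (2 * k)" by simp
  moreover have "(s a \<otimes>\<^bsub>G\<^esub> s b) [^]\<^bsub>G\<^esub> Suc k = (s a \<otimes>\<^bsub>G\<^esub> s b) \<otimes>\<^bsub>G\<^esub> (s a \<otimes>\<^bsub>G\<^esub> s b) [^]\<^bsub>G\<^esub> k"
    by (rule nat_pow_Suc2) simp
  ultimately show ?case using Suc by (simp add: m_assoc del: nat_pow_Suc)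
qed simp

lemma braid: "wp (alt a b (m a b)) = wp (alt b a (m a b))"
proof -
  let ?k = "m a b"
  have 1: "wp (alt a b (2 * ?k)) = \<one>\<^bsub>G\<^esub>"
    by (simp add: wp_alt_double m_def pow_ord_eq_1)
  have 2: "wp (rev w) \<otimes>\<^bsub>G\<^esub> wp v = \<one>\<^bsub>G\<^esub> \<Longrightarrow> wp w = wp v" for v w
    unfolding wp_rev using inv_equality[of "inv\<^bsub>G\<^esub> wp w" "wp v"]
    by (metis inv_closed inv_inv inv_solve_left r_one wp_closed one_closed)
  have "rev (alt b a ?k) @ alt a b ?k = alt a b (2 * ?k)"
    unfolding mult_2 alt_add rev_alt by auto
  then have "wp (rev (alt b a ?k)) \<otimes>\<^bsub>G\<^esub> wp (alt a b ?k) = \<one>\<^bsub>G\<^esub>"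
    using 1 by (metis wp_append)
  from 2[OF this] show ?thesis by simp
qed

text \<open>These are the values of the Chebyshev polynomials of the second kind at \<open>cos t\<close>; they are the
  coefficients of the roots of a dihedral group.\<close>

definition cheb :: "real \<Rightarrow> nat \<Rightarrow> real" where "cheb t k = sin (real k * t) / sin t"

lemma cheb_rec: "cheb t (Suc (Suc k)) = 2 * cos t * cheb t (Suc k) - cheb t k"
proof -
  define u where "u = real (Suc k) * t"
  have "real (Suc (Suc k)) * t = u + t" "real k * t = u - t" by (simp_all add: u_def algebra_simps)
  then have "sin (real (Suc (Suc k)) * t) = 2 * cos t * sin u - sin (real k * t)"
    by (simp add: sin_add sin_diff)
  then show ?thesis by (simp add: cheb_def diff_divide_distrib u_def)
qed

definition angle :: "'n \<Rightarrow> 'n \<Rightarrow> real" where "angle a b = pi / real (m a b)"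

lemma sin_angle: "a \<noteq> b \<Longrightarrow> sin (angle a b) > 0"
  using m_ge2[of a b] by (intro sin_gt_zero) (auto simp: angle_def field_simps)

lemma act_alt:
  assumes "a \<noteq> b"
  shows "act (alt a b k) (\<alpha> a) =
    cheb (angle a b) (if even k then Suc k else k) *\<^sub>R \<alpha> a
    + cheb (angle a b) (if even k then k else Suc k) *\<^sub>R \<alpha> b"
proof (induction k)
  case 0
  show ?case using sin_angle[OF assms] by (simp add: cheb_def)
next
  case (Suc k)
  let ?c = "cheb (angle a b)"
  have ab: "B (\<alpha> a) (\<alpha> b) = - cos (angle a b)" "B (\<alpha> b) (\<alpha> a) = - cos (angle a b)"
    using B_sym by (simp_all add: B_simple angle_def m_sym)
  have \<sigma>: "\<sigma> b (x *\<^sub>R \<alpha> a + y *\<^sub>R \<alpha> b) = x *\<^sub>R \<alpha> a + (2 * cos (angle a b) * x - y) *\<^sub>R \<alpha> b"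
    "\<sigma> a (y *\<^sub>R \<alpha> a + x *\<^sub>R \<alpha> b) = (2 * cos (angle a b) * x - y) *\<^sub>R \<alpha> a + x *\<^sub>R \<alpha> b" for x y
    by (simp_all add: simple_reflection_def B_linear ab) (simp_all add: vec_eq_iff algebra_simps)
  show ?case
    using Suc by (cases "even k") (simp_all add: \<sigma> cheb_rec)
qed

lemma cheb_2m: assumes "a \<noteq> b"
  shows "cheb (angle a b) (2 * m a b) = 0" "cheb (angle a b) (Suc (2 * m a b)) = 1"
    "cheb (angle a b) (2 * m a b - 1) = - 1"
proof -
  have m: "m a b \<ge> 2" using m_ge2[OF assms] .
  have e: "real (2 * m a b) * angle a b = 2 * pi" using m by (simp add: angle_def)
  have s0: "sin (angle a b) \<noteq> 0" using sin_angle[OF assms] by simp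
  show "cheb (angle a b) (2 * m a b) = 0" unfolding cheb_def e by simp
  have "real (Suc (2 * m a b)) * angle a b = 2 * pi + angle a b"
    using e by (simp add: algebra_simps)
  then show "cheb (angle a b) (Suc (2 * m a b)) = 1"
    using s0 by (simp add: cheb_def sin_add)
  have "real (2 * m a b - 1) * angle a b = 2 * pi - angle a b"
    using e m by (simp add: algebra_simps of_nat_diff)
  then show "cheb (angle a b) (2 * m a b - 1) = - 1"
    using s0 by (simp add: cheb_def sin_diff)
qed

text \<open>For \<open>a \<noteq> b\<close>, on the plane of \<open>\<alpha>\<^sub>a\<close> and \<open>\<alpha>\<^sub>b\<close> the relator acts trivially by the values of the coefficients at
  twice the order. The orthogonal space is fixed by both reflections, and it is a
  complement of the plane because the Gram determinant \<open>1 - cos\<^sup>2\<close> does not vanish.\<close>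

lemma act_relator: "act (concat (replicate (m a b) [a, b])) v = v"
proof (cases "a = b")
  case True then show ?thesis by simp
next
  case False
  let ?w = "alt a b (2 * m a b)" and ?c = "cos (angle a b)"
  have m: "m a b \<ge> 2" using m_ge2[OF False] .
  have wa: "act ?w (\<alpha> a) = \<alpha> a" using cheb_2m[OF False] by (simp add: act_alt[OF False])
  have "?w = alt a b (Suc (2 * m a b - 1))" using m by simp
  also have "\<dots> = alt b a (2 * m a b - 1) @ [b]" by (rule alt_snoc)
  finally have "act ?w (\<alpha> b) = - act (alt b a (2 * m a b - 1)) (\<alpha> b)"
    by (simp add: simple_reflection_eq reflect_self act_minus)
  also have "odd (2 * m a b - 1)" using m by simp
  then have "act (alt b a (2 * m a b - 1)) (\<alpha> b) = - \<alpha> b"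
    using cheb_2m[OF False] m act_alt[OF False[symmetric], of "2 * m a b - 1"]
    by (simp add: angle_def m_sym[of b a])
  finally have wb: "act ?w (\<alpha> b) = \<alpha> b" by simp
  have ab: "B (\<alpha> a) (\<alpha> b) = - ?c" "B (\<alpha> b) (\<alpha> a) = - ?c"
    using B_sym by (simp_all add: B_simple angle_def m_sym)
  have d: "1 - ?c^2 \<noteq> 0" using sin_angle[OF False] by (simp add: sin_squared_eq[symmetric])
  \<comment> \<open>\<open>x\<close> and \<open>y\<close> are the coefficients of the orthogonal projection of \<open>v\<close> to the plane.\<close>
  define x where "x = (B (\<alpha> a) v + ?c * B (\<alpha> b) v) / (1 - ?c^2)"
  define y where "y = (B (\<alpha> b) v + ?c * B (\<alpha> a) v) / (1 - ?c^2)"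
  have xy: "x - ?c * y = B (\<alpha> a) v" "y - ?c * x = B (\<alpha> b) v"
  proof -
    have "(x - ?c * y) * (1 - ?c^2) = B (\<alpha> a) v * (1 - ?c^2)"
      "(y - ?c * x) * (1 - ?c^2) = B (\<alpha> b) v * (1 - ?c^2)"
      using d unfolding x_def y_def by (simp_all add: left_diff_distrib) (simp_all add: algebra_simps power2_eq_square)
    with d show "x - ?c * y = B (\<alpha> a) v" "y - ?c * x = B (\<alpha> b) v" by auto
  qed
  define z where "z = v - x *\<^sub>R \<alpha> a - y *\<^sub>R \<alpha> b"
  have "B (\<alpha> a) z = 0" "B (\<alpha> b) z = 0" using xy by (simp_all add: z_def B_linear ab mult.commute)
  then have za: "\<sigma> a z = z" and zb: "\<sigma> b z = z" by (simp_all add: simple_reflection_def)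
  have "act (alt a b k) z = z" for k by (induction k) (auto simp: za zb)
  then have "act ?w (z + x *\<^sub>R \<alpha> a + y *\<^sub>R \<alpha> b) = z + x *\<^sub>R \<alpha> a + y *\<^sub>R \<alpha> b"
    by (simp add: linear_add[OF act_linear] linear_scale[OF act_linear] wa wb)
  moreover have "z + x *\<^sub>R \<alpha> a + y *\<^sub>R \<alpha> b = v" by (simp add: z_def)
  ultimately show ?thesis by (simp add: alt_double)
qed

lemma relator_step_act: "relator_step m u v \<Longrightarrow> act u = act v \<and> (even (length u) \<longleftrightarrow> even (length v))"
  unfolding relator_step_def
  by (auto simp: fun_eq_iff act_relator alt_double[symmetric]) (simp_all add: alt_double)

lemma equivclp_act:
  "equivclp (relator_step m) u v \<Longrightarrow> act u = act v \<and> (even (length u) \<longleftrightarrow> even (length v))"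
proof (induction rule: equivclp_induct)
  case (step y z)
  then show ?case using relator_step_act[of y z] relator_step_act[of z y] by auto
qed simp

text \<open>The defining presentation of the group enters here: both the action and the parity of the length
  are invariant under deleting relators.\<close>

lemma wp_eq_imp:
  assumes "wp u = wp v"
  shows "act u = act v" and "even (length u) \<longleftrightarrow> even (length v)"
proof -
  have m: "(\<lambda>i j. ord (s i \<otimes>\<^bsub>G\<^esub> s j)) = m" by (simp add: m_def fun_eq_iff)
  have "wp (rev v @ u) = \<one>\<^bsub>G\<^esub>" using assms by (simp add: wp_rev)
  then have e: "equivclp (relator_step m) (rev v @ u) []"
    using coxeter unfolding coxeter_system_def m by blast
  from equivclp_act[OF this] have 1: "act (rev v @ u) = act []" "even (length (rev v @ u))" by auto
  have "act u x = act v x" for x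
  proof -
    have "act (rev v) (act u x) = x" using fun_cong[OF 1(1), of x] by simp
    then show ?thesis by (metis act_rev')
  qed
  then show "act u = act v" by auto
  show "even (length u) \<longleftrightarrow> even (length v)" using 1(2) by simp
qed

end

section \<open>Positive and negative roots\<close>

context finite_coxeter
begin

definition nonneg :: "real ^ 'n \<Rightarrow> bool" where "nonneg v \<longleftrightarrow> (\<forall>i. v $ i \<ge> 0)"
definition reduced :: "'n list \<Rightarrow> bool" where "reduced w \<longleftrightarrow> length w = len (wp w)"

lemma nonneg_comb: "\<lbrakk>nonneg x; nonneg y; a \<ge> 0; b \<ge> 0\<rbrakk> \<Longrightarrow> nonneg (a *\<^sub>R x + b *\<^sub>R y)"
  by (simp add: nonneg_def)

lemma nonneg_antisym: "nonneg v \<Longrightarrow> nonneg (- v) \<Longrightarrow> v = 0"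
  by (auto simp: nonneg_def vec_eq_iff intro: antisym)

lemma nonneg_simple: "nonneg (\<alpha> i)"
  by (simp add: nonneg_def simple_root_def axis_def)

lemma len_le: "len (wp w) \<le> length w"
  unfolding cox_length_def by (rule Least_le) auto

lemma ex_reduced: "\<exists>u. wp u = wp w \<and> length u = len (wp w)"
  using LeastI_ex[of "\<lambda>k. \<exists>u. length u = k \<and> wp u = wp w"] unfolding cox_length_def by blast

lemma reduced_appendD:
  assumes "reduced (u @ v)" shows "reduced u" "reduced v"
proof -
  obtain u' where u': "wp u' = wp u" "length u' = len (wp u)" using ex_reduced by blast
  obtain v' where v': "wp v' = wp v" "length v' = len (wp v)" using ex_reduced by blast
  have "length u + length v = len (wp (u @ v))" using assms by (simp add: reduced_def)
  also have "wp (u @ v) = wp (u' @ v')" by (simp add: u' v')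
  also have "len \<dots> \<le> len (wp u) + len (wp v)" using len_le[of "u' @ v'"] u' v' by simp
  finally show "reduced u" "reduced v" using len_le[of u] len_le[of v] by (auto simp: reduced_def)
qed

lemma reduced_rev: assumes "reduced w" shows "reduced (rev w)"
proof -
  obtain u where u: "wp u = wp (rev w)" "length u = len (wp (rev w))" using ex_reduced by blast
  have "wp (rev u) = wp w" using u(1) by (simp add: wp_rev)
  then have "length w \<le> length u" using assms len_le[of "rev u"] by (simp add: reduced_def)
  then show ?thesis using len_le[of "rev w"] u by (simp add: reduced_def)
qed

lemma not_reduced_snoc:
  assumes "reduced w" "\<not> reduced (w @ [a])"
  obtains u where "wp u = wp (w @ [a])" "Suc (length u) = length w"
proof -
  obtain u where u: "wp u = wp (w @ [a])" "length u = len (wp (w @ [a]))" using ex_reduced by blast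
  have "length u \<le> length w"
    using assms(2) u len_le[of "w @ [a]"] by (simp add: reduced_def)
  moreover have "even (length u) \<longleftrightarrow> even (Suc (length w))" using wp_eq_imp(2)[OF u(1)] by simp
  moreover have "length w \<le> Suc (length u)"
  proof -
    have "wp (u @ [a]) = wp w" using u(1) by (simp add: m_assoc)
    then show ?thesis using assms(1) len_le[of "u @ [a]"] by (simp add: reduced_def)
  qed
  ultimately have "Suc (length u) = length w" by (metis le_SucE le_antisym Suc_leI even_Suc le_neq_implies_less)
  then show ?thesis using that u by blast
qed

text \<open>Let \<open>b\<close> be the last letter of \<open>w\<close>. Among all reduced words for the same element, take one that ends
  in an alternating word in \<open>a\<close> and \<open>b\<close> (with last letter \<open>b\<close>) of maximal length \<open>k\<close>, and let \<open>v\<close> be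
  what precedes. Both \<open>va\<close> and \<open>vb\<close> are reduced, one because the alternating word starts with that
  letter and the other by the maximality of \<open>k\<close>, so induction applies to \<open>v\<close> with either letter.
  The alternating word maps \<open>\<alpha>\<^sub>a\<close> to a combination of \<open>\<alpha>\<^sub>a\<close> and \<open>\<alpha>\<^sub>b\<close> whose coefficients are nonnegative
  because \<open>k\<close> is less than the order of \<open>s\<^sub>a s\<^sub>b\<close>: otherwise the braid relation would give a reduced word
  ending in \<open>a\<close>.\<close>

theorem reduced_nonneg: "reduced (w @ [a]) \<Longrightarrow> nonneg (act w (\<alpha> a))"
proof (induction "length w" arbitrary: w a rule: less_induct)
  case less
  have red_w: "reduced w" using reduced_appendD less.prems by blast
  show ?case
  proof (cases w rule: rev_cases)
    case Nil
    then show ?thesis by (simp add: nonneg_simple)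
  next
    case (snoc w' b)
    have "a \<noteq> b"
    proof
      assume "a = b"
      then have "wp (w @ [a]) = wp w'" using snoc by (simp add: m_assoc)
      then show False using less.prems len_le[of w'] snoc by (simp add: reduced_def)
    qed
    let ?P = "\<lambda>k. \<exists>v. wp (v @ alt a b k) = wp w \<and> length v + k = length w"
    have P1: "?P 1" using snoc by auto
    have bound: "\<forall>k. ?P k \<longrightarrow> k \<le> length w" by auto
    define k where "k = (GREATEST k. ?P k)"
    have Pk: "?P k" unfolding k_def using GreatestI_nat[of ?P, OF P1] bound by blast
    have kmax: "?P j \<Longrightarrow> j \<le> k" for j unfolding k_def using Greatest_le_nat[of ?P] bound by blast
    have k1: "k \<ge> 1" using kmax[OF P1] .
    obtain v where v: "wp (v @ alt a b k) = wp w" "length v + k = length w" using Pk by blast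
    have red: "reduced (v @ alt a b k)" using red_w v by (simp add: reduced_def)
    have red_v: "reduced v" using reduced_appendD red by blast
    \<comment> \<open>\<open>y\<close> is the first letter of the alternating word, and \<open>z\<close> would be the next letter in front.\<close>
    define z where "z = (if even k then b else a)"
    define y where "y = (if even k then a else b)"
    obtain k' where k': "k = Suc k'" using k1 by (cases k) auto
    have "v @ alt a b k = (v @ [y]) @ alt a b k'" by (simp add: k' y_def)
    then have red_y: "reduced (v @ [y])" using reduced_appendD(1) red by metis
    have red_z: "reduced (v @ [z])"
    proof (rule ccontr)
      assume "\<not> reduced (v @ [z])"
      from not_reduced_snoc[OF red_v this] obtain u where
        u: "wp u = wp (v @ [z])" "Suc (length u) = length v" .
      have "wp (u @ alt a b (Suc k)) = wp (v @ [z]) \<otimes>\<^bsub>G\<^esub> (s z \<otimes>\<^bsub>G\<^esub> wp (alt a b k))"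
        using u(1) by (simp add: z_def)
      also have "\<dots> = wp w" using v(1) by (simp add: m_assoc) (simp add: m_assoc[symmetric])
      finally have "?P (Suc k)" using u(2) v(2) by (intro exI[of _ u]) simp
      then show False using kmax by fastforce
    qed
    have lt: "length v < length w" using v(2) k1 by simp
    have nn: "nonneg (act v (\<alpha> y))" "nonneg (act v (\<alpha> z))"
      using less.hyps[OF lt] red_y red_z by auto
    then have nab: "nonneg (act v (\<alpha> a))" "nonneg (act v (\<alpha> b))"
      by (auto simp: y_def z_def split: if_splits)
    have km: "k < m a b"
    proof (rule ccontr)
      assume "\<not> k < m a b"
      then obtain j where j: "k = j + m a b" by (metis add.commute le_Suc_ex not_less)
      define p where "p = (if even (m a b) then alt a b j else alt b a j)"
      obtain n where n: "m a b = Suc n" using m_ge2[OF \<open>a \<noteq> b\<close>] by (cases "m a b") auto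
      have "wp (v @ alt a b k) = wp (v @ p @ alt a b (m a b))"
        unfolding j alt_add by (simp add: p_def)
      also have "\<dots> = wp (v @ p @ alt b a (m a b))" by (metis wp_append braid)
      also have "alt b a (m a b) = alt a b n @ [a]" unfolding n by (rule alt_snoc)
      finally have "wp w = wp ((v @ p @ alt a b n) @ [a])" using v(1) by simp
      then have "wp (w @ [a]) = wp (v @ p @ alt a b n)" by (simp add: m_assoc)
      moreover have "length (v @ p @ alt a b n) < length w" using v(2) j n by (simp add: p_def)
      ultimately show False using less.prems len_le[of "v @ p @ alt a b n"] by (simp add: reduced_def)
    qed
    have cheb: "cheb (angle a b) l \<ge> 0" if "l \<le> m a b" for l
    proof -
      have "real l * angle a b \<le> pi" "0 \<le> real l * angle a b"
        using that m_ge2[OF \<open>a \<noteq> b\<close>] by (auto simp: angle_def field_simps)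
      then show ?thesis using sin_angle[OF \<open>a \<noteq> b\<close>] by (simp add: cheb_def sin_ge_zero)
    qed
    have "act w (\<alpha> a) = act v (act (alt a b k) (\<alpha> a))"
      using fun_cong[OF wp_eq_imp(1)[OF v(1)], of "\<alpha> a"] by simp
    also have "\<dots> = cheb (angle a b) (if even k then Suc k else k) *\<^sub>R act v (\<alpha> a)
        + cheb (angle a b) (if even k then k else Suc k) *\<^sub>R act v (\<alpha> b)"
      by (simp only: act_alt[OF \<open>a \<noteq> b\<close>] linear_add[OF act_linear] linear_scale[OF act_linear])
    also have "nonneg \<dots>" using km by (intro nonneg_comb nab cheb) auto
    finally show ?thesis .
  qed
qed

text \<open>If \<open>wa\<close> is not longer than \<open>w\<close>, then \<open>w\<close> has a reduced expression ending in \<open>a\<close>, which sends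
  \<open>\<alpha>\<^sub>a\<close> to a negative root.\<close>

lemma root_sign: "nonneg (act w (\<alpha> a)) \<or> nonneg (- act w (\<alpha> a))"
proof -
  obtain u where u: "wp u = wp w" "length u = len (wp w)" using ex_reduced by blast
  have red: "reduced u" using u by (simp add: reduced_def)
  have act_u: "act u = act w" using wp_eq_imp(1)[OF u(1)] .
  show ?thesis
  proof (cases "reduced (u @ [a])")
    case True
    then show ?thesis using reduced_nonneg act_u by metis
  next
    case False
    from not_reduced_snoc[OF red this] obtain x where
      x: "wp x = wp (u @ [a])" "Suc (length x) = length u" .
    have xa: "wp (x @ [a]) = wp u" using x(1) by (simp add: m_assoc)
    then have "reduced (x @ [a])" using red x(2) by (simp add: reduced_def)
    then have "nonneg (act x (\<alpha> a))" by (rule reduced_nonneg)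
    moreover have "act u (\<alpha> a) = act (x @ [a]) (\<alpha> a)" using wp_eq_imp(1)[OF xa] by simp
    then have "act u (\<alpha> a) = - act x (\<alpha> a)" by (simp add: simple_reflection_eq reflect_self act_minus)
    ultimately show ?thesis using act_u by simp
  qed
qed

lemma root_nonzero: "act w (\<alpha> a) \<noteq> 0"
proof
  assume "act w (\<alpha> a) = 0"
  then have "B 0 0 = 1" using root_norm[of w a] by simp
  then show False using B_scale_left[of 0 0 0] by simp
qed

text \<open>No element is longer than the longest one, so multiplying its inverse by a simple reflection shortens
  it; hence every simple root becomes negative.\<close>

lemma longest_negative:
  assumes red: "reduced u" and longest: "longest_element G s (wp u)" and v: "nonneg v"
  shows "nonneg (- act (rev u) v)"
proof -
  have neg: "nonneg (- act (rev u) (\<alpha> a))" for a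
  proof -
    have "\<not> reduced (rev u @ [a])"
    proof
      assume "reduced (rev u @ [a])"
      then have "len (wp (rev u @ [a])) > length u" by (simp add: reduced_def)
      moreover have "len (wp (rev u @ [a])) \<le> len (wp u)"
        using longest wp_closed by (simp add: longest_element_def)
      ultimately show False using red by (simp add: reduced_def)
    qed
    from not_reduced_snoc[OF reduced_rev[OF red] this] obtain x where
      x: "wp x = wp (rev u @ [a])" "Suc (length x) = length (rev u)" .
    have xa: "wp (x @ [a]) = wp (rev u)" using x(1) by (simp add: m_assoc)
    then have "reduced (x @ [a])" using reduced_rev[OF red] x(2) by (simp add: reduced_def)
    then have "nonneg (act x (\<alpha> a))" by (rule reduced_nonneg)
    moreover have "act (rev u) (\<alpha> a) = act (x @ [a]) (\<alpha> a)" using wp_eq_imp(1)[OF xa] by simp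
    then have "act (rev u) (\<alpha> a) = - act x (\<alpha> a)" by (simp add: simple_reflection_eq reflect_self act_minus)
    ultimately show ?thesis by simp
  qed
  have "v = (\<Sum>a\<in>UNIV. v $ a *\<^sub>R \<alpha> a)"
    using basis_expansion[of v] by (simp add: simple_root_def scalar_mult_eq_scaleR)
  then have "act (rev u) v = (\<Sum>a\<in>UNIV. v $ a *\<^sub>R act (rev u) (\<alpha> a))"
    by (metis (no_types, lifting) linear_sum[OF act_linear] linear_scale[OF act_linear] sum.cong)
  then show ?thesis using neg v
    by (auto simp: nonneg_def intro!: sum_nonpos mult_nonneg_nonpos)
qed

text \<open>A simple reflection changes one coordinate only, so a positive root that it makes negative has
  no other coordinates; its norm determines it.\<close>

lemma simple_sign_change:
  assumes x: "x = act w (\<alpha> b)" "nonneg x" "\<not> nonneg (\<sigma> a x)"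
  shows "x = \<alpha> a"
proof -
  have "nonneg (- \<sigma> a x)" using root_sign[of "a # w" b] x by simp
  then have "x $ j = 0" if "j \<noteq> a" for j
    using x(2) that unfolding nonneg_def
    by (auto simp: simple_reflection_def simple_root_def axis_def intro!: antisym dest!: spec[of _ j])
  then have xa: "x = x $ a *\<^sub>R \<alpha> a" by (auto simp: vec_eq_iff simple_root_def axis_def)
  have "B x x = 1" using root_norm x(1) by simp
  then have "(x $ a)\<^sup>2 = 1" using xa by (metis B_scale_left B_scale_right B_simple_self mult.right_neutral power2_eq_square)
  then have "x $ a = 1" using x(2) unfolding nonneg_def by (metis abs_of_nonneg power2_eq_1_iff abs_neg_one one_neq_neg_one)
  then show ?thesis using xa by simp
qed

end

section \<open>Subwords at sets of positions\<close>

lemma subword_cong: "J \<inter> {1..length Q} = J' \<inter> {1..length Q} \<Longrightarrow> subword Q J = subword Q J'"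
proof -
  assume eq: "J \<inter> {1..length Q} = J' \<inter> {1..length Q}"
  have "filter (\<lambda>j. j \<in> J) [1..<Suc (length Q)] = filter (\<lambda>j. j \<in> J') [1..<Suc (length Q)]"
  proof (rule filter_cong[OF refl])
    fix x assume "x \<in> set [1..<Suc (length Q)]"
    then have "x \<in> {1..length Q}" by auto
    then show "x \<in> J \<longleftrightarrow> x \<in> J'" using eq by blast
  qed
  then show ?thesis unfolding subword_def by (rule arg_cong)
qed

lemma subword_split:
  assumes "1 \<le> l" "l \<le> length Q"
  shows "subword Q J = subword Q (J \<inter> {..<l}) @ (if l \<in> J then [letter Q l] else []) @ subword Q (J \<inter> {l<..})"
proof -
  have u: "[1..<Suc (length Q)] = [1..<l] @ [l] @ [Suc l..<Suc (length Q)]"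
    using assms upt_add_eq_append[of 1 l "Suc (length Q) - l"] by (simp add: upt_conv_Cons)
  have 1: "filter (\<lambda>j. j \<in> J \<inter> {..<l}) [1..<l] = filter (\<lambda>j. j \<in> J) [1..<l]"
    "filter (\<lambda>j. j \<in> J \<inter> {..<l}) [Suc l..<Suc (length Q)] = []"
    "filter (\<lambda>j. j \<in> J \<inter> {l<..}) [1..<l] = []"
    "filter (\<lambda>j. j \<in> J \<inter> {l<..}) [Suc l..<Suc (length Q)] = filter (\<lambda>j. j \<in> J) [Suc l..<Suc (length Q)]"
    by (auto intro!: filter_cong simp: filter_empty_conv)
  show ?thesis unfolding subword_def u filter_append map_append 1 by simp
qed

lemma subseq_map_filter:
  "\<lbrakk>subseq w (map f (filter P xs)); distinct xs\<rbrakk> \<Longrightarrow>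
    \<exists>A \<subseteq> {x \<in> set xs. P x}. w = map f (filter (\<lambda>x. x \<in> A) xs)"
proof (induction xs arbitrary: w)
  case Nil
  then show ?case by auto
next
  case (Cons x xs)
  have extend: "\<exists>A\<subseteq>{y \<in> set (x # xs). P y}. w = map f (filter (\<lambda>y. y \<in> A) (x # xs))"
    if w: "subseq w (map f (filter P xs))"
  proof -
    from Cons.IH[OF w] Cons.prems obtain A where A: "A \<subseteq> {y \<in> set xs. P y}" "w = map f (filter (\<lambda>y. y \<in> A) xs)"
      by auto
    have "x \<notin> A" using A Cons.prems by auto
    with A show ?thesis by (intro exI[of _ A]) auto
  qed
  show ?case
  proof (cases "P x \<and> w \<noteq> [] \<and> hd w = f x")
    case True
    then obtain w' where w: "w = f x # w'" by (cases w) auto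
    have "subseq w' (map f (filter P xs))" using Cons.prems(1) True w by simp
    from Cons.IH[OF this] Cons.prems obtain A where A: "A \<subseteq> {y \<in> set xs. P y}" "w' = map f (filter (\<lambda>y. y \<in> A) xs)"
      by auto
    have "filter (\<lambda>y. y \<in> insert x A) xs = filter (\<lambda>y. y \<in> A) xs"
      using Cons.prems(2) by (intro filter_cong) auto
    then show ?thesis using A w True by (intro exI[of _ "insert x A"]) auto
  next
    case False
    have "subseq w (map f (filter P xs))"
    proof (cases w)
      case (Cons a w')
      then show ?thesis using False Cons.prems by (auto simp: subseq_Cons2_iff split: if_splits)
    qed simp
    then show ?thesis by (rule extend)
  qed
qed

section \<open>Flips of root independent subwords of the longest element\<close>

locale longest_quadruple =
  fixes X :: "('w, 'n::finite) quadruple"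
  assumes D_fin: "X \<in> D_fin" and longest: "longest_element (grp X) (gens X) (elt X)"

sublocale longest_quadruple \<subseteq> finite_coxeter "grp X" "gens X"
  using D_fin by unfold_locales (auto simp: D_fin_def is_quadruple_def)

context longest_quadruple
begin

abbreviation "Q \<equiv> qword X"
abbreviation "I \<equiv> face X"
abbreviation "r \<equiv> root_fun X"
abbreviation "pre l \<equiv> subword Q ({1..<l} - I)"

lemma root_fun_eq: "r l = act (pre l) (\<alpha> (letter Q l))"
  by (simp add: root_fun_def)

lemma r_norm: "B (r l) (r l) = 1"
  unfolding root_fun_eq by (rule root_norm)

lemma reduced_factor: "reduced (u @ v @ w) \<Longrightarrow> reduced v"
  using reduced_appendD by blast

lemma face_positions: "I \<subseteq> positions Q"
  using D_fin by (auto simp: D_fin_def is_quadruple_def subword_complex_def)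

text \<open>If the reduced expression used only some of the positions outside the face, the face could be
  enlarged by the others.\<close>

lemma complement_reduced:
  "reduced (subword Q (positions Q - I))" "wp (subword Q (positions Q - I)) = elt X"
proof -
  let ?P = "positions Q"
  obtain w where w: "subseq w (subword Q (?P - I))" "reduced_expression (grp X) (gens X) w (elt X)"
    using D_fin by (auto simp: D_fin_def is_quadruple_def subword_complex_def)
  obtain A where A: "A \<subseteq> ?P - I" "w = subword Q A"
    using subseq_map_filter[OF w(1)[unfolded subword_def] distinct_upt] unfolding subword_def by blast
  have "?P - (?P - A) = A" using A by auto
  then have "?P - A \<in> subword_complex (grp X) (gens X) Q (elt X)"
    using w(2) A by (auto simp: subword_complex_def)
  moreover have "I \<subseteq> ?P - A" using A face_positions by auto
  ultimately have "?P - A = I" using D_fin by (auto simp: D_fin_def is_quadruple_def)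
  then have "w = subword Q (?P - I)" using \<open>?P - (?P - A) = A\<close> A by auto
  with w(2) show "reduced (subword Q (?P - I))" "wp (subword Q (?P - I)) = elt X"
    by (auto simp: reduced_expression_def reduced_def)
qed

lemma complement_split:
  assumes "l \<in> positions Q - I"
  shows "subword Q (positions Q - I) = pre l @ [letter Q l] @ subword Q ({l<..} - I)"
proof -
  have "subword Q (positions Q - I) = subword Q ((positions Q - I) \<inter> {..<l}) @ [letter Q l]
      @ subword Q ((positions Q - I) \<inter> {l<..})"
    using subword_split[of l Q "positions Q - I"] assms by (auto simp: positions_def)
  also have "subword Q ((positions Q - I) \<inter> {..<l}) = pre l"
    by (rule subword_cong) (auto simp: positions_def)
  also have "subword Q ((positions Q - I) \<inter> {l<..}) = subword Q ({l<..} - I)"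
    by (rule subword_cong) (auto simp: positions_def)
  finally show ?thesis .
qed

lemma prefix_split:
  assumes "l \<in> positions Q" "l < l'"
  shows "pre l' = pre l @ (if l \<in> I then [] else [letter Q l]) @ subword Q ({l<..<l'} - I)"
proof -
  have "pre l' = subword Q (({1..<l'} - I) \<inter> {..<l}) @ (if l \<in> I then [] else [letter Q l])
      @ subword Q (({1..<l'} - I) \<inter> {l<..})"
    using subword_split[of l Q "{1..<l'} - I"] assms by (auto simp: positions_def)
  also have "({1..<l'} - I) \<inter> {..<l} = {1..<l} - I" using assms by auto
  also have "({1..<l'} - I) \<inter> {l<..} = {l<..<l'} - I" using assms by (auto simp: positions_def)
  finally show ?thesis .
qed

lemma complement_root_nonneg: "l \<in> positions Q - I \<Longrightarrow> nonneg (r l)"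
proof -
  assume "l \<in> positions Q - I"
  then have "reduced ((pre l @ [letter Q l]) @ subword Q ({l<..} - I))"
    using complement_split complement_reduced(1) by simp
  from reduced_appendD(1)[OF this] show ?thesis unfolding root_fun_eq by (rule reduced_nonneg)
qed

lemma factor_nonneg:
  assumes "l \<in> positions Q - I" "l' \<in> positions Q - I" "l < l'"
  shows "nonneg (act (subword Q ({l<..<l'} - I)) (\<alpha> (letter Q l')))"
proof -
  let ?f = "subword Q ({l<..<l'} - I)"
  have "subword Q (positions Q - I) = (pre l @ [letter Q l]) @ (?f @ [letter Q l']) @ subword Q ({l'<..} - I)"
    using complement_split[OF assms(2)] prefix_split[of l l'] assms by simp
  then have "reduced (?f @ [letter Q l'])"
    using complement_reduced(1) reduced_factor[of "pre l @ [letter Q l]"] by (simp only:)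
  then show ?thesis by (rule reduced_nonneg)
qed

lemma complement_root_inj:
  assumes "l \<in> positions Q - I" "l' \<in> positions Q - I" "l < l'"
  shows "r l \<noteq> r l'"
proof
  assume eq: "r l = r l'"
  let ?f = "subword Q ({l<..<l'} - I)" and ?a = "letter Q l"
  define x where "x = act ?f (\<alpha> (letter Q l'))"
  have "pre l' = pre l @ [?a] @ ?f" using prefix_split[OF _ assms(3)] assms(1) by (simp only: Diff_iff if_False)
  then have "r l' = act (pre l) (\<sigma> ?a x)"
    unfolding root_fun_eq x_def by (simp only: act_append act_Cons act_Nil)
  then have "act (pre l) (\<alpha> ?a) = act (pre l) (\<sigma> ?a x)"
    using eq root_fun_eq[of l] by metis
  then have "\<alpha> ?a = \<sigma> ?a x" by (metis act_rev)
  then have "\<sigma> ?a (\<alpha> ?a) = x" by simp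
  then have "x = - \<alpha> ?a" by (simp add: simple_reflection_eq reflect_self)
  then show False using factor_nonneg[OF assms] nonneg_antisym[OF nonneg_simple, of ?a]
      root_nonzero[of "[]" ?a] unfolding x_def by simp
qed

lemma complement_root_sign:
  assumes "l \<in> positions Q - I" "l' \<in> positions Q - I" shows "r l \<noteq> - r l'"
proof
  assume "r l = - r l'"
  then have "nonneg (- r l')" using complement_root_nonneg[OF assms(1)] by simp
  then have "r l' = 0" using complement_root_nonneg[OF assms(2)] nonneg_antisym by blast
  then show False using root_nonzero root_fun_eq by metis
qed

text \<open>Reading a positive root backwards along the reduced word of the longest element makes it
  negative; it becomes a simple root just before its first change of sign.\<close>

lemma positive_root_in_complement:
  assumes v: "v = act w (\<alpha> b)" "nonneg v"
  shows "\<exists>l\<in>positions Q - I. r l = v"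
proof -
  define f where "f l = act (rev (pre l)) v" for l
  have f1: "f (Suc 0) = v" by (simp add: f_def subword_def)
  have f_root: "f l = act (rev (pre l) @ w) (\<alpha> b)" for l by (simp add: f_def v)
  have "pre (Suc (length Q)) = subword Q (positions Q - I)"
    by (rule subword_cong) (auto simp: positions_def)
  then have "nonneg (- f (Suc (length Q)))"
    using longest_negative[OF complement_reduced(1) _ v(2)] complement_reduced(2) longest by (simp add: f_def)
  then have last: "\<not> nonneg (f (Suc (length Q)))"
    using nonneg_antisym root_nonzero f_root by metis
  define l where "l = (LEAST l. \<not> nonneg (f (Suc l)))"
  have l: "\<not> nonneg (f (Suc l))" unfolding l_def by (rule LeastI[where P = "\<lambda>l. \<not> nonneg (f (Suc l))"]) (rule last)
  have l_le: "l \<le> length Q" unfolding l_def by (rule Least_le) (rule last)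
  have l1: "1 \<le> l" using l f1 v(2) by (cases l) auto
  have "\<not> \<not> nonneg (f (Suc (l - 1)))"
    by (rule not_less_Least) (use l1 in \<open>simp add: l_def[symmetric]\<close>)
  then have fl: "nonneg (f l)" using l1 by simp
  have snoc: "pre (Suc l) = pre l @ (if l \<in> I then [] else [letter Q l])"
    using prefix_split[of l "Suc l"] l1 l_le
    by (simp add: positions_def greaterThanLessThan_def lessThan_Suc_atMost Int_commute subword_def)
  have lI: "l \<notin> I" using snoc l fl by (auto simp: f_def)
  then have "f (Suc l) = \<sigma> (letter Q l) (f l)" using snoc by (simp add: f_def)
  then have "f l = \<alpha> (letter Q l)" using simple_sign_change[OF f_root fl] l by metis
  then have "r l = v" unfolding root_fun_eq f_def by (metis act_rev')
  then show ?thesis using lI l1 l_le by (auto simp: positions_def)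
qed

lemma ex_partner: "\<exists>l\<in>positions Q - I. r l = r i \<or> r l = - r i"
proof -
  consider "nonneg (r i)" | "nonneg (- r i)" using root_sign unfolding root_fun_eq by blast
  then show ?thesis
  proof cases
    case 1
    then show ?thesis using positive_root_in_complement root_fun_eq by metis
  next
    case 2
    have "- r i = act (pre i @ [letter Q i]) (\<alpha> (letter Q i))"
      by (simp add: root_fun_eq simple_reflection_eq reflect_self act_minus)
    then show ?thesis using positive_root_in_complement 2 by metis
  qed
qed

lemma in_root_line: "r l \<in> span {r i} \<longleftrightarrow> r l = r i \<or> r l = - r i"
proof
  assume "r l \<in> span {r i}"
  then obtain c where c: "r l = c *\<^sub>R r i" by (auto simp: span_singleton)
  then have "c\<^sup>2 = 1" using r_norm[of l] r_norm[of i] by (simp add: B_linear power2_eq_square)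
  then show "r l = r i \<or> r l = - r i" using c by (auto simp: power2_eq_1_iff)
next
  assume "r l = r i \<or> r l = - r i"
  moreover have "r i \<in> span {r i}" by (simp add: span_base)
  ultimately show "r l \<in> span {r i}" using span_neg by metis
qed

lemma face_root_eqD:
  assumes "l \<in> I" "i \<in> I" "r l = r i \<or> r l = - r i" shows "l = i"
proof (rule ccontr)
  assume "l \<noteq> i"
  have inj: "inj_on r I" and ind: "independent (r ` I)"
    using D_fin by (auto simp: D_fin_def root_independent_def)
  have "r i \<noteq> r l" using inj assms \<open>l \<noteq> i\<close> by (auto dest: inj_onD)
  then have "{r i} \<subseteq> r ` I - {r l}" using assms by auto
  then have "span {r i} \<subseteq> span (r ` I - {r l})" by (rule span_mono)
  moreover have "r l \<in> span {r i}" using assms(3) in_root_line by blast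
  ultimately have "r l \<in> span (r ` I - {r l})" by (rule subsetD)
  moreover have "r l \<in> r ` I" using assms(1) by (rule imageI)
  ultimately show False using ind unfolding dependent_def by blast
qed

text \<open>By root independence no other position of the face lies on the line of \<open>r i\<close>, and exactly one
  position outside the face does.\<close>

lemma flip_partner_props:
  assumes i: "i \<in> I"
  shows "flip_partner X i \<in> positions Q - I"
    and "r (flip_partner X i) = r i \<or> r (flip_partner X i) = - r i"
proof -
  obtain l where l: "l \<in> positions Q - I" "r l = r i \<or> r l = - r i" using ex_partner by blast
  have uniq: "l' = l" if l': "l' \<in> positions Q - I" "r l' = r i \<or> r l' = - r i" for l'
  proof -
    have "r l' = r l" using l l' complement_root_sign[OF l(1) l'(1)] complement_root_sign[OF l'(1) l(1)] by auto
    then show ?thesis using complement_root_inj[OF l(1) l'(1)] complement_root_inj[OF l'(1) l(1)]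
      by (metis nat_neq_iff)
  qed
  have flat: "flat X (span {r i}) = {i, l}"
  proof (rule Set.set_eqI)
    fix x
    show "x \<in> flat X (span {r i}) \<longleftrightarrow> x \<in> {i, l}"
    proof
      assume "x \<in> flat X (span {r i})"
      then have x: "x \<in> positions Q" "r x = r i \<or> r x = - r i" by (auto simp: flat_def in_root_line)
      show "x \<in> {i, l}" using x uniq face_root_eqD[OF _ i x(2)] by (cases "x \<in> I") simp_all
    next
      assume "x \<in> {i, l}"
      then show "x \<in> flat X (span {r i})"
        using l i face_positions unfolding flat_def in_root_line by auto
    qed
  qed
  have "flip_partner X i = l"
    unfolding flip_partner_def
  proof (rule the_equality)
    show "l \<in> positions Q - I \<and> flat X (span {r i}) = {i, l}" using l flat by simp
    show "i' = l" if "i' \<in> positions Q - I \<and> flat X (span {r i}) = {i, i'}" for i'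
    proof -
      have "{i, l} = {i, i'}" using that flat by simp
      then show ?thesis using that l(1) i by (simp add: doubleton_eq_iff) blast
    qed
  qed
  then show "flip_partner X i \<in> positions Q - I"
    "r (flip_partner X i) = r i \<or> r (flip_partner X i) = - r i" using l by auto
qed

text \<open>The roots outside the face are positive. Transporting the root at one of the two positions back to
  the other one gives the root of a factor of the reduced word, whose sign is known.\<close>

lemma flip_partner_sign:
  assumes i: "i \<in> I"
  shows "i < flip_partner X i \<Longrightarrow> r (flip_partner X i) = r i"
    and "flip_partner X i < i \<Longrightarrow> r (flip_partner X i) = - r i"
proof -
  let ?i = "flip_partner X i"
  note p = flip_partner_props[OF i]
  show "r ?i = r i" if lt: "i < ?i"
  proof (rule ccontr)
    assume "r ?i \<noteq> r i"
    then have eq: "r ?i = - r i" using p by simp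
    let ?f = "subword Q ({i<..<?i} - I)"
    have sp: "pre ?i = pre i @ ?f"
      using prefix_split[of i ?i] lt i face_positions by auto
    have "act (pre i) (act ?f (\<alpha> (letter Q ?i))) = act (pre i) (- \<alpha> (letter Q i))"
      using eq unfolding root_fun_eq sp by (simp add: act_minus)
    then have neg: "act ?f (\<alpha> (letter Q ?i)) = - \<alpha> (letter Q i)" by (metis act_rev)
    have "reduced (pre ?i @ [letter Q ?i])"
      using complement_split[OF p(1)] complement_reduced(1) reduced_appendD(1)[of "pre ?i @ [letter Q ?i]"] by simp
    then have "reduced (?f @ [letter Q ?i])" unfolding sp append_assoc by (rule reduced_appendD(2))
    then have "nonneg (- \<alpha> (letter Q i))" unfolding neg[symmetric] by (rule reduced_nonneg)
    then show False using nonneg_antisym[OF nonneg_simple] root_nonzero[of "[]"] by simp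
  qed
  show "r ?i = - r i" if lt: "?i < i"
  proof (rule ccontr)
    assume "r ?i \<noteq> - r i"
    then have eq: "r ?i = r i" using p by simp
    let ?f = "subword Q ({?i<..<i} - I)"
    have sp: "pre i = pre ?i @ [letter Q ?i] @ ?f"
      using prefix_split[of ?i i] lt p(1) by simp
    have "act (pre ?i) (\<sigma> (letter Q ?i) (act ?f (\<alpha> (letter Q i)))) = act (pre ?i) (\<alpha> (letter Q ?i))"
      using eq unfolding root_fun_eq sp by simp
    then have "act ?f (\<alpha> (letter Q i)) = - \<alpha> (letter Q ?i)"
      by (metis act_rev sigma_sq simple_reflection_eq reflect_self B_simple_self)
    then have neg: "\<alpha> (letter Q i) = - act (rev ?f) (\<alpha> (letter Q ?i))" by (metis act_rev act_minus)
    have "subword Q (positions Q - I) = pre ?i @ [letter Q ?i] @ ?f @ subword Q ({i..} - I)"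
    proof -
      have "subword Q ({?i<..} - I) = subword Q (({?i<..} - I) \<inter> {..<i}) @ subword Q (({?i<..} - I) \<inter> {i<..})"
        using subword_split[of i Q "{?i<..} - I"] i face_positions by (auto simp: positions_def)
      also have "({?i<..} - I) \<inter> {..<i} = {?i<..<i} - I" by auto
      also have "({?i<..} - I) \<inter> {i<..} = {i..} - I"
      proof (rule Set.set_eqI)
        fix x show "x \<in> ({?i<..} - I) \<inter> {i<..} \<longleftrightarrow> x \<in> {i..} - I"
          using i lt by (cases "x = i") auto
      qed
      finally show ?thesis using complement_split[OF p(1)] by simp
    qed
    then have "reduced ([letter Q ?i] @ ?f)"
      using complement_reduced(1) reduced_factor[of "pre ?i" "[letter Q ?i] @ ?f"] by simp
    from reduced_rev[OF this] have "reduced (rev ?f @ [letter Q ?i])" by simp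
    then have "nonneg (- \<alpha> (letter Q i))" unfolding neg minus_minus by (rule reduced_nonneg)
    then show False using nonneg_antisym[OF nonneg_simple] root_nonzero[of "[]"] by simp
  qed
qed

text \<open>Conjugating a simple reflection by the preceding prefix gives the reflection in the root at the
  inserted position.\<close>

lemma act_insert:
  assumes "j \<in> positions Q" "j \<notin> J"
  shows "act (subword Q (insert j J)) v
    = reflect (act (subword Q (J \<inter> {..<j})) (\<alpha> (letter Q j))) (act (subword Q J) v)"
proof -
  have 1: "subword Q (insert j J) = subword Q (J \<inter> {..<j}) @ [letter Q j] @ subword Q (J \<inter> {j<..})"
    using subword_split[of j Q "insert j J"] assms by (simp add: positions_def)
  have 2: "subword Q J = subword Q (J \<inter> {..<j}) @ subword Q (J \<inter> {j<..})"
    using subword_split[of j Q J] assms by (simp add: positions_def)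
  show ?thesis unfolding 1 using 2 by (simp add: simple_reflection_eq act_reflect)
qed

text \<open>The prefixes of the two words differ by deleting the letter at \<open>i'\<close> or inserting the letter at \<open>i\<close>
  (or both). Each of the two operations is the reflection in \<open>\<plusminus>r i\<close>, so that they cancel beyond both
  positions.\<close>

lemma flip_root_fun:
  assumes i: "i \<in> I" and l: "l \<in> positions Q"
  shows "root_fun (flip X i) l =
    (if min i (flip_partner X i) < l \<and> l \<le> max i (flip_partner X i) then reflect (r i) (r l) else r l)"
proof -
  let ?i = "flip_partner X i"
  note p = flip_partner_props[OF i]
  have ip: "i \<in> positions Q" using i face_positions by auto
  have i1: "1 \<le> i" "1 \<le> ?i" using ip p(1) by (auto simp: positions_def)
  have ne: "?i \<noteq> i" "?i \<notin> I" using p i by auto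
  have refl: "reflect (r ?i) = reflect (r i)" using p(2) reflect_minus by metis
  let ?J = "{1..<l} - I" and ?J' = "{1..<l} - ((I - {i}) \<union> {?i})"
  have Y: "root_fun (flip X i) l = act (subword Q ?J') (\<alpha> (letter Q l))"
    by (simp add: root_fun_def flip_def)
  consider "l \<le> i" "l \<le> ?i" | "i < l" "l \<le> ?i" | "?i < l" "l \<le> i" | "i < l" "?i < l" by linarith
  then show ?thesis
  proof cases
    case 1
    then have "?J' = ?J" by auto
    moreover have "\<not> min i ?i < l" using 1 by simp
    ultimately show ?thesis using Y by (simp add: root_fun_eq)
  next
    case 2
    have J': "?J' = insert i ?J" using 2 i1 by auto
    have "?J \<inter> {..<i} = {1..<i} - I" using 2 by auto
    then show ?thesis using Y act_insert[OF ip, of ?J] i 2 J' by (simp add: root_fun_eq)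
  next
    case 3
    have J: "?J = insert ?i ?J'" using 3 i1 ne by auto
    have "?J' \<inter> {..<?i} = {1..<?i} - I" using 3 by auto
    then have "act (subword Q ?J) v = reflect (r ?i) (act (subword Q ?J') v)" for v
      using act_insert[of ?i ?J'] p(1) J by (simp add: root_fun_eq)
    then have "reflect (r i) (r l) = act (subword Q ?J') (\<alpha> (letter Q l))"
      using refl reflect_involution[OF r_norm] by (simp add: root_fun_eq)
    then show ?thesis using Y 3 by simp
  next
    case 4
    let ?Z = "?J - {?i}"
    have J: "?J = insert ?i ?Z" "?J' = insert i ?Z" using 4 i1 ne by auto
    have c: "?Z \<inter> {..<?i} = {1..<?i} - I" using 4 by auto
    have a: "act (subword Q ?J) v = reflect (r i) (act (subword Q ?Z) v)" for v
      using act_insert[of ?i ?Z] p(1) J(1) c refl by (simp add: root_fun_eq)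
    have b: "reflect (act (subword Q (?Z \<inter> {..<i})) (\<alpha> (letter Q i))) = reflect (r i)"
    proof (cases "?i < i")
      case False
      then have "?Z \<inter> {..<i} = {1..<i} - I" using 4 by auto
      then show ?thesis by (simp add: root_fun_eq)
    next
      case True
      let ?Z' = "?Z \<inter> {..<i}"
      have J2: "{1..<i} - I = insert ?i ?Z'" using 4 ne True i1 by auto
      have "?Z' \<inter> {..<?i} = {1..<?i} - I" using 4 True by auto
      then have "r i = reflect (r i) (act (subword Q ?Z') (\<alpha> (letter Q i)))"
        using act_insert[of ?i ?Z'] p(1) J2 refl by (simp add: root_fun_eq)
      then have "act (subword Q ?Z') (\<alpha> (letter Q i)) = - r i"
        using reflect_involution[OF r_norm] reflect_self[OF r_norm] by metis
      then show ?thesis by (simp add: reflect_minus)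
    qed
    have "act (subword Q ?J') v = reflect (r i) (act (subword Q ?Z) v)" for v
      using act_insert[OF ip, of ?Z] J(2) b i by simp
    then have "act (subword Q ?J') v = act (subword Q ?J) v" for v using a by simp
    moreover have "\<not> l \<le> max i ?i" using 4 by simp
    ultimately show ?thesis using Y by (simp add: root_fun_eq)
  qed
qed

lemma adjacent_root_form:
  assumes "a \<in> I" "b \<in> I" "a \<noteq> b"
  shows "adjacent (root_quiver X) a b \<longleftrightarrow> root_form X a b \<noteq> 0"
proof -
  have "root_form X b a = root_form X a b" by (simp add: root_form_def B_sym)
  then show ?thesis using assms
    by (auto simp: adjacent_def root_quiver_def zero_less_mult_iff mult_less_0_iff)
qed

lemma root_quiver_antisym: "(a, b) \<in> arrows (root_quiver X) \<Longrightarrow> (b, a) \<notin> arrows (root_quiver X)"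
  by (auto simp: root_quiver_def root_form_def B_sym zero_less_mult_iff)

text \<open>Arrows between other vertices could change only between a vertex inside the interval and one
  outside, both adjacent to \<open>i\<close>; this is excluded for special \<open>i\<close>. For the arrows at \<open>i\<close>, a vertex
  inside the interval changes its order relative to \<open>i\<close> and a vertex outside changes the sign of its
  form with the root of \<open>i\<close>: both reverse the arrow.\<close>

theorem flip_special_quiver:
  assumes special: "special_vertex X i"
  defines "\<rho> \<equiv> id(i := flip_partner X i)"
  shows "i \<in> I" "flip_partner X i \<notin> I"
    and "verts (root_quiver (flip X i)) = \<rho> ` I"
    and "\<And>a b. a \<in> I \<Longrightarrow> b \<in> I \<Longrightarrow> (\<rho> a, \<rho> b) \<in> arrows (root_quiver (flip X i)) \<longleftrightarrow>
      (if a = i \<or> b = i then (b, a) \<in> arrows (root_quiver X) else (a, b) \<in> arrows (root_quiver X))"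
proof -
  let ?i = "flip_partner X i" and ?Y = "flip X i"
  show i: "i \<in> I" using special by (simp add: special_vertex_def root_quiver_def)
  note p = flip_partner_props[OF i]
  show ne: "?i \<notin> I" using p by simp
  have fY: "face ?Y = (I - {i}) \<union> {?i}" by (simp add: flip_def)
  show "verts (root_quiver ?Y) = \<rho> ` I"
    using i by (auto simp: root_quiver_def fY \<rho>_def)
  let ?in = "\<lambda>l. min i ?i < l \<and> l \<le> max i ?i"
  have ip: "i \<in> positions Q" "?i \<noteq> i" using i face_positions p ne by auto
  have formY: "root_form ?Y a b = B (root_fun ?Y a) (root_fun ?Y b)" for a b
    by (simp add: root_form_def flip_def)
  have rY: "root_fun ?Y a = (if ?in a then reflect (r i) (r a) else r a)" if "a \<in> I" for a
    using flip_root_fun[OF i] that face_positions by auto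
  have rYi: "root_fun ?Y ?i = - r i"
  proof (cases "i < ?i")
    case True
    then show ?thesis using flip_root_fun[OF i, of ?i] p flip_partner_sign(1)[OF i True] reflect_self[OF r_norm] by simp
  next
    case False
    then have "?i < i" using ip by simp
    then show ?thesis using flip_root_fun[OF i, of ?i] p flip_partner_sign(2)[OF i] by simp
  qed
  have orth: "B (r i) (r a) = 0 \<or> B (r i) (r b) = 0" if ab: "a \<in> I - {i}" "b \<in> I - {i}" "?in a" "\<not> ?in b" for a b
  proof (rule ccontr)
    assume c: "\<not> ?thesis"
    have "adjacent (root_quiver X) i a" "adjacent (root_quiver X) i b"
      using c ab i adjacent_root_form by (auto simp: root_form_def)
    moreover have "a \<in> reflection_interval X i" using ab by (auto simp: reflection_interval_def)
    moreover have "b \<notin> reflection_interval X i"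
      using ab ne by (auto simp: reflection_interval_def min_def max_def split: if_splits)
    moreover have "b \<in> positions Q" using ab face_positions by auto
    ultimately show False using special unfolding special_vertex_def stable_interval_def by blast
  qed
  have old: "root_form ?Y a b = root_form X a b" if ab: "a \<in> I - {i}" "b \<in> I - {i}" for a b
  proof -
    have "B (reflect (r i) (r a)) (r b) = B (r a) (r b)" if "B (r i) (r a) = 0 \<or> B (r i) (r b) = 0"
      using that by (auto simp: reflect_def B_linear)
    moreover have "B (r a) (reflect (r i) (r b)) = B (r a) (r b)" if "B (r i) (r a) = 0 \<or> B (r i) (r b) = 0"
      using that by (auto simp: reflect_def B_linear B_sym[of "r a" "r i"])
    ultimately show ?thesis
      using orth[OF ab] orth[OF ab(2,1)] reflect_isometry[OF r_norm] ab
      by (auto simp: formY rY root_form_def[of X])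
  qed
  have new: "(real ?i - real a) * root_form ?Y ?i a > 0 \<longleftrightarrow> (real a - real i) * root_form X i a > 0"
    if a: "a \<in> I - {i}" for a
  proof (cases "?in a")
    case True
    have "a \<noteq> ?i" "a \<noteq> i" using a ne by auto
    have "root_form ?Y ?i a = B (reflect (r i) (r i)) (reflect (r i) (r a))"
      using True a by (simp add: formY rYi rY reflect_self[OF r_norm])
    also have "\<dots> = root_form X i a" by (simp add: reflect_isometry[OF r_norm] root_form_def)
    finally show ?thesis using True \<open>a \<noteq> ?i\<close> \<open>a \<noteq> i\<close>
      by (auto simp: zero_less_mult_iff min_def max_def split: if_splits)
  next
    case False
    have "a \<noteq> ?i" "a \<noteq> i" using a ne by auto
    have "root_form ?Y ?i a = - root_form X i a"
    proof -
      have "root_fun ?Y a = r a" using rY[of a] a unfolding if_not_P[OF False] by simp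
      then show ?thesis by (simp add: formY rYi B_linear root_form_def[of X])
    qed
    then show ?thesis using False \<open>a \<noteq> ?i\<close> \<open>a \<noteq> i\<close>
      by (auto simp: zero_less_mult_iff mult_less_0_iff min_def max_def not_less split: if_splits)
  qed
  have symX: "root_form X a b = root_form X b a" and symY: "root_form ?Y a b = root_form ?Y b a" for a b
    unfolding formY by (simp_all add: root_form_def B_sym)
  show "(\<rho> a, \<rho> b) \<in> arrows (root_quiver ?Y) \<longleftrightarrow>
      (if a = i \<or> b = i then (b, a) \<in> arrows (root_quiver X) else (a, b) \<in> arrows (root_quiver X))"
    if ab: "a \<in> I" "b \<in> I" for a b
  proof -
    consider "a = i" "b = i" | "a = i" "b \<in> I - {i}" | "a \<in> I - {i}" "b = i" | "a \<in> I - {i}" "b \<in> I - {i}"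
      using ab by blast
    then show ?thesis
    proof cases
      case 1 then show ?thesis by (simp add: root_quiver_def \<rho>_def)
    next
      case 2 then show ?thesis using new[of b] i symX[of b i] by (simp add: root_quiver_def \<rho>_def fY)
    next
      case 3
      have "(real a - real ?i) * root_form ?Y a ?i = - ((real ?i - real a) * root_form ?Y ?i a)"
        "(real i - real a) * root_form X i a = - ((real a - real i) * root_form X i a)"
        by (simp_all add: symY[of a] algebra_simps)
      moreover have "(real ?i - real a) * root_form ?Y ?i a < 0 \<longleftrightarrow> (real a - real i) * root_form X i a < 0"
      proof (cases "root_form X i a = 0")
        case True
        then have "\<not> (real ?i - real a) * root_form ?Y ?i a > 0" using new[OF 3(1)] by simp
        moreover have "root_form ?Y ?i a = 0"
          using True 3 by (simp add: formY rYi rY B_linear root_form_def[of X] reflect_def r_norm)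
        ultimately show ?thesis using True by simp
      next
        case False
        have "root_form ?Y ?i a \<noteq> 0"
          using False 3 by (auto simp: formY rYi rY B_linear root_form_def[of X] reflect_def r_norm)
        moreover have "real ?i \<noteq> real a" "real a \<noteq> real i" using 3 ne by auto
        ultimately show ?thesis using new[OF 3(1)] False
          by (metis less_irrefl linorder_neqE_linordered_idom mult_eq_0_iff order_less_asym right_minus_eq)
      qed
      ultimately show ?thesis using 3 i by (auto simp add: root_quiver_def \<rho>_def fY)
    next
      case 4 then show ?thesis using old[OF 4] by (auto simp: root_quiver_def \<rho>_def fY)
    qed
  qed
qed

end

section \<open>Flips at special vertices and Hall algebras\<close>

theorem corollary3p30:
  fixes X :: "('w, 'n::finite) quadruple" and i :: nat
  assumes "X \<in> D_fin"
    and "longest_element (grp X) (gens X) (elt X)"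
    and "tree_type (root_quiver X)"
    and "special_vertex X i"
  shows "\<exists>\<phi> :: (sobj set \<Rightarrow> 'k::field_char_0) \<Rightarrow> (sobj set \<Rightarrow> 'k).
           \<phi> \<in> algebra_iso (hall_algebra (root_quiver X)) (hall_algebra (root_quiver (flip X i)))"
proof -
  interpret longest_quadruple X
    using assms by unfold_locales
  \<comment> \<open>The arrows of the source serve as reference direction, so that \<open>D\<close> is all of \<open>R\<close> for \<open>X\<close>.\<close>
  define R where "R = arrows (root_quiver X)"
  define \<rho> where "\<rho> = id(i := flip_partner X i)"
  define D where "D = {(a, b) \<in> R. a \<noteq> i \<and> b \<noteq> i}"
  define F where "F = {(a, b) \<in> R. a = i \<or> b = i}"
  have V: "verts (root_quiver X) = face X" by (simp add: root_quiver_def)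
  have ne: "flip_partner X i \<notin> face X" using flip_special_quiver(2)[OF assms(4)] .
  have VY: "verts (root_quiver (flip X i)) = \<rho> ` face X"
    using flip_special_quiver(3)[OF assms(4)] by (simp add: \<rho>_def)
  have AY: "(\<rho> a, \<rho> b) \<in> arrows (root_quiver (flip X i)) \<longleftrightarrow> (if a = i \<or> b = i then (b, a) \<in> R else (a, b) \<in> R)"
    if "a \<in> face X" "b \<in> face X" for a b
    using flip_special_quiver(4)[OF assms(4) that] by (simp add: \<rho>_def R_def)
  have anti: "(b, a) \<notin> R" if "(a, b) \<in> R" for a b
    using root_quiver_antisym that by (simp add: R_def)
  have adj: "adjacent (root_quiver X) a b \<longleftrightarrow> (a, b) \<in> R \<union> R\<inverse>" for a b
    by (auto simp: adjacent_def R_def)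
  have forest: "forest (face X) R"
  proof
    show "finite (face X)" using face_positions by (rule finite_subset) (simp add: positions_def)
    show "R \<subseteq> face X \<times> face X" by (auto simp: R_def root_quiver_def)
    show "(b, a) \<notin> R" if "(a, b) \<in> R" for a b using anti[OF that] .
    show False if vs: "length vs \<ge> 3" "distinct vs" "set vs \<subseteq> face X"
      "successively (\<lambda>a b. (a, b) \<in> R \<union> R\<inverse>) vs" "(last vs, hd vs) \<in> R \<union> R\<inverse>" for vs
    proof -
      have "\<forall>k. Suc k < length vs \<longrightarrow> adjacent (root_quiver X) (vs ! k) (vs ! Suc k)"
        using vs(4) unfolding adj successively_conv_nth by simp
      then show False using assms(3) vs(1-3,5) unfolding tree_type_def adj V by blast
    qed
  qed
  have "oriented_forest_axioms (face X) R (root_quiver X) R id"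
  proof
    show "arrows (root_quiver X) \<subseteq> verts (root_quiver X) \<times> verts (root_quiver X)"
      by (auto simp: root_quiver_def)
  qed (simp_all add: V R_def)
  then have X: "oriented_forest (face X) R (root_quiver X) R id"
    using forest by (simp add: oriented_forest_def)
  have "oriented_forest_axioms (face X) R (root_quiver (flip X i)) D \<rho>"
  proof
    show "D \<subseteq> R" by (auto simp: D_def)
    show "bij_betw \<rho> (face X) (verts (root_quiver (flip X i)))"
      unfolding VY by (rule inj_on_imp_bij_betw) (use ne in \<open>auto simp: \<rho>_def inj_on_def\<close>)
    show "arrows (root_quiver (flip X i)) \<subseteq> verts (root_quiver (flip X i)) \<times> verts (root_quiver (flip X i))"
      by (auto simp: root_quiver_def)
    show "(\<rho> a, \<rho> b) \<in> arrows (root_quiver (flip X i)) \<longleftrightarrow> (a, b) \<in> D \<or> (b, a) \<in> R - D"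
      if "a \<in> face X" "b \<in> face X" for a b
      unfolding AY[OF that] by (auto simp: D_def)
  qed
  then have Y: "oriented_forest (face X) R (root_quiver (flip X i)) D \<rho>"
    using forest by (simp add: oriented_forest_def)
  have "arrow_reversal_axioms R R D F"
    by unfold_locales (auto simp: D_def F_def)
  then interpret reversed: arrow_reversal "face X" R "root_quiver X" R id "root_quiver (flip X i)" D \<rho> F
    using X Y by (simp add: arrow_reversal_def)
  show ?thesis using reversed.reversal_algebra_iso by blast
qed

end
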